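(* Let $g$ and $h$ be rational functions with either $\deg(g)>1$ or $\deg(h)>2$, and $2\deg(g)\neq\deg(h)$. Then, for $|\varepsilon|$ small enough, the map $$H_\varepsilon(x,y)=\left(y,-x+\sqrt{y^2+1+\varepsilon h(y)}+\varepsilon\,g(y)\right)$$ is not $\mathcal{C}^{6}$-locally integrable at its elliptic fixed point.
   Context: $H_\varepsilon$ is a real planar map depending on a real parameter $\varepsilon$. For a rational function $g=P/Q$, with $P,Q$ polynomials, $\deg(g)=\deg(P)-\deg(Q)$. Elliptic fixed point: a fixed point $p$ of a planar map such that the eigenvalues of the linear part of the map at $p$ lie on the unit circle of $\mathbb{C}$ and are different from $\pm1$. A planar map $F$ is $\mathcal{C}^m$-locally integrable at an elliptic fixed point $p$ ($m\ge2$) if there exist a neighborhood $\mathcal{U}$ of $p$ and a locally non-constant real valued function $V\in\mathcal{C}^m(\mathcal{U})$ (called first integral) such that $V(F(x))=V(x)$, all the level curves $\{V=c\}\cap\mathcal{U}$ are closed curves surrounding $p$ and, moreover, $p$ is an isolated non-degenerate critical point of $V$ in $\mathcal{U}$.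
   Formalization: It is assumed that H_0, on the domain where g and h are defined, has an elliptic fixed point (that is, 1/√3 is not a pole of g or h; otherwise "its elliptic fixed point" is undefined); the claim is for the unique elliptic fixed point of H_ε near it. *)

theory Defs
  imports "HOL-Analysis.Analysis" "HOL-Computational_Algebra.Polynomial_Factorial"
    "HOL-Computational_Algebra.Field_as_Ring"
begin

section \<open>Rational functions of one real variable\<close>

text \<open>A rational function is an element of the fraction field of the real polynomials.
  Degree, poles and values are read off its representation in lowest terms.\<close>

type_synonym ratfun = "real poly fract"

definition rat_num :: "ratfun \<Rightarrow> real poly" where
  "rat_num g = fst (quot_of_fract g)"

definition rat_den :: "ratfun \<Rightarrow> real poly" where
  "rat_den g = snd (quot_of_fract g)"

text \<open>The zero function gets degree 0 here, since the zero polynomial has degree 0 in the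
  library and the denominator is then 1. This is not the usual convention of minus infinity.\<close>

definition rat_degree :: "ratfun \<Rightarrow> int" where
  "rat_degree g = int (degree (rat_num g)) - int (degree (rat_den g))"

definition rat_defined_at :: "ratfun \<Rightarrow> real \<Rightarrow> bool" where
  "rat_defined_at g y \<longleftrightarrow> poly (rat_den g) y \<noteq> 0"

definition rat_eval :: "ratfun \<Rightarrow> real \<Rightarrow> real" where
  "rat_eval g y = poly (rat_num g) y / poly (rat_den g) y"


section \<open>Functions of class \<open>C\<^sup>m\<close> on an open set\<close>

text \<open>All directional derivatives are iterated, which on an open set of a Euclidean space is
  the same as requiring continuous partial derivatives up to order \<open>m\<close>.\<close>

fun Cm_on :: "nat \<Rightarrow> ('a::euclidean_space \<Rightarrow> 'b::real_normed_vector) \<Rightarrow> 'a set \<Rightarrow> bool" where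
  "Cm_on 0 f U \<longleftrightarrow> continuous_on U f"
| "Cm_on (Suc m) f U \<longleftrightarrow>
     (\<forall>x\<in>U. f differentiable (at x)) \<and>
     (\<forall>v. Cm_on m (\<lambda>x. frechet_derivative f (at x) v) U)"


section \<open>Elliptic fixed points and local integrability of planar maps\<close>

text \<open>A planar map is given by a function \<open>F\<close> together with its domain of definition \<open>D\<close>.\<close>

definition complex_eigenvalue :: "real^2^2 \<Rightarrow> complex \<Rightarrow> bool" where
  "complex_eigenvalue A l \<longleftrightarrow>
     (\<exists>v::complex^2. v \<noteq> 0 \<and> (\<chi> i j. complex_of_real (A $ i $ j)) *v v = l *s v)"

definition elliptic_fixed_point :: "(real^2) set \<Rightarrow> (real^2 \<Rightarrow> real^2) \<Rightarrow> real^2 \<Rightarrow> bool" where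
  "elliptic_fixed_point D F p \<longleftrightarrow>
     p \<in> interior D \<and> F p = p \<and> F differentiable (at p) \<and>
     (\<forall>l. complex_eigenvalue (matrix (frechet_derivative F (at p))) l \<longrightarrow>
            cmod l = 1 \<and> l \<noteq> 1 \<and> l \<noteq> -1)"

definition critical_point :: "(real^2 \<Rightarrow> real) \<Rightarrow> real^2 \<Rightarrow> bool" where
  "critical_point V x \<longleftrightarrow> (V has_derivative (\<lambda>_. 0)) (at x)"

definition hessian :: "(real^2 \<Rightarrow> real) \<Rightarrow> real^2 \<Rightarrow> real^2^2" where
  "hessian V x =
     (\<chi> i j. frechet_derivative (\<lambda>z. frechet_derivative V (at z) (axis i 1)) (at x) (axis j 1))"

definition closed_curve_around :: "real^2 \<Rightarrow> (real^2) set \<Rightarrow> bool" where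
  "closed_curve_around p C \<longleftrightarrow>
     (\<exists>\<gamma>. simple_path \<gamma> \<and> pathfinish \<gamma> = pathstart \<gamma> \<and> path_image \<gamma> = C \<and> p \<in> inside C)"

text \<open>\<open>V\<close> lives on \<open>U\<close> only, so invariance is required at the points of \<open>U\<close> whose image is
  again in \<open>U\<close>. The level sets are those through the points of \<open>U\<close> other than \<open>p\<close>; this forces
  the level set of \<open>p\<close> itself to be just \<open>p\<close>. The notion is meant for \<open>m \<ge> 2\<close>.\<close>

definition first_integral_on ::
  "nat \<Rightarrow> (real^2 \<Rightarrow> real^2) \<Rightarrow> real^2 \<Rightarrow> (real^2) set \<Rightarrow> (real^2 \<Rightarrow> real) \<Rightarrow> bool" where
  "first_integral_on m F p U V \<longleftrightarrow>
     Cm_on m V U \<and>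
     (\<forall>W. open W \<and> W \<noteq> {} \<and> W \<subseteq> U \<longrightarrow> \<not> V constant_on W) \<and>
     (\<forall>x\<in>U. F x \<in> U \<longrightarrow> V (F x) = V x) \<and>
     (\<forall>x\<in>U - {p}. closed_curve_around p {z\<in>U. V z = V x}) \<and>
     critical_point V p \<and>
     det (hessian V p) \<noteq> 0 \<and>
     (\<exists>e>0. \<forall>x\<in>ball p e \<inter> U - {p}. \<not> critical_point V x)"

definition locally_integrable_at ::
  "nat \<Rightarrow> (real^2) set \<Rightarrow> (real^2 \<Rightarrow> real^2) \<Rightarrow> real^2 \<Rightarrow> bool" where
  "locally_integrable_at m D F p \<longleftrightarrow>
     (\<exists>U V. open U \<and> p \<in> U \<and> U \<subseteq> D \<and> first_integral_on m F p U V)"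


section \<open>The perturbed Cohen map\<close>

definition H_map :: "ratfun \<Rightarrow> ratfun \<Rightarrow> real \<Rightarrow> real^2 \<Rightarrow> real^2" where
  "H_map g h \<epsilon> v =
     (let x = v $ 1; y = v $ 2 in
        vector [y, - x + sqrt (y\<^sup>2 + 1 + \<epsilon> * rat_eval h y) + \<epsilon> * rat_eval g y])"

text \<open>The natural domain, needed because the library's \<open>sqrt\<close> and division are total. Poles of
  \<open>g\<close> and \<open>h\<close> are excluded for every \<open>\<epsilon>\<close>, also for \<open>\<epsilon> = 0\<close>. So the only possible fixed point
  for \<open>\<epsilon> = 0\<close>, whose two coordinates are \<open>1 / sqrt 3\<close>, belongs to the domain iff \<open>g\<close> and \<open>h\<close>
  have no pole at \<open>1 / sqrt 3\<close>; it is then elliptic, with trace 1/2 of the linear part. For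
  small \<open>\<epsilon>\<close> the elliptic fixed point of the map is the continuation of this one. The map can
  have further elliptic fixed points, which go to infinity or to poles of \<open>g\<close> or \<open>h\<close> as
  \<open>\<epsilon>\<close> tends to 0.\<close>

definition H_dom :: "ratfun \<Rightarrow> ratfun \<Rightarrow> real \<Rightarrow> (real^2) set" where
  "H_dom g h \<epsilon> =
     {v. rat_defined_at g (v $ 2) \<and> rat_defined_at h (v $ 2) \<and>
         (v $ 2)\<^sup>2 + 1 + \<epsilon> * rat_eval h (v $ 2) \<ge> 0}"

end

theory Submission
  imports Defs "HOL-Library.Landau_Symbols"
begin

text \<open>Near the elliptic fixed point, a first integral with non-degenerate Hessian is, after a linear
  change of coordinates, a multiple of \<open>|z|\<^sup>2\<close> to second order, so it confines the orbits and is
  strictly monotone along rays. The third-order normal form of the map is the rotation by the angle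
  \<open>\<omega> + B |w|\<^sup>2\<close>, and \<open>B \<noteq> 0\<close> at \<open>\<epsilon> = 0\<close>, hence for all small \<open>\<epsilon>\<close>. For every
  large \<open>N\<close> the total angle of \<open>N\<close> steps thus varies by more than one turn along each ray, which
  yields a point of period \<open>N\<close> on it, so there are infinitely many of them.

  On the other hand, the points of period \<open>N\<close> are finite in number. They satisfy polynomial
  equations in the coordinates \<open>x 0, ..., x (N-1)\<close> of the orbit. For \<open>\<epsilon> \<noteq> 0\<close> the degree
  assumptions make a pure power of \<open>x n\<close> the only term of top degree. For \<open>\<epsilon> = 0\<close> the equations
  are \<open>(x (n+2) + x n)\<^sup>2 - (x (n+1))\<^sup>2 = 1\<close>, whose top-degree forms split into linear factors
  and have no common zero besides the origin if \<open>3\<close> does not divide \<open>N\<close>. In both cases a power of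
  each coordinate is a polynomial of lower degree on the solution set, so the polynomial functions on
  it form a finite-dimensional space.\<close>

section \<open>Polynomial functions on a set of real sequences\<close>

text \<open>At \<epsilon> = 0 the restriction on the period cannot be dropped from this argument:
  the factors \<open>x (n+2) + x (n+1) + x n\<close> vanish together on the sequence s, t, -s-t
  repeated with period 3. For \<epsilon> \<noteq> 0, write g = P/Q and h = R/T and remove the square
  root and the denominators. The part that involves only y = \<open>x (n+1)\<close> is \<epsilon>^2
  T P^2 - \<epsilon> Q^2 R - Q^2 T (y^2 + 1). The condition 2 deg g \<noteq> deg h keeps the first
  two terms from cancelling, and deg g > 1 or deg h > 2 lets the larger of them dominate the third
  as well as every term that contains \<open>x n\<close> or \<open>x (n+2)\<close>. The twist comes
  from the square root alone: at \<epsilon> = 0 the fixed point has cos \<omega> = 1/4, and 2 sin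
  \<omega> times the twist coefficient is 15/64. The normal form has to avoid the resonances cos
  2\<omega> = cos \<omega> and cos 3\<omega> = cos \<omega>; both are excluded by 0 < cos \<omega> <
  1/2, which persists for small \<epsilon>.\<close>

lemma homogeneous_system_nontrivial_solution:
  fixes c :: "'k \<Rightarrow> 'b \<Rightarrow> 'f::field"
  assumes "finite B" "finite K" "card B < card K"
  shows "\<exists>a. (\<exists>k\<in>K. a k \<noteq> 0) \<and> (\<forall>b\<in>B. (\<Sum>k\<in>K. a k * c k b) = 0)"
  using assms
proof (induction B arbitrary: K c rule: finite_induct)
  case empty
  then have "K \<noteq> {}" by auto
  then show ?case by (intro exI[of _ "\<lambda>_. 1"]) auto
next
  case (insert b B)
  show ?case
  proof (cases "\<forall>k\<in>K. c k b = 0")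
    case True
    have "card B < card K" using insert by simp
    then obtain a where "\<exists>k\<in>K. a k \<noteq> 0" "\<forall>b\<in>B. (\<Sum>k\<in>K. a k * c k b) = 0"
      using insert.IH[OF insert.prems(1)] by blast
    moreover have "(\<Sum>k\<in>K. a k * c k b) = 0" using True by simp
    ultimately show ?thesis by auto
  next
    case False
    then obtain k0 where k0: "k0 \<in> K" "c k0 b \<noteq> 0" by auto
    let ?K = "K - {k0}"
    have "card B < card ?K" "finite ?K" using insert k0 by auto
    \<comment> \<open>Gaussian elimination: equation \<open>b\<close> is solved for the unknown
      \<open>k0\<close>, whose value is substituted into the other equations.\<close>
    from insert.IH[OF this(2,1), of "\<lambda>k d. c k d - c k b / c k0 b * c k0 d"]
    obtain a where a: "\<exists>k\<in>?K. a k \<noteq> 0"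
      "\<And>d. d \<in> B \<Longrightarrow> (\<Sum>k\<in>?K. a k * (c k d - c k b / c k0 b * c k0 d)) = 0" by blast
    define a' where "a' = a(k0 := - (\<Sum>k\<in>?K. a k * c k b) / c k0 b)"
    have split: "(\<Sum>k\<in>K. a' k * c k d) = a' k0 * c k0 d + (\<Sum>k\<in>?K. a k * c k d)" for d
      using k0 insert.prems(1) by (subst sum.remove[of K k0]) (auto simp: a'_def intro: sum.cong)
    have "(\<Sum>k\<in>K. a' k * c k d) = 0" if "d \<in> insert b B" for d
    proof (cases "d = b")
      case True
      then show ?thesis unfolding split using k0 by (simp add: a'_def)
    next
      case False
      then have "0 = (\<Sum>k\<in>?K. a k * (c k d - c k b / c k0 b * c k0 d))" using a that by auto
      also have "\<dots> = (\<Sum>k\<in>?K. a k * c k d) - (\<Sum>k\<in>?K. a k * c k b) / c k0 b * c k0 d"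
        by (simp add: algebra_simps sum_subtractf sum_distrib_left sum_distrib_right sum_divide_distrib)
      finally show ?thesis unfolding split by (simp add: a'_def algebra_simps)
    qed
    moreover have "\<exists>k\<in>K. a' k \<noteq> 0" using a(1) by (auto simp: a'_def)
    ultimately show ?thesis by blast
  qed
qed

text \<open>Membership depends only on the values on \<open>S\<close> (rule \<open>cong\<close>), so
  an equation valid on \<open>S\<close> can lower the degree bound \<open>d\<close>. This is how the
  relations along an orbit enter.\<close>

inductive polyfun_on :: "nat \<Rightarrow> (nat \<Rightarrow> real) set \<Rightarrow> nat \<Rightarrow> ((nat \<Rightarrow> real) \<Rightarrow> real) \<Rightarrow> bool"
  for m S where
  const: "polyfun_on m S d (\<lambda>_. c)"
| var_times: "i < m \<Longrightarrow> polyfun_on m S d f \<Longrightarrow> polyfun_on m S (Suc d) (\<lambda>x. x i * f x)"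
| add: "polyfun_on m S d f \<Longrightarrow> polyfun_on m S d f' \<Longrightarrow> polyfun_on m S d (\<lambda>x. f x + f' x)"
| Suc: "polyfun_on m S d f \<Longrightarrow> polyfun_on m S (Suc d) f"
| cong: "polyfun_on m S d f \<Longrightarrow> (\<And>x. x \<in> S \<Longrightarrow> f x = f' x) \<Longrightarrow> polyfun_on m S d f'"

section \<open>Closure properties of polynomial functions of bounded degree\<close>

lemma polyfun_on_mono: "polyfun_on m S d f \<Longrightarrow> d \<le> e \<Longrightarrow> polyfun_on m S e f"
  by (induction e) (auto simp: le_Suc_eq intro: polyfun_on.Suc)

lemma polyfun_on_cmult: "polyfun_on m S d f \<Longrightarrow> polyfun_on m S d (\<lambda>x. c * f x)"
proof (induction rule: polyfun_on.induct)
  case (var_times i d f)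
  from polyfun_on.var_times[OF this(1,3)] show ?case
    by (rule polyfun_on.cong) simp
next
  case (add d f f')
  from polyfun_on.add[OF add.IH] show ?case by (simp add: algebra_simps)
next
  case (cong d f f')
  show ?case by (rule polyfun_on.cong[OF cong.IH]) (simp add: cong)
qed (auto intro: polyfun_on.intros)

lemma polyfun_on_diff:
  "polyfun_on m S d f \<Longrightarrow> polyfun_on m S d f' \<Longrightarrow> polyfun_on m S d (\<lambda>x. f x - f' x)"
  using polyfun_on.add[OF _ polyfun_on_cmult[of m S d f' "-1"]] by simp

lemma polyfun_on_mult:
  "polyfun_on m S d f \<Longrightarrow> polyfun_on m S e f' \<Longrightarrow> polyfun_on m S (d + e) (\<lambda>x. f x * f' x)"
proof (induction rule: polyfun_on.induct)
  case (const d c)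
  then show ?case by (auto intro: polyfun_on_mono polyfun_on_cmult)
next
  case (var_times i d f)
  from polyfun_on.var_times[OF this(1) var_times.IH[OF var_times.prems]] show ?case
    by (simp add: mult.assoc)
next
  case (add d f f')
  then show ?case using polyfun_on.add by (simp add: algebra_simps)
next
  case (cong d f g)
  show ?case by (rule polyfun_on.cong[OF cong.IH[OF cong.prems]]) (simp add: cong)
qed (auto intro: polyfun_on.intros)

lemma polyfun_on_var: "i < m \<Longrightarrow> polyfun_on m S (Suc 0) (\<lambda>x. x i)"
  using polyfun_on.var_times[OF _ polyfun_on.const[of m S 0 1]] by simp

lemma polyfun_on_power: "polyfun_on m S d f \<Longrightarrow> polyfun_on m S (n * d) (\<lambda>x. f x ^ n)"
  by (induction n) (auto intro: polyfun_on_mult polyfun_on.const)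

lemma polyfun_on_var_power: "i < m \<Longrightarrow> polyfun_on m S n (\<lambda>x. x i ^ n)"
  using polyfun_on_power[OF polyfun_on_var] by simp

lemma polyfun_on_sum:
  "(\<And>i. i \<in> I \<Longrightarrow> polyfun_on m S d (f i)) \<Longrightarrow> polyfun_on m S d (\<lambda>x. \<Sum>i\<in>I. f i x)"
  by (induction I rule: infinite_finite_induct) (auto intro: polyfun_on.intros)

lemma polyfun_on_prod:
  assumes "finite I" "\<And>i. i \<in> I \<Longrightarrow> polyfun_on m S (d i) (f i)"
  shows "polyfun_on m S (\<Sum>i\<in>I. d i) (\<lambda>x. \<Prod>i\<in>I. f i x)"
  using assms by (induction I rule: finite_induct) (auto intro: polyfun_on.intros polyfun_on_mult)

lemma polyfun_on_poly: 
  assumes "i < m" "degree p \<le> d"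
  shows "polyfun_on m S d (\<lambda>x. poly p (x i))"
  unfolding poly_altdef
  by (intro polyfun_on_sum polyfun_on_cmult polyfun_on_mono[OF polyfun_on_var_power]) (use assms in auto)

text \<open>Exponents of the normal forms that are left once every \<open>x i ^ D\<close> has been
  rewritten. The extensional function space makes the set finite.\<close>

definition reduced_exponents :: "nat \<Rightarrow> nat \<Rightarrow> nat \<Rightarrow> (nat \<Rightarrow> nat) set" where
  "reduced_exponents m D d = {e \<in> {..<m} \<rightarrow>\<^sub>E {..<D}. (\<Sum>i<m. e i) \<le> d}"

definition reduced_on :: "nat \<Rightarrow> nat \<Rightarrow> (nat \<Rightarrow> real) set \<Rightarrow> nat \<Rightarrow> ((nat \<Rightarrow> real) \<Rightarrow> real) \<Rightarrow> bool" where
  "reduced_on m D S d f \<longleftrightarrow>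
     (\<exists>c. \<forall>x\<in>S. f x = (\<Sum>e\<in>reduced_exponents m D d. c e * (\<Prod>i<m. x i ^ e i)))"

lemma finite_reduced_exponents [simp]: "finite (reduced_exponents m D d)"
proof -
  have "finite ({..<m} \<rightarrow>\<^sub>E {..<D})" by (rule finite_PiE) auto
  then show ?thesis by (rule rev_finite_subset) (auto simp: reduced_exponents_def)
qed

lemma reduced_on_add:
  "reduced_on m D S d f \<Longrightarrow> reduced_on m D S d f' \<Longrightarrow> reduced_on m D S d (\<lambda>x. f x + f' x)"
  unfolding reduced_on_def
  apply (elim exE)
  subgoal for c c'
    by (rule exI[of _ "\<lambda>e. c e + c' e"]) (auto simp: algebra_simps sum.distrib)
  done

lemma reduced_on_cmult: "reduced_on m D S d f \<Longrightarrow> reduced_on m D S d (\<lambda>x. b * f x)"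
  unfolding reduced_on_def
  apply (elim exE)
  subgoal for c
    by (rule exI[of _ "\<lambda>e. b * c e"]) (auto simp: algebra_simps sum_distrib_left)
  done

lemma reduced_on_cong:
  "reduced_on m D S d f \<Longrightarrow> (\<And>x. x \<in> S \<Longrightarrow> f x = f' x) \<Longrightarrow> reduced_on m D S d f'"
  unfolding reduced_on_def by metis

lemma reduced_on_monomial:
  assumes "e \<in> reduced_exponents m D d"
  shows "reduced_on m D S d (\<lambda>x. \<Prod>i<m. x i ^ e i)"
  unfolding reduced_on_def
  by (rule exI[of _ "\<lambda>e'. if e' = e then 1 else 0"]) (use assms in \<open>auto simp: if_distrib[of "\<lambda>a. a * _"] cong: if_cong\<close>)

lemma reduced_on_sum:
  assumes "finite I" "\<And>j. j \<in> I \<Longrightarrow> reduced_on m D S d (f j)"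
  shows "reduced_on m D S d (\<lambda>x. \<Sum>j\<in>I. f j x)"
  using assms
proof (induction I rule: finite_induct)
  case empty
  show ?case unfolding reduced_on_def by (rule exI[of _ "\<lambda>_. 0"]) simp
qed (auto intro: reduced_on_add)

lemma reduced_on_mono: "reduced_on m D S d f \<Longrightarrow> d \<le> d' \<Longrightarrow> reduced_on m D S d' f"
proof -
  assume "reduced_on m D S d f" "d \<le> d'"
  then obtain c where c: "\<And>x. x \<in> S \<Longrightarrow> f x = (\<Sum>e\<in>reduced_exponents m D d. c e * (\<Prod>i<m. x i ^ e i))"
    unfolding reduced_on_def by blast
  have "reduced_on m D S d' (\<lambda>x. \<Sum>e\<in>reduced_exponents m D d. c e * (\<Prod>i<m. x i ^ e i))"
    using \<open>d \<le> d'\<close>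
    by (intro reduced_on_sum reduced_on_cmult reduced_on_monomial finite_reduced_exponents)
      (auto simp: reduced_exponents_def)
  then show ?thesis by (rule reduced_on_cong) (simp add: c)
qed

text \<open>Multiplying a reduced monomial by \<open>x j\<close> leads out of the reduced monomials
  only if the exponent reaches \<open>D\<close>. Rewriting \<open>x j ^ D\<close> then lowers the
  total degree, which calls for an outer induction on the degree around the induction on the
  construction.\<close>

lemma polyfun_on_imp_reduced_on:
  assumes D: "D > 0" and red: "\<And>i. i < m \<Longrightarrow> polyfun_on m S (D - 1) (\<lambda>x. x i ^ D)"
  shows "polyfun_on m S d f \<Longrightarrow> reduced_on m D S d f"
proof (induction d arbitrary: f rule: less_induct)
  case (less d)
  show ?case using less.prems less.IH
  proof (induction rule: polyfun_on.induct)
    case (const d c)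
    have "(\<lambda>i\<in>{..<m}. 0) \<in> reduced_exponents m D d" using D by (auto simp: reduced_exponents_def)
    from reduced_on_cmult[OF reduced_on_monomial[OF this], of S c] show ?case by simp
  next
    case (var_times j d f)
    then have "reduced_on m D S d f" by simp
    then obtain c where c: "\<And>x. x \<in> S \<Longrightarrow> f x = (\<Sum>e\<in>reduced_exponents m D d. c e * (\<Prod>i<m. x i ^ e i))"
      unfolding reduced_on_def by blast
    have "reduced_on m D S (Suc d) (\<lambda>x. x j * (\<Prod>i<m. x i ^ e i))"
      if e: "e \<in> reduced_exponents m D d" for e
    proof -
      have split: "x j * (\<Prod>i<m. x i ^ e i) = x j ^ Suc (e j) * (\<Prod>i\<in>{..<m}-{j}. x i ^ e i)" for x :: "nat \<Rightarrow> real"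
        using \<open>j < m\<close> by (subst prod.remove[of _ j]) auto
      have degs: "(\<Sum>i<m. e i) = e j + (\<Sum>i\<in>{..<m}-{j}. e i)"
        using \<open>j < m\<close> by (subst sum.remove[of _ j]) auto
      show ?thesis
      proof (cases "Suc (e j) < D")
        case True
        let ?e = "e(j := Suc (e j))"
        have "(\<Sum>i<m. ?e i) = Suc (\<Sum>i<m. e i)"
          unfolding degs using \<open>j < m\<close> by (subst sum.remove[of _ j]) auto
        then have "?e \<in> reduced_exponents m D (Suc d)"
          using e True \<open>j < m\<close> by (auto simp: reduced_exponents_def PiE_iff extensional_def)
        from reduced_on_monomial[OF this] show ?thesis
          unfolding split
        proof (rule reduced_on_cong)
          fix x :: "nat \<Rightarrow> real"
          show "(\<Prod>i<m. x i ^ ?e i) = x j ^ Suc (e j) * (\<Prod>i\<in>{..<m}-{j}. x i ^ e i)"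
            using \<open>j < m\<close> by (subst prod.remove[of _ j]) auto
        qed
      next
        case False
        moreover have "e j < D" using e \<open>j < m\<close> by (auto simp: reduced_exponents_def)
        ultimately have ej: "Suc (e j) = D" by linarith
        \<comment> \<open>A factor of degree \<open>D\<close> is traded for one of degree
          \<open>D - 1\<close>, so the product has degree at most \<open>d\<close> instead of
          \<open>Suc d\<close>, and the outer hypothesis applies.\<close>
        have "polyfun_on m S (D - 1 + (\<Sum>i\<in>{..<m}-{j}. e i)) (\<lambda>x. x j ^ D * (\<Prod>i\<in>{..<m}-{j}. x i ^ e i))"
          by (intro polyfun_on_mult red polyfun_on_prod polyfun_on_var_power) (use \<open>j < m\<close> in auto)
        moreover have "D - 1 + (\<Sum>i\<in>{..<m}-{j}. e i) \<le> d"
        proof -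
          have "(\<Sum>i<m. e i) \<le> d" using e by (simp add: reduced_exponents_def)
          then show ?thesis unfolding degs ej[symmetric] by simp
        qed
        ultimately have "polyfun_on m S d (\<lambda>x. x j ^ D * (\<Prod>i\<in>{..<m}-{j}. x i ^ e i))"
          by (rule polyfun_on_mono)
        then have "reduced_on m D S d (\<lambda>x. x j ^ D * (\<Prod>i\<in>{..<m}-{j}. x i ^ e i))"
          using var_times.prems by simp
        then show ?thesis unfolding split ej by (rule reduced_on_mono) simp
      qed
    qed
    then have "reduced_on m D S (Suc d)
        (\<lambda>x. \<Sum>e\<in>reduced_exponents m D d. c e * (x j * (\<Prod>i<m. x i ^ e i)))"
      by (intro reduced_on_sum reduced_on_cmult) auto
    then show ?case
      by (rule reduced_on_cong) (auto simp: c sum_distrib_left algebra_simps)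
  next
    case (add d f f')
    then show ?case by (auto intro: reduced_on_add)
  next
    case (Suc d f)
    have "reduced_on m D S d f" using Suc by simp
    then show ?case by (rule reduced_on_mono) simp
  next
    case (cong d f f')
    then show ?case by (auto intro: reduced_on_cong)
  qed
qed

text \<open>The reduced monomials span the functions \<open>x j ^ k\<close>, so finitely many of these powers are
  linearly dependent.\<close>

lemma finite_coordinate_values:
  assumes D: "D > 0" and red: "\<And>i. i < m \<Longrightarrow> polyfun_on m S (D - 1) (\<lambda>x. x i ^ D)"
    and j: "j < m"
  shows "finite ((\<lambda>x. x j) ` S)"
proof -
  \<comment> \<open>With all exponents below \<open>D\<close> the total degree never exceeds
    \<open>m * D\<close>, so \<open>B\<close> contains every reduced monomial, whatever the degree
    bound.\<close>
  define B where "B = reduced_exponents m D (m * D)"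
  have B: "reduced_exponents m D d \<subseteq> B" for d
  proof
    fix e assume e: "e \<in> reduced_exponents m D d"
    have "(\<Sum>i<m. e i) \<le> (\<Sum>i<m. D)"
      by (rule sum_mono) (use e in \<open>auto simp: reduced_exponents_def PiE_iff less_imp_le\<close>)
    with e show "e \<in> B" by (auto simp: B_def reduced_exponents_def)
  qed
  have "\<exists>c. \<forall>x\<in>S. x j ^ k = (\<Sum>e\<in>B. c e * (\<Prod>i<m. x i ^ e i))" for k
  proof -
    have "reduced_on m D S k (\<lambda>x. x j ^ k)"
      by (intro polyfun_on_imp_reduced_on[OF D red] polyfun_on_var_power j)
    then have "reduced_on m D S (max k (m * D)) (\<lambda>x. x j ^ k)"
      by (rule reduced_on_mono) simp
    moreover have "reduced_exponents m D (max k (m * D)) = B"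
      using B[of "max k (m * D)"] by (auto simp: B_def reduced_exponents_def)
    ultimately show ?thesis by (simp add: reduced_on_def)
  qed
  then obtain c where c: "\<And>k x. x \<in> S \<Longrightarrow> x j ^ k = (\<Sum>e\<in>B. c k e * (\<Prod>i<m. x i ^ e i))" by metis
  \<comment> \<open>There are \<open>card B + 1\<close> powers of \<open>x j\<close> against
    \<open>card B\<close> monomials, hence a nontrivial vanishing combination: a polynomial that has
    \<open>x j\<close> as a root for all \<open>x\<close> in \<open>S\<close>.\<close>
  have "finite B" by (simp add: B_def)
  from homogeneous_system_nontrivial_solution[OF this, of "{..card B}" c]
  obtain a k0 where a: "k0 \<le> card B" "a k0 \<noteq> 0"
    "\<And>e. e \<in> B \<Longrightarrow> (\<Sum>k\<le>card B. a k * c k e) = 0" by auto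
  define p where "p = (\<Sum>k\<le>card B. monom (a k) k)"
  have "coeff p k0 = a k0" using a(1) by (simp add: p_def coeff_sum)
  then have "p \<noteq> 0" using a(2) by auto
  moreover have "poly p (x j) = 0" if "x \<in> S" for x
  proof -
    have "poly p (x j) = (\<Sum>k\<le>card B. a k * (\<Sum>e\<in>B. c k e * (\<Prod>i<m. x i ^ e i)))"
      using c[OF that] by (simp add: p_def poly_sum poly_monom)
    also have "\<dots> = (\<Sum>e\<in>B. \<Sum>k\<le>card B. a k * c k e * (\<Prod>i<m. x i ^ e i))"
      unfolding sum_distrib_left by (subst sum.swap) (simp add: algebra_simps)
    also have "\<dots> = 0" using a(3) by (simp flip: sum_distrib_right)
    finally show ?thesis .
  qed
  ultimately show ?thesis
    by (intro finite_subset[OF _ poly_roots_finite[of p]]) auto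
qed

section \<open>Finiteness of the periodic orbits\<close>

text \<open>The recurrence that makes every \<open>cohen_factor\<close> vanish. The solutions with
  initial values 1, 0 and 0, 1 give the entries of the product of the transfer matrices.\<close>

fun recur :: "(nat \<Rightarrow> int) \<Rightarrow> int \<Rightarrow> int \<Rightarrow> nat \<Rightarrow> int" where
  "recur \<sigma> a b 0 = a"
| "recur \<sigma> a b (Suc 0) = b"
| "recur \<sigma> a b (Suc (Suc n)) = - recur \<sigma> a b n - \<sigma> n * recur \<sigma> a b (Suc n)"

text \<open>A discrete Wronskian: it is constant because the oldest term of the recurrence has the
  coefficient -1.\<close>

lemma recur_casoratian:
  "recur \<sigma> 1 0 n * recur \<sigma> 0 1 (Suc n) - recur \<sigma> 1 0 (Suc n) * recur \<sigma> 0 1 n = 1"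
  by (induction n) (auto simp: algebra_simps)

text \<open>Modulo 2 every \<open>\<sigma> n\<close> is 1, so the recurrence becomes that of the
  Fibonacci numbers, whose parity has period 3.\<close>

lemma even_recur:
  assumes "\<And>n. odd (\<sigma> n)"
  shows "even (recur \<sigma> 1 0 n) \<longleftrightarrow> n mod 3 = 1" "even (recur \<sigma> 0 1 n) \<longleftrightarrow> n mod 3 = 0"
proof -
  have step: "even (recur \<sigma> a b (Suc (Suc n))) \<longleftrightarrow> (even (recur \<sigma> a b n) \<longleftrightarrow> even (recur \<sigma> a b (Suc n)))"
    for a b n using assms[of n] by auto
  have mod3: "Suc (Suc n) mod 3 = 1 \<longleftrightarrow> (n mod 3 = 1 \<longleftrightarrow> Suc n mod 3 = 1)"
    "Suc (Suc n) mod 3 = 0 \<longleftrightarrow> (n mod 3 = 0 \<longleftrightarrow> Suc n mod 3 = 0)" for n :: nat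
    by presburger+
  have "(even (recur \<sigma> 1 0 n) \<longleftrightarrow> n mod 3 = 1) \<and> (even (recur \<sigma> 1 0 (Suc n)) \<longleftrightarrow> Suc n mod 3 = 1)" for n
  proof (induction n)
    case (Suc n)
    then show ?case by (simp only: step mod3 simp_thms)
  qed simp
  then show "even (recur \<sigma> 1 0 n) \<longleftrightarrow> n mod 3 = 1" by (rule conjunct1)
  have "(even (recur \<sigma> 0 1 n) \<longleftrightarrow> n mod 3 = 0) \<and> (even (recur \<sigma> 0 1 (Suc n)) \<longleftrightarrow> Suc n mod 3 = 0)" for n
  proof (induction n)
    case (Suc n)
    then show ?case by (simp only: step mod3 simp_thms)
  qed simp
  then show "even (recur \<sigma> 0 1 n) \<longleftrightarrow> n mod 3 = 0" by (rule conjunct1)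
qed

text \<open>The product of the transfer matrices over one period has determinant 1. Unless 3 divides the
  period, its trace is odd, so 1 is not an eigenvalue.\<close>

lemma recur_det_nonzero:
  assumes "\<And>n. odd (\<sigma> n)" "\<not> 3 dvd N"
  shows "(1 - recur \<sigma> 1 0 N) * (1 - recur \<sigma> 0 1 (Suc N)) - recur \<sigma> 1 0 (Suc N) * recur \<sigma> 0 1 N \<noteq> 0"
proof -
  have "odd (recur \<sigma> 1 0 N + recur \<sigma> 0 1 (Suc N))"
    unfolding even_add even_recur[OF assms(1)] using assms(2) by presburger
  then have "recur \<sigma> 1 0 N + recur \<sigma> 0 1 (Suc N) \<noteq> 2" by (metis even_numeral)
  then show ?thesis using recur_casoratian[of \<sigma> N] by (simp add: algebra_simps)
qed

text \<open>For \<open>\<sigma> n = 1\<close> and \<open>\<sigma> n = -1\<close> these are the two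
  linear factors of \<open>(x (n+2) + x n)\<^sup>2 - (x (n+1))\<^sup>2\<close>; the function
  \<sigma> selects one of them for each \<open>n\<close>.\<close>

definition cohen_factor :: "(nat \<Rightarrow> int) \<Rightarrow> nat \<Rightarrow> (nat \<Rightarrow> real) \<Rightarrow> real" where
  "cohen_factor \<sigma> n x = x (n + 2) + x n + of_int (\<sigma> n) * x (n + 1)"

text \<open>Modulo the span of the factors every entry is determined by the first two, and closing
  the period gives two equations for these with nonzero determinant.\<close>

lemma coordinate_in_span_cohen_factors:
  fixes S :: "(nat \<Rightarrow> real) set"
  assumes odd: "\<And>n. odd (\<sigma> n)" and N: "\<not> 3 dvd N"
    and per: "\<And>x n. x \<in> S \<Longrightarrow> x (n + N) = x n" and j: "j < N + 2"
  shows "\<exists>c. \<forall>x\<in>S. x j = (\<Sum>n<N. c n * cohen_factor \<sigma> n x)"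
proof -
  define Sp where "Sp f \<longleftrightarrow> (\<exists>c. \<forall>x\<in>S. f x = (\<Sum>n<N. c n * cohen_factor \<sigma> n x))" for f
  have add: "Sp (\<lambda>x. a * f x + b * g x)" if "Sp f" "Sp g" for f g a b
  proof -
    from that obtain c d where "\<forall>x\<in>S. f x = (\<Sum>n<N. c n * cohen_factor \<sigma> n x)"
      "\<forall>x\<in>S. g x = (\<Sum>n<N. d n * cohen_factor \<sigma> n x)" unfolding Sp_def by blast
    then show ?thesis unfolding Sp_def
      by (intro exI[of _ "\<lambda>n. a * c n + b * d n"])
        (auto simp: sum_distrib_left algebra_simps sum.distrib)
  qed
  have cong: "Sp f \<Longrightarrow> (\<And>x. x \<in> S \<Longrightarrow> f x = g x) \<Longrightarrow> Sp g" for f g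
    unfolding Sp_def by metis
  have factor: "Sp (cohen_factor \<sigma> n)" if "n < N" for n
    unfolding Sp_def
    by (rule exI[of _ "\<lambda>k. if k = n then 1 else 0"]) (use that in \<open>auto simp: if_distrib[of "\<lambda>a. a * _"] cong: if_cong\<close>)
  have zero: "Sp (\<lambda>_. 0)" unfolding Sp_def by (rule exI[of _ "\<lambda>_. 0"]) simp
  let ?p = "\<lambda>n. real_of_int (recur \<sigma> 1 0 n)" and ?q = "\<lambda>n. real_of_int (recur \<sigma> 0 1 n)"
  \<comment> \<open>Modulo the span, \<open>x n\<close> continues linearly from \<open>x 0\<close>
    and \<open>x 1\<close>. The range ends at \<open>N + 1\<close> because entry \<open>n\<close>
    uses the factor of index \<open>n - 2\<close>, which must be below \<open>N\<close>.\<close>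
  have rel: "n \<le> N + 1 \<Longrightarrow> Sp (\<lambda>x. x n - ?p n * x 0 - ?q n * x 1)" for n
  proof (induction n rule: less_induct)
    case (less n)
    consider "n = 0" | "n = 1" | k where "n = k + 2" 
      by (metis One_nat_def add_2_eq_Suc' nat.exhaust)
    then show ?case
    proof cases
      case 3
      have "Sp (\<lambda>x. 1 * cohen_factor \<sigma> k x + (-1) * (1 * (x k - ?p k * x 0 - ?q k * x 1)
              + of_int (\<sigma> k) * (x (k+1) - ?p (k+1) * x 0 - ?q (k+1) * x 1)))"
        using less 3 by (intro add factor) auto
      then show ?thesis
        by (rule cong) (simp add: 3 cohen_factor_def algebra_simps)
    qed (use zero in auto)
  qed
  define \<Delta> where "\<Delta> = (1 - ?p N) * (1 - ?q (Suc N)) - ?p (Suc N) * ?q N"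
  have \<Delta>: "\<Delta> \<noteq> 0"
  proof -
    have "\<Delta> = of_int ((1 - recur \<sigma> 1 0 N) * (1 - recur \<sigma> 0 1 (Suc N)) - recur \<sigma> 1 0 (Suc N) * recur \<sigma> 0 1 N)"
      by (simp add: \<Delta>_def)
    then show ?thesis using recur_det_nonzero[of \<sigma> N, OF odd N] by (simp only: of_int_eq_0_iff not_False_eq_True)
  qed
  have perN: "x N = x 0" "x (Suc N) = x 1" if "x \<in> S" for x
    using per[OF that, of 0] per[OF that, of 1] by auto
  \<comment> \<open>Periodicity at \<open>N\<close> and \<open>Suc N\<close> gives a homogeneous
    system for \<open>x 0\<close> and \<open>x 1\<close> modulo the span; Cramer's rule with the
    determinant \<Delta> solves it.\<close>
  have 0: "Sp (\<lambda>x. (1 - ?p N) * x 0 - ?q N * x 1)"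
    by (rule cong[OF rel[of N]]) (auto simp: perN algebra_simps)
  have 1: "Sp (\<lambda>x. (1 - ?q (Suc N)) * x 1 - ?p (Suc N) * x 0)"
    by (rule cong[OF rel[of "Suc N"]]) (auto simp: perN algebra_simps)
  have cramer: "(1 - b') / d * ((1 - a) * y - b * z) + b / d * ((1 - b') * z - a' * y) = y"
    "a' / d * ((1 - a) * y - b * z) + (1 - a) / d * ((1 - b') * z - a' * y) = z"
    if "d = (1 - a) * (1 - b') - a' * b" "d \<noteq> 0" for a b a' b' d y z :: real
  proof -
    have "(1 - b') * ((1 - a) * y - b * z) + b * ((1 - b') * z - a' * y) = y * d"
      "a' * ((1 - a) * y - b * z) + (1 - a) * ((1 - b') * z - a' * y) = z * d"
      unfolding that(1) by (simp_all add: algebra_simps)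
    with \<open>d \<noteq> 0\<close> show "(1 - b') / d * ((1 - a) * y - b * z) + b / d * ((1 - b') * z - a' * y) = y"
      "a' / d * ((1 - a) * y - b * z) + (1 - a) / d * ((1 - b') * z - a' * y) = z"
      by (simp_all add: nonzero_eq_divide_eq flip: add_divide_distrib)
  qed
  have x0: "Sp (\<lambda>x. x 0)"
    by (rule cong[OF add[OF 0 1, of "(1 - ?q (Suc N)) / \<Delta>" "?q N / \<Delta>"]], rule cramer)
      (rule \<Delta>_def \<Delta>)+
  have x1: "Sp (\<lambda>x. x 1)"
    by (rule cong[OF add[OF 0 1, of "?p (Suc N) / \<Delta>" "(1 - ?p N) / \<Delta>"]], rule cramer)
      (rule \<Delta>_def \<Delta>)+
  have "Sp (\<lambda>x. 1 * (x j - ?p j * x 0 - ?q j * x 1) + 1 * (?p j * x 0 + ?q j * x 1))"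
    using j by (intro add rel x0 x1) auto
  then have "Sp (\<lambda>x. x j)" by (rule cong) simp
  then show ?thesis by (simp add: Sp_def)
qed

text \<open>Eliminates the factors one at a time: multiplying the relations for the two choices of the
  last sign replaces the product of the two conjugate factors by 1.\<close>

lemma coordinate_power_elimination:
  fixes S :: "(nat \<Rightarrow> real) set"
  assumes N: "\<not> 3 dvd N"
    and per: "\<And>x n. x \<in> S \<Longrightarrow> x (n + N) = x n"
    and eq: "\<And>x n. x \<in> S \<Longrightarrow> (x (n + 2) + x n)\<^sup>2 = (x (n + 1))\<^sup>2 + 1"
    and j: "j < N + 2" and "k \<le> N" and \<sigma>: "\<And>n. \<sigma> n = 1 \<or> \<sigma> n = -1"
  shows "\<exists>a r. (\<forall>n. polyfun_on (N+2) S (2^k - 1) (a n)) \<and> polyfun_on (N+2) S (2^k - 1) r \<and>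
           (\<forall>x\<in>S. x j ^ (2^k) = (\<Sum>n<N-k. cohen_factor \<sigma> n x * a n x) + r x)"
  using \<open>k \<le> N\<close> \<sigma>
proof (induction k arbitrary: \<sigma>)
  case 0
  have "odd (\<sigma> n)" for n using 0(2)[of n] by (elim disjE) simp_all
  from coordinate_in_span_cohen_factors[of \<sigma> N S j, OF this N per j]
  obtain c where "\<forall>x\<in>S. x j = (\<Sum>n<N. c n * cohen_factor \<sigma> n x)" by blast
  then show ?case
    by (intro exI[of _ "\<lambda>n x. c n"] exI[of _ "\<lambda>_. 0"]) (auto intro: polyfun_on.const simp: mult.commute)
next
  case (Suc k)
  let ?K = "N - Suc k" and ?e = "2 ^ k :: nat"
  let ?P = "polyfun_on (N+2) S"
  define u where "u = \<sigma>(?K := 1)"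
  define v where "v = \<sigma>(?K := -1)"
  have uv: "u n = 1 \<or> u n = -1" "v n = 1 \<or> v n = -1" for n using Suc.prems(2)[of n] by (simp_all add: u_def v_def)
  have kN: "k \<le> N" "N - k = Suc ?K" using Suc.prems(1) by linarith+
  obtain a r where a: "\<And>n. ?P (?e - 1) (a n)" "?P (?e - 1) r"
    "\<And>x. x \<in> S \<Longrightarrow> x j ^ ?e = (\<Sum>n<Suc ?K. cohen_factor u n x * a n x) + r x"
    using Suc.IH[of u, OF kN(1) uv(1)] unfolding kN(2) by blast
  obtain b s where b: "\<And>n. ?P (?e - 1) (b n)" "?P (?e - 1) s"
    "\<And>x. x \<in> S \<Longrightarrow> x j ^ ?e = (\<Sum>n<Suc ?K. cohen_factor v n x * b n x) + s x"
    using Suc.IH[of v, OF kN(1) uv(2)] unfolding kN(2) by blast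
  have agree: "cohen_factor u n x = cohen_factor \<sigma> n x" "cohen_factor v n x = cohen_factor \<sigma> n x"
    if "n < ?K" for n x using that by (auto simp: cohen_factor_def u_def v_def)
  let ?A = "\<lambda>x. \<Sum>n<?K. cohen_factor \<sigma> n x * a n x" and ?B = "\<lambda>x. \<Sum>n<?K. cohen_factor \<sigma> n x * b n x"
  let ?u = "cohen_factor u ?K" and ?v = "cohen_factor v ?K"
  have one: "?u x * ?v x = 1" if "x \<in> S" for x
  proof -
    have "?u x * ?v x = (x (?K + 2) + x ?K)\<^sup>2 - (x (?K + 1))\<^sup>2"
      unfolding cohen_factor_def u_def v_def fun_upd_same by (simp only: of_int_1 of_int_minus) algebra
    with eq[OF that, of ?K] show ?thesis by linarith
  qed
  \<comment> \<open>Found by multiplying the two expressions for the power: terms with a remaining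
    factor go to \<open>a'\<close>, the others to \<open>r'\<close>. Since the product of the
    conjugate factors is 1, at most one linear factor survives in \<open>r'\<close>, and the degree
    is at most 2(2^k - 1) + 1 = 2^(k+1) - 1.\<close>
  define a' where "a' n x = a n x * x j ^ ?e + b n x * (?u x * a ?K x + r x)" for n x
  define r' where "r' x = a ?K x * b ?K x + ?u x * a ?K x * s x + r x * (?v x * b ?K x + s x)" for x
  have "?P (Suc 0 + 0) (\<lambda>x. x i)" if "i < N + 2" for i using polyfun_on_var[OF that] by simp
  then have L: "?P 1 (cohen_factor w ?K)" for w
    unfolding cohen_factor_def
    by (intro polyfun_on.add polyfun_on_cmult) (use kN in auto)
  have e: "?e > 0" "(2::nat) ^ Suc k - 1 = ?e - 1 + ?e" "(2::nat) ^ Suc k - 1 = ?e + (?e - 1)" 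
    by (auto simp: Suc_leI)
  have e1: "?e = 1 + (?e - 1)" using e(1) by linarith
  have L': "?P ?e (\<lambda>x. cohen_factor w ?K x * f x)" if "?P (?e - 1) f" for f w
    using polyfun_on_mult[OF L that] e1 by metis
  have up: "?P ?e f" if "?P (?e - 1) f" for f using polyfun_on_mono[OF that] by simp
  have "?P (2 ^ Suc k - 1) (a' n)" for n
    unfolding a'_def e(2)
    by (intro polyfun_on.add polyfun_on_mult polyfun_on_var_power a b L' up j)
  moreover have "?P (2 ^ Suc k - 1) r'"
  proof -
    have "?P (?e + (?e - 1)) (\<lambda>x. a ?K x * b ?K x)" by (intro polyfun_on_mult a b up)
    moreover have "?P (?e + (?e - 1)) (\<lambda>x. ?u x * a ?K x * s x)" by (intro polyfun_on_mult L' a b)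
    moreover have "?P (?e - 1 + ?e) (\<lambda>x. r x * (?v x * b ?K x + s x))"
      by (intro polyfun_on_mult polyfun_on.add L' up a b)
    ultimately show ?thesis unfolding r'_def e(3) by (intro polyfun_on.add) (auto simp: add.commute)
  qed
  moreover have "x j ^ (2 ^ Suc k) = (\<Sum>n<?K. cohen_factor \<sigma> n x * a' n x) + r' x" if "x \<in> S" for x
  proof -
    have A: "x j ^ ?e = ?A x + (?u x * a ?K x + r x)" using a(3)[OF that] agree by simp
    have B: "x j ^ ?e = ?B x + (?v x * b ?K x + s x)" using b(3)[OF that] agree by simp
    have "x j ^ (2 ^ Suc k) = x j ^ ?e * x j ^ ?e" by (simp flip: power_add add: mult_2)
    also have "\<dots> = ?A x * x j ^ ?e + (?u x * a ?K x + r x) * x j ^ ?e"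
      by (subst (1) A) (simp only: distrib_right)
    also have "(?u x * a ?K x + r x) * x j ^ ?e
        = ?B x * (?u x * a ?K x + r x) + (?u x * a ?K x + r x) * (?v x * b ?K x + s x)"
      by (subst B) (simp only: distrib_left mult.commute)
    also have "(?u x * a ?K x + r x) * (?v x * b ?K x + s x) = r' x + (?u x * ?v x - 1) * (a ?K x * b ?K x)"
      by (simp add: r'_def algebra_simps)
    also have "?A x * x j ^ ?e + (?B x * (?u x * a ?K x + r x) + (r' x + (?u x * ?v x - 1) * (a ?K x * b ?K x)))
       = (\<Sum>n<?K. cohen_factor \<sigma> n x * a' n x) + r' x"
      using one[OF that] by (simp add: a'_def sum_distrib_right sum_distrib_left algebra_simps sum.distrib)
    finally show ?thesis .
  qed
  ultimately show ?case by blast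
qed

text \<open>After \<open>N\<close> elimination steps no factor remains, so
  \<open>x i ^ (2 ^ N)\<close> has degree at most \<open>2 ^ N - 1\<close> on \<open>S\<close>, and
  \<open>D = 2 ^ N\<close> serves for every coordinate.\<close>

lemma finite_coordinate_values_cohen:
  fixes S :: "(nat \<Rightarrow> real) set"
  assumes N: "\<not> 3 dvd N"
    and per: "\<And>x n. x \<in> S \<Longrightarrow> x (n + N) = x n"
    and eq: "\<And>x n. x \<in> S \<Longrightarrow> (x (n + 2) + x n)\<^sup>2 = (x (n + 1))\<^sup>2 + 1"
    and j: "j < N + 2"
  shows "finite ((\<lambda>x. x j) ` S)"
proof (rule finite_coordinate_values[where m = "N + 2" and D = "2 ^ N"])
  fix i assume i: "i < N + 2"
  from coordinate_power_elimination[of N S i N "\<lambda>_. 1", OF N per eq i order_refl]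
  obtain r where "polyfun_on (N+2) S (2^N - 1) r" "\<forall>x\<in>S. x i ^ (2^N) = r x" by auto
  then show "polyfun_on (N + 2) S (2 ^ N - 1) (\<lambda>x. x i ^ 2 ^ N)"
    by (auto intro: polyfun_on.cong)
qed (simp, rule j)

text \<open>Expanding the square isolates a polynomial \<open>G\<close> in \<open>x (n+1)\<close>
  alone; the other terms contain \<open>x (n+2) + x n\<close> to the power one or two. Once
  \<open>D = degree G\<close> exceeds their degrees, \<open>x (n+1) ^ D\<close> has degree at most
  \<open>D - 1\<close> on \<open>S\<close>.\<close>

lemma finite_coordinate_values_rational:
  fixes S :: "(nat \<Rightarrow> real) set" and P Q R T :: "real poly"
  assumes "N > 0" and per: "\<And>x n. x \<in> S \<Longrightarrow> x (n + N) = x n"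
    and Q: "Q \<noteq> 0" and T: "T \<noteq> 0" and eps: "\<epsilon> \<noteq> 0"
    and deg: "int (degree P) - int (degree Q) > 1 \<or> int (degree R) - int (degree T) > 2"
    and deg_neq: "2 * (int (degree P) - int (degree Q)) \<noteq> int (degree R) - int (degree T)"
    and eq: "\<And>x n. x \<in> S \<Longrightarrow> 
      poly T (x (n+1)) * (poly Q (x (n+1)) * (x (n+2) + x n) - \<epsilon> * poly P (x (n+1)))\<^sup>2
      = (poly Q (x (n+1)))\<^sup>2 * (poly T (x (n+1)) * ((x (n+1))\<^sup>2 + 1) + \<epsilon> * poly R (x (n+1)))"
    and j: "j < N + 2"
  shows "finite ((\<lambda>x. x j) ` S)"
proof -
  define A where "A = smult (\<epsilon>\<^sup>2) (T * P\<^sup>2)"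
  define B where "B = smult (-\<epsilon>) (Q\<^sup>2 * R)"
  define C where "C = - (Q\<^sup>2 * T * [:1, 0, 1:])"
  define G where "G = A + B + C"
  define D where "D = degree G"
  have dC: "degree C = 2 * degree Q + degree T + 2"
  proof -
    define K where "K = [:1, 0, 1 :: real:]"
    have K: "degree K = 2" "K \<noteq> 0" by (simp_all add: K_def)
    have "degree (Q\<^sup>2 * T * K) = degree (Q\<^sup>2 * T) + degree K"
      using Q T K by (intro degree_mult_eq) simp_all
    also have "degree (Q\<^sup>2 * T) = degree (Q\<^sup>2) + degree T"
      using Q T by (intro degree_mult_eq) simp_all
    finally show ?thesis unfolding C_def degree_minus K_def[symmetric] by (simp add: degree_power_eq Q K)
  qed
  have dA: "P \<noteq> 0 \<Longrightarrow> degree A = degree T + 2 * degree P"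
    unfolding A_def using T eps by (simp add: degree_mult_eq degree_power_eq)
  have dB: "R \<noteq> 0 \<Longrightarrow> degree B = 2 * degree Q + degree R"
    unfolding B_def using Q eps by (simp add: degree_mult_eq degree_power_eq)
  have dAle: "degree A \<le> degree T + 2 * degree P"
    by (cases "P = 0") (use dA in \<open>auto simp: A_def\<close>)
  have dBle: "degree B \<le> 2 * degree Q + degree R"
    by (cases "R = 0") (use dB in \<open>auto simp: B_def\<close>)
  \<comment> \<open>The bounds are the degrees of the terms with the square and with the first power
    of \<open>x (n+2) + x n\<close>. The case split decides whether \<open>A\<close> or
    \<open>B\<close> leads; they could cancel only in the case of equality, which is
    excluded.\<close>
  have big: "D > degree T + 2 * degree Q + 2 \<and> D > degree T + degree Q + degree P + 1"
  proof (cases "2 * (int (degree P) - int (degree Q)) > int (degree R) - int (degree T)")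
    case True
    then have *: "int (degree P) - int (degree Q) > 1" using deg by presburger
    then have "P \<noteq> 0" by auto
    have lt: "degree (B + C) < degree A"
      by (rule le_less_trans[OF degree_add_le_max]) (use dBle dC dA[OF \<open>P \<noteq> 0\<close>] True * in auto)
    have "G = A + (B + C)" by (simp add: G_def)
    then have "D = degree A" unfolding D_def using degree_add_eq_left[OF lt] by simp
    then show ?thesis using dA[OF \<open>P \<noteq> 0\<close>] * by linarith
  next
    case False
    then have **: "2 * (int (degree P) - int (degree Q)) < int (degree R) - int (degree T)"
      using deg_neq by linarith
    then have *: "int (degree R) - int (degree T) > 2" using deg by presburger
    then have "R \<noteq> 0" by auto
    have lt: "degree (A + C) < degree B"
      by (rule le_less_trans[OF degree_add_le_max]) (use dAle dC dB[OF \<open>R \<noteq> 0\<close>] ** * in auto)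
    have "G = (A + C) + B" by (simp add: G_def)
    then have "D = degree B" unfolding D_def using degree_add_eq_right[OF lt] by simp
    \<comment> \<open>The second bound asks for deg R - deg T > deg P - deg Q + 1. This follows from
      \<open>**\<close> if deg P - deg Q \<ge> 1, and from \<open>*\<close> otherwise.\<close>
    then show ?thesis using dB[OF \<open>R \<noteq> 0\<close>] * **
      by (cases "int (degree P) - int (degree Q) \<ge> 1") simp_all
  qed
  define c where "c = lead_coeff G"
  have c: "c \<noteq> 0" using big unfolding c_def D_def by auto
  let ?P = "polyfun_on (N + 2) S"
  have red: "?P (D - 1) (\<lambda>x. x (n+1) ^ D)" if n: "n < N" for n
  proof -
    define G' where "G' = G - monom c D"
    have dG': "degree G' \<le> D - 1"
    proof -
      have "degree G' \<le> D" unfolding G'_def D_def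
        by (rule degree_diff_le) (auto simp: degree_monom_le)
      moreover have "degree G' \<noteq> D"
      proof
        assume "degree G' = D"
        moreover have "coeff G' D = 0" by (simp add: G'_def c_def D_def)
        ultimately have "G' = 0" by (metis leading_coeff_0_iff)
        with \<open>degree G' = D\<close> big show False by simp
      qed
      ultimately show ?thesis by linarith
    qed
    let ?s = "\<lambda>x. x (n+2) + x n"
    have s: "?P 1 ?s" using n polyfun_on_var[of _ "N+2" S] by (intro polyfun_on.add) auto
    have s2: "?P 2 (\<lambda>x. (?s x)\<^sup>2)" using polyfun_on_power[OF s, of 2] by simp
    have 1: "?P (D - 1) (\<lambda>x. poly (smult (2*\<epsilon>) (T * Q * P)) (x (n+1)) * ?s x)"
    proof (rule polyfun_on_mono[OF polyfun_on_mult[OF polyfun_on_poly[OF _ order_refl] s]])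
      have "degree (smult (2*\<epsilon>) (T * Q * P)) \<le> degree T + degree Q + degree P"
        using degree_smult_le[of "2*\<epsilon>" "T*Q*P"] degree_mult_le[of "T*Q" P] degree_mult_le[of T Q] by linarith
      then show "degree (smult (2*\<epsilon>) (T * Q * P)) + 1 \<le> D - 1" using big by linarith
    qed (use n in auto)
    have 2: "?P (D - 1) (\<lambda>x. poly (T * Q\<^sup>2) (x (n+1)) * (?s x)\<^sup>2)"
    proof (rule polyfun_on_mono[OF polyfun_on_mult[OF polyfun_on_poly[OF _ order_refl] s2]])
      have "degree (T * Q\<^sup>2) = degree T + 2 * degree Q" 
        using T Q by (simp add: degree_mult_eq degree_power_eq)
      then show "degree (T * Q\<^sup>2) + 2 \<le> D - 1" using big by linarith
    qed (use n in auto)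
    have 3: "?P (D - 1) (\<lambda>x. poly G' (x (n+1)))" using n dG' by (intro polyfun_on_poly) auto
    have "?P (D - 1) (\<lambda>x. (1 / c) * (poly (smult (2*\<epsilon>) (T * Q * P)) (x (n+1)) * ?s x
            - poly (T * Q\<^sup>2) (x (n+1)) * (?s x)\<^sup>2 - poly G' (x (n+1))))"
      by (intro polyfun_on_cmult polyfun_on_diff 1 2 3)
    then show ?thesis
    proof (rule polyfun_on.cong)
      fix x assume "x \<in> S"
      have G: "poly G y = c * y ^ D + poly G' y" for y by (simp add: G'_def poly_monom)
      have "poly G (x (n+1)) = poly (smult (2*\<epsilon>) (T * Q * P)) (x (n+1)) * ?s x
            - poly (T * Q\<^sup>2) (x (n+1)) * (?s x)\<^sup>2"
        using eq[OF \<open>x \<in> S\<close>, of n] by (simp add: G_def A_def B_def C_def power2_eq_square algebra_simps)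
      then show "(1 / c) * (poly (smult (2*\<epsilon>) (T * Q * P)) (x (n+1)) * ?s x
            - poly (T * Q\<^sup>2) (x (n+1)) * (?s x)\<^sup>2 - poly G' (x (n+1))) = x (n+1) ^ D"
        using c unfolding G by (simp add: field_simps)
    qed
  qed
  show ?thesis
  proof (rule finite_coordinate_values[where m = "N + 2" and D = D])
    fix i assume i: "i < N + 2"
    \<comment> \<open>The relation at \<open>n\<close> controls only the middle entry
      \<open>x (n+1)\<close> with \<open>n < N\<close>; the end entries \<open>x 0\<close> and
      \<open>x (N+1)\<close> are reached by periodicity.\<close>
    have "\<exists>k<N. \<forall>x\<in>S. x (k + 1) = x i"
    proof -
      consider "i = 0" | "i = N + 1" | "1 \<le> i" "i \<le> N" using i by linarith
      then show ?thesis
      proof cases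
        case 1
        then show ?thesis using \<open>N > 0\<close> per[of _ 0] by (intro exI[of _ "N - 1"]) auto
      next
        case 2
        then show ?thesis using \<open>N > 0\<close> per[of _ 1] by (intro exI[of _ 0]) (metis add.commute add_0)
      next
        case 3
        then show ?thesis by (intro exI[of _ "i - 1"]) auto
      qed
    qed
    then obtain k where "k < N" "\<forall>x\<in>S. x (k + 1) = x i" by blast
    then show "?P (D - 1) (\<lambda>x. x i ^ D)" by (intro polyfun_on.cong[OF red[of k]]) auto
  qed (use big j in linarith)+
qed

section \<open>Twist maps with a first integral\<close>

lemma exists_2pi_multiple_between:
  fixes a b :: real
  assumes "b - a \<ge> 2 * pi"
  shows "\<exists>k::int. a \<le> 2 * pi * k \<and> 2 * pi * k \<le> b"
proof -
  have "a \<le> 2 * pi * \<lceil>a / (2 * pi)\<rceil>"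
    using mult_left_mono[OF le_of_int_ceiling[of "a / (2 * pi)"], of "2 * pi"] by simp
  moreover have "2 * pi * \<lceil>a / (2 * pi)\<rceil> \<le> 2 * pi * (a / (2 * pi) + 1)"
    by (rule mult_left_mono[OF of_int_ceiling_le_add_one]) simp
  ultimately show ?thesis using assms by (intro exI[of _ "\<lceil>a / (2 * pi)\<rceil>"]) (simp add: algebra_simps)
qed

lemma abs_Im_Ln_lt: "cmod (q - 1) < 1 \<Longrightarrow> \<bar>Im (Ln q)\<bar> < pi / 2"
proof -
  assume "cmod (q - 1) < 1"
  then have "Re q > 0" using abs_Re_le_cmod[of "q - 1"] by auto
  then show ?thesis by (rule Re_Ln_pos_lt_imp)
qed

text \<open>The angle of \<open>z\<close> along an orbit of \<open>\<Phi>\<close> differs from the angle of \<open>W z\<close> by a bounded amount,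
  and the latter advances by \<open>\<omega> + B |W z|\<^sup>2\<close> up to a small relative error. After many steps the
  total advance therefore varies by more than one turn along each ray, so some point returns to its
  ray. By monotonicity of the first integral \<open>E\<close> along the ray, the return is to the same point.\<close>

lemma twist_infinite_periodic:
  fixes \<Phi> W :: "complex \<Rightarrow> complex" and E :: "complex \<Rightarrow> real" and \<omega> B \<kappa> r0 :: real
  assumes r0: "r0 > 0" and \<kappa>: "\<kappa> > 0" and B: "B \<noteq> 0"
    and cont: "continuous_on (ball 0 r0) \<Phi>"
    and lin: "(\<lambda>z. \<Phi> z - cis \<omega> * z) \<in> o[nhds 0](\<lambda>z. z)"
    and W: "(\<lambda>z. W z - z) \<in> o[nhds 0](\<lambda>z. z)"
    and twist: "(\<lambda>z. W (\<Phi> z) - cis (\<omega> + B * (cmod (W z))\<^sup>2) * W z) \<in> o[nhds 0](\<lambda>z. z ^ 3)"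
    and quad: "(\<lambda>z. E z - \<kappa> * (cmod z)\<^sup>2) \<in> o[nhds 0](\<lambda>z. (cmod z)\<^sup>2)"
    and inv: "\<And>z. cmod z < r0 \<Longrightarrow> cmod (\<Phi> z) < r0 \<Longrightarrow> E (\<Phi> z) = E z"
    and mono: "\<And>u s t. cmod u = 1 \<Longrightarrow> 0 < s \<Longrightarrow> s < t \<Longrightarrow> t < r0 \<Longrightarrow>
                 E (of_real s * u) < E (of_real t * u)"
  shows "\<exists>N0. \<forall>N\<ge>N0. infinite {z. (\<forall>i. cmod ((\<Phi> ^^ i) z) < r0) \<and> (\<Phi> ^^ N) z = z}"
proof -
  have "\<forall>\<^sub>F z in nhds 0. cmod (\<Phi> z - cis \<omega> * z) \<le> 1/10 * cmod z"
    using landau_o.smallD[OF lin, of "1/10"] by simp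
  moreover have "\<forall>\<^sub>F z in nhds 0. cmod (W z - z) \<le> 1/10 * cmod z"
    using landau_o.smallD[OF W, of "1/10"] by simp
  moreover have "\<forall>\<^sub>F z in nhds 0. cmod (W (\<Phi> z) - cis (\<omega> + B * (cmod (W z))\<^sup>2) * W z) \<le> \<bar>B\<bar>/100 * cmod z ^ 3"
    using landau_o.smallD[OF twist, of "\<bar>B\<bar>/100"] B by (simp add: norm_power)
  moreover have "\<forall>\<^sub>F z in nhds 0. \<bar>E z - \<kappa> * (cmod z)\<^sup>2\<bar> \<le> \<kappa>/10 * (cmod z)\<^sup>2"
    using landau_o.smallD[OF quad, of "\<kappa>/10"] \<kappa> by simp
  moreover have "\<forall>\<^sub>F z::complex in nhds 0. \<bar>B\<bar> * (cmod z)\<^sup>2 < 1/100"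
  proof -
    have "((\<lambda>z::complex. \<bar>B\<bar> * (cmod z)\<^sup>2) \<longlongrightarrow> \<bar>B\<bar> * (cmod 0)\<^sup>2) (nhds 0)"
      by (intro tendsto_intros filterlim_ident)
    from order_tendstoD(2)[OF this, of "1/100"] show ?thesis by simp
  qed
  moreover have "\<forall>\<^sub>F z::complex in nhds 0. cmod z < r0"
    using r0 by (auto simp: eventually_nhds_metric)
  ultimately have "\<forall>\<^sub>F z in nhds 0. cmod (\<Phi> z - cis \<omega> * z) \<le> 1/10 * cmod z \<and> cmod (W z - z) \<le> 1/10 * cmod z \<and>
     cmod (W (\<Phi> z) - cis (\<omega> + B * (cmod (W z))\<^sup>2) * W z) \<le> \<bar>B\<bar>/100 * cmod z ^ 3 \<and>
     \<bar>E z - \<kappa> * (cmod z)\<^sup>2\<bar> \<le> \<kappa>/10 * (cmod z)\<^sup>2 \<and> \<bar>B\<bar> * (cmod z)\<^sup>2 < 1/100 \<and> cmod z < r0"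
    by eventually_elim blast
  then obtain \<rho> where \<rho>: "\<rho> > 0" and
    b1: "\<And>z. cmod z < \<rho> \<Longrightarrow> cmod (\<Phi> z - cis \<omega> * z) \<le> 1/10 * cmod z" and
    b2: "\<And>z. cmod z < \<rho> \<Longrightarrow> cmod (W z - z) \<le> 1/10 * cmod z" and
    b3: "\<And>z. cmod z < \<rho> \<Longrightarrow> cmod (W (\<Phi> z) - cis (\<omega> + B * (cmod (W z))\<^sup>2) * W z) \<le> \<bar>B\<bar>/100 * cmod z ^ 3" and
    b4: "\<And>z. cmod z < \<rho> \<Longrightarrow> \<bar>E z - \<kappa> * (cmod z)\<^sup>2\<bar> \<le> \<kappa>/10 * (cmod z)\<^sup>2" and
    b5: "\<And>z. cmod z < \<rho> \<Longrightarrow> \<bar>B\<bar> * (cmod z)\<^sup>2 < 1/100" and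
    b6: "\<And>z. cmod z < \<rho> \<Longrightarrow> cmod z < r0"
    unfolding eventually_nhds_metric dist_0_norm by (auto simp: dist_norm)
  \<comment> \<open>\<open>q\<close> compares a step with the rotation, \<open>t\<close> compares
    \<open>W\<close> with the identity, and \<open>m0\<close> compares a step seen through
    \<open>W\<close> with the twist. Modulo 2 pi i, \<open>Ln q\<close> is \<open>m\<close> plus a
    difference of values of \<open>Ln t\<close> that telescopes along an orbit.\<close>
  define q where "q z = \<Phi> z / (cis \<omega> * z)" for z
  define t where "t z = W z / z" for z
  define m0 where "m0 z = W (\<Phi> z) / (cis (\<omega> + B * (cmod (W z))\<^sup>2) * W z)" for z
  define m where "m z = \<i> * of_real (B * (cmod (W z))\<^sup>2) + Ln (m0 z)" for z
  have q: "cmod (q z - 1) \<le> 1/10" if "cmod z < \<rho>" "z \<noteq> 0" for z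
  proof -
    have "q z - 1 = (\<Phi> z - cis \<omega> * z) / (cis \<omega> * z)" using that by (simp add: q_def field_simps)
    then show ?thesis using b1[OF that(1)] that(2) by (simp add: norm_divide norm_mult divide_le_eq)
  qed
  have t: "cmod (t z - 1) \<le> 1/10" if "cmod z < \<rho>" "z \<noteq> 0" for z
  proof -
    have "t z - 1 = (W z - z) / z" using that by (simp add: t_def field_simps)
    then show ?thesis using b2[OF that(1)] that(2) by (simp add: norm_divide divide_le_eq)
  qed
  have nz: "w \<noteq> 0" if "cmod (w - 1) \<le> 1/10" for w :: complex using that by auto
  have Wlo: "9/10 * cmod z \<le> cmod (W z)" and Wup: "cmod (W z) \<le> 11/10 * cmod z" if "cmod z < \<rho>" for z
  proof -
    have "cmod z \<le> cmod (W z) + cmod (W z - z)" by (metis norm_minus_commute norm_triangle_sub)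
    with b2[OF that] show "9/10 * cmod z \<le> cmod (W z)" by linarith
    have "cmod (W z) \<le> cmod z + cmod (W z - z)" by (metis norm_triangle_sub)
    with b2[OF that] show "cmod (W z) \<le> 11/10 * cmod z" by linarith
  qed
  have \<Phi>lo: "9/10 * cmod z \<le> cmod (\<Phi> z)" and \<Phi>up: "cmod (\<Phi> z) \<le> 11/10 * cmod z" if "cmod z < \<rho>" for z
  proof -
    have eq: "cmod (cis \<omega> * z) = cmod z" by (simp add: norm_mult)
    have "cmod (cis \<omega> * z) \<le> cmod (\<Phi> z) + cmod (\<Phi> z - cis \<omega> * z)" by (metis norm_minus_commute norm_triangle_sub)
    with b1[OF that] eq show "9/10 * cmod z \<le> cmod (\<Phi> z)" by linarith
    have "cmod (\<Phi> z) \<le> cmod (cis \<omega> * z) + cmod (\<Phi> z - cis \<omega> * z)" by (metis norm_triangle_sub)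
    with b1[OF that] eq show "cmod (\<Phi> z) \<le> 11/10 * cmod z" by linarith
  qed
  have m0: "cmod (m0 z - 1) \<le> \<bar>B\<bar>/90 * (cmod z)\<^sup>2" if "cmod z < \<rho>" "z \<noteq> 0" for z
  proof -
    have "W z \<noteq> 0" using Wlo[OF that(1)] that(2) by auto
    then have "m0 z - 1 = (W (\<Phi> z) - cis (\<omega> + B * (cmod (W z))\<^sup>2) * W z) / (cis (\<omega> + B * (cmod (W z))\<^sup>2) * W z)"
      by (simp add: m0_def diff_divide_distrib)
    then have "cmod (m0 z - 1) = cmod (W (\<Phi> z) - cis (\<omega> + B * (cmod (W z))\<^sup>2) * W z) / cmod (W z)"
      by (simp add: norm_divide norm_mult)
    also have "\<dots> \<le> (\<bar>B\<bar>/100 * cmod z ^ 3) / (9/10 * cmod z)"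
      using b3[OF that(1)] Wlo[OF that(1)] that(2) by (intro frac_le) auto
    also have "\<dots> = \<bar>B\<bar>/90 * (cmod z)\<^sup>2" using that(2) by (simp add: power3_eq_cube power2_eq_square)
    finally show ?thesis .
  qed
  have step: "Ln (q z) + Ln (t (\<Phi> z)) - Ln (t z) = m z"
    and m_bound: "\<bar>Im (m z) - B * (cmod (W z))\<^sup>2\<bar> \<le> \<bar>B\<bar>/45 * (cmod z)\<^sup>2"
    if z: "cmod z < \<rho> / 2" "z \<noteq> 0" for z
  proof -
    have z1: "cmod z < \<rho>" using z \<rho> by linarith
    have z2: "cmod (\<Phi> z) < \<rho>" "\<Phi> z \<noteq> 0" using \<Phi>up[OF z1] \<Phi>lo[OF z1] z by auto
    have Wz: "W z \<noteq> 0" using Wlo[OF z1] z(2) by auto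
    have sm: "cmod (m0 z - 1) < 1/2" using m0[OF z1 z(2)] b5[OF z1] by linarith
    then have "m0 z \<noteq> 0" by auto
    have "cmod (Ln (1 + (m0 z - 1))) \<le> 2 * cmod (m0 z - 1)" by (rule norm_Ln_le) (rule sm)
    then have "cmod (Ln (m0 z)) \<le> \<bar>B\<bar>/45 * (cmod z)\<^sup>2" using m0[OF z1 z(2)] by simp
    then have "\<bar>Im (Ln (m0 z))\<bar> \<le> \<bar>B\<bar>/45 * (cmod z)\<^sup>2" using abs_Im_le_cmod order_trans by blast
    then show *: "\<bar>Im (m z) - B * (cmod (W z))\<^sup>2\<bar> \<le> \<bar>B\<bar>/45 * (cmod z)\<^sup>2" by (simp add: m_def)
    have "\<bar>B * (cmod (W z))\<^sup>2\<bar> \<le> \<bar>B\<bar> * (11/10 * cmod z)\<^sup>2"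
      unfolding abs_mult using Wup[OF z1] by (intro mult_mono) (auto intro: power_mono)
    also have "\<dots> = 121/100 * (\<bar>B\<bar> * (cmod z)\<^sup>2)" by (simp add: power_mult_distrib power2_eq_square)
    finally have "\<bar>Im (m z)\<bar> < 1" using * b5[OF z1] by linarith
    \<comment> \<open>Three angles below pi / 2 and one below 1 add up to less than 2 pi, so the
      logarithms agree exactly and not just modulo 2 pi i.\<close>
    moreover have "\<bar>Im (Ln (q z))\<bar> < pi / 2" "\<bar>Im (Ln (t z))\<bar> < pi / 2" "\<bar>Im (Ln (t (\<Phi> z)))\<bar> < pi / 2"
      using q[OF z1 z(2)] t[OF z1 z(2)] t[OF z2] by (linarith | intro abs_Im_Ln_lt)+
    ultimately have "\<bar>Im (Ln (q z) + Ln (t (\<Phi> z)) - Ln (t z)) - Im (m z)\<bar> < 2 * pi"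
      using pi_gt3 by simp
    moreover have "exp (Ln (q z) + Ln (t (\<Phi> z)) - Ln (t z)) = exp (m z)"
    proof -
      have nz': "q z \<noteq> 0" "t (\<Phi> z) \<noteq> 0" "t z \<noteq> 0"
        using q[OF z1 z(2)] t[OF z1 z(2)] t[OF z2] by (auto intro!: nz)
      have "exp (m z) = cis (B * (cmod (W z))\<^sup>2) * m0 z"
        using \<open>m0 z \<noteq> 0\<close> by (simp add: m_def exp_add cis_conv_exp)
      also have "\<dots> = W (\<Phi> z) / (cis \<omega> * W z)"
        using Wz by (simp add: m0_def cis_mult[symmetric] field_simps)
      also have "\<dots> = q z * t (\<Phi> z) / t z"
        using z z2 Wz by (simp add: q_def t_def field_simps)
      finally show ?thesis using nz' by (simp add: exp_add exp_diff)
    qed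
    ultimately show "Ln (q z) + Ln (t (\<Phi> z)) - Ln (t z) = m z" by (rule exp_complex_eqI)
  qed
  \<comment> \<open>Confinement for all times: \<open>E\<close> is conserved and within ten percent
    of \<kappa> |z|^2, so the squared modulus changes at most by a factor 11/9 < 5/4. The comparison
    is always with the initial point, so errors do not accumulate.\<close>
  have orbit: "4/5 * (cmod z)\<^sup>2 \<le> (cmod ((\<Phi> ^^ n) z))\<^sup>2 \<and> (cmod ((\<Phi> ^^ n) z))\<^sup>2 \<le> 5/4 * (cmod z)\<^sup>2
      \<and> E ((\<Phi> ^^ n) z) = E z" if z: "cmod z < \<rho> / 4" for z n
  proof (induction n)
    case 0
    then show ?case by simp
  next
    case (Suc n)
    let ?y = "(\<Phi> ^^ n) z"
    have "(cmod ?y)\<^sup>2 \<le> (5/4 * cmod z)\<^sup>2"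
      using Suc by (simp add: power_mult_distrib power2_eq_square)
    then have y: "cmod ?y \<le> 5/4 * cmod z" by (rule power2_le_imp_le) simp
    then have y1: "cmod ?y < \<rho>" using z \<rho> by linarith
    have y2: "cmod (\<Phi> ?y) < \<rho>" using \<Phi>up[OF y1] y z \<rho> by linarith
    have E: "E (\<Phi> ?y) = E z" using inv[OF b6[OF y1] b6[OF y2]] Suc by simp
    have z1: "cmod z < \<rho>" using z \<rho> by linarith
    let ?a = "(cmod (\<Phi> ?y))\<^sup>2" and ?b = "(cmod z)\<^sup>2"
    have "\<kappa> * (9/10 * ?a) \<le> \<kappa> * (11/10 * ?b)" "\<kappa> * (9/10 * ?b) \<le> \<kappa> * (11/10 * ?a)"
      using b4[OF y2] b4[OF z1] E unfolding abs_le_iff by (simp_all add: algebra_simps)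
    then have "9/10 * ?a \<le> 11/10 * ?b" "9/10 * ?b \<le> 11/10 * ?a" using \<kappa> by (simp_all add: mult_le_cancel_left_pos)
    moreover have "?b \<ge> 0" by simp
    ultimately have "4/5 * ?b \<le> ?a" "?a \<le> 5/4 * ?b" by linarith+
    then show ?case using E by simp
  qed
  have orbit_norm: "cmod ((\<Phi> ^^ n) z) < \<rho> / 2" if "cmod z < \<rho> / 4" for z n
  proof -
    have "(cmod ((\<Phi> ^^ n) z))\<^sup>2 \<le> 5/4 * (cmod z)\<^sup>2" using orbit[OF that] by blast
    also have "\<dots> \<le> (2 * cmod z)\<^sup>2" by (simp add: power_mult_distrib)
    finally have "cmod ((\<Phi> ^^ n) z) \<le> 2 * cmod z" by (rule power2_le_imp_le) simp
    then show ?thesis using that by linarith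
  qed
  have orbit_nz: "(\<Phi> ^^ n) z \<noteq> 0" if "cmod z < \<rho> / 4" "z \<noteq> 0" for z n
    using orbit[OF that(1), of n] that(2) by auto
  \<comment> \<open>The total angle of \<open>n\<close> steps as a real number, not modulo 2 pi. It
    is continuous in \<open>z\<close> because each value of \<open>q\<close> stays near 1, away from
    the branch cut of \<open>Ln\<close>.\<close>
  define A where "A n z = (\<Sum>i<n. \<omega> + Im (Ln (q ((\<Phi> ^^ i) z))))" for n z
  have A_dir: "(\<Phi> ^^ n) z = of_real (cmod ((\<Phi> ^^ n) z) / cmod z) * cis (A n z) * z"
    if z: "cmod z < \<rho> / 4" "z \<noteq> 0" for z n
  proof (induction n)
    case 0
    then show ?case using z by (simp add: A_def)
  next
    case (Suc n)
    let ?y = "(\<Phi> ^^ n) z"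
    have y: "cmod ?y < \<rho>" "?y \<noteq> 0" using orbit_norm[OF z(1), of n] orbit_nz[OF z] \<rho> by auto
    have "q ?y \<noteq> 0" using q[OF y] by (intro nz)
    then have "q ?y = of_real (cmod (q ?y)) * cis (Im (Ln (q ?y)))"
      by (metis Arg_eq_Im_Ln rcis_cmod_Arg rcis_def)
    moreover have "cmod (q ?y) = cmod (\<Phi> ?y) / cmod ?y" by (simp add: q_def norm_divide norm_mult)
    ultimately have polar: "q ?y = of_real (cmod (\<Phi> ?y) / cmod ?y) * cis (Im (Ln (q ?y)))" by metis
    have "\<Phi> ?y = q ?y * cis \<omega> * ?y" using y by (simp add: q_def)
    also have "\<dots> = of_real (cmod (\<Phi> ?y) / cmod ?y) * cis (\<omega> + Im (Ln (q ?y))) * ?y"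
      by (subst polar) (simp only: cis_mult[symmetric] mult_ac)
    also have "\<dots> = of_real (cmod (\<Phi> ?y) / cmod ?y) * cis (\<omega> + Im (Ln (q ?y))) *
        (of_real (cmod ?y / cmod z) * cis (A n z) * z)"
      by (subst Suc.IH[symmetric]) (rule refl)
    also have "\<dots> = of_real (cmod (\<Phi> ?y) / cmod z) * cis (A (Suc n) z) * z"
      using y(2) by (simp add: A_def cis_mult[symmetric] mult_ac)
    finally show ?case by simp
  qed
  \<comment> \<open>\<open>W\<close> changes moduli by at most ten percent, squared moduli along the
    orbit vary between the factors 4/5 and 5/4, and \<open>m\<close> has an error of 1/45 |z|^2
    relative to \<open>B\<close>. The constants fit since 0.81 * 0.8 - 1.25/45 > 3/5 and 1.21 * 1.25
    + 1.25/45 < 8/5. The error pi is what telescoping leaves of \<open>t\<close>.\<close>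
  have A_est: "\<exists>s. \<bar>A n z - n * \<omega> - B * s\<bar> \<le> pi \<and> 3/5 * n * (cmod z)\<^sup>2 \<le> s \<and> s \<le> 8/5 * n * (cmod z)\<^sup>2"
    if z: "cmod z < \<rho> / 4" "z \<noteq> 0" for z n
  proof -
    define s where "s = (\<Sum>i<n. Im (m ((\<Phi> ^^ i) z))) / B"
    have "A n z - n * \<omega> = (\<Sum>i<n. Im (Ln (q ((\<Phi> ^^ i) z))))" by (simp add: A_def sum.distrib)
    also have "\<dots> = (\<Sum>i<n. Im (m ((\<Phi> ^^ i) z)) + (Im (Ln (t ((\<Phi> ^^ i) z))) - Im (Ln (t ((\<Phi> ^^ Suc i) z)))))"
    proof (rule sum.cong[OF refl])
      fix i
      from arg_cong[OF step[OF orbit_norm[OF z(1)] orbit_nz[OF z], of i], of Im]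
      show "Im (Ln (q ((\<Phi> ^^ i) z))) = Im (m ((\<Phi> ^^ i) z)) + (Im (Ln (t ((\<Phi> ^^ i) z))) - Im (Ln (t ((\<Phi> ^^ Suc i) z))))"
        by simp
    qed
    also have "\<dots> = B * s + (Im (Ln (t z)) - Im (Ln (t ((\<Phi> ^^ n) z))))"
      using sum_lessThan_telescope'[of "\<lambda>i. Im (Ln (t ((\<Phi> ^^ i) z)))" n] B
      by (simp only: sum.distrib) (simp add: s_def)
    finally have "A n z - n * \<omega> - B * s = Im (Ln (t z)) - Im (Ln (t ((\<Phi> ^^ n) z)))" by simp
    moreover have "\<bar>Im (Ln (t ((\<Phi> ^^ i) z)))\<bar> < pi / 2" for i
      by (rule abs_Im_Ln_lt) (use t[OF _ orbit_nz[OF z, of i]] orbit_norm[OF z(1), of i] \<rho> in auto)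
    from this[of 0] this[of n] have "\<bar>Im (Ln (t z)) - Im (Ln (t ((\<Phi> ^^ n) z)))\<bar> \<le> pi" by simp
    ultimately have 1: "\<bar>A n z - n * \<omega> - B * s\<bar> \<le> pi" by simp
    have each: "3/5 * (cmod z)\<^sup>2 \<le> Im (m ((\<Phi> ^^ i) z)) / B \<and> Im (m ((\<Phi> ^^ i) z)) / B \<le> 8/5 * (cmod z)\<^sup>2" for i
    proof -
      let ?y = "(\<Phi> ^^ i) z"
      have y: "cmod ?y < \<rho> / 2" "?y \<noteq> 0" "cmod ?y < \<rho>" using orbit_norm[OF z(1), of i] orbit_nz[OF z] \<rho> by auto
      have "\<bar>Im (m ?y) / B - (cmod (W ?y))\<^sup>2\<bar> = \<bar>Im (m ?y) - B * (cmod (W ?y))\<^sup>2\<bar> / \<bar>B\<bar>"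
        using B by (simp add: field_simps flip: abs_divide)
      also have "\<dots> \<le> (\<bar>B\<bar>/45 * (cmod ?y)\<^sup>2) / \<bar>B\<bar>" using m_bound[OF y(1,2)] by (intro divide_right_mono) auto
      also have "\<dots> = 1/45 * (cmod ?y)\<^sup>2" using B by simp
      finally have "\<bar>Im (m ?y) / B - (cmod (W ?y))\<^sup>2\<bar> \<le> 1/45 * (cmod ?y)\<^sup>2" .
      moreover have "81/100 * (cmod ?y)\<^sup>2 \<le> (cmod (W ?y))\<^sup>2"
        using power_mono[OF Wlo[OF y(3)], of 2] by (simp add: power_mult_distrib power2_eq_square)
      moreover have "(cmod (W ?y))\<^sup>2 \<le> 121/100 * (cmod ?y)\<^sup>2"
        using power_mono[OF Wup[OF y(3)], of 2] by (simp add: power_mult_distrib power2_eq_square)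
      moreover have "4/5 * (cmod z)\<^sup>2 \<le> (cmod ?y)\<^sup>2" "(cmod ?y)\<^sup>2 \<le> 5/4 * (cmod z)\<^sup>2"
        using orbit[OF z(1), of i] by auto
      moreover have "(cmod z)\<^sup>2 \<ge> 0" by simp
      ultimately show ?thesis unfolding abs_le_iff by linarith
    qed
    have "(\<Sum>i<n. 3/5 * (cmod z)\<^sup>2) \<le> s" "s \<le> (\<Sum>i<n. 8/5 * (cmod z)\<^sup>2)"
      unfolding s_def sum_divide_distrib by (rule sum_mono; use each in blast)+
    then have "3/5 * n * (cmod z)\<^sup>2 \<le> s" "s \<le> 8/5 * n * (cmod z)\<^sup>2" by (simp_all add: mult_ac)
    with 1 show ?thesis by blast
  qed
  have A_cont: "continuous_on {z. cmod z < \<rho> / 4 \<and> z \<noteq> 0} (A n)" for n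
  proof -
    let ?D = "{z. cmod z < \<rho> / 4 \<and> z \<noteq> 0}"
    have c: "continuous_on ?D (\<Phi> ^^ i)" for i
    proof (induction i)
      case (Suc i)
      have "continuous_on ((\<Phi> ^^ i) ` ?D) \<Phi>"
      proof (rule continuous_on_subset[OF cont], safe)
        fix z assume z: "cmod z < \<rho> / 4"
        have "cmod ((\<Phi> ^^ i) z) < r0" by (rule b6) (use orbit_norm[OF z, of i] \<rho> in linarith)
        then show "(\<Phi> ^^ i) z \<in> ball 0 r0" by simp
      qed
      from continuous_on_compose[OF Suc this] show ?case by (simp add: o_def)
    qed (simp add: id_def)
    have c': "continuous_on ?D (\<lambda>z. \<Phi> ((\<Phi> ^^ i) z))" for i using c[of "Suc i"] by (simp add: o_def)
    show ?thesis unfolding A_def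
    proof (intro continuous_on_sum continuous_on_add continuous_on_const continuous_on_Im continuous_on_Ln')
      fix i
      show "continuous_on ?D (\<lambda>z. q ((\<Phi> ^^ i) z))"
        unfolding q_def using c c' orbit_nz by (intro continuous_intros) auto
      fix z assume "z \<in> ?D"
      then have "cmod (q ((\<Phi> ^^ i) z) - 1) \<le> 1/10"
        using orbit_norm[of z i] orbit_nz[of z i] \<rho> by (intro q) auto
      then have "Re (q ((\<Phi> ^^ i) z)) > 0"
        using abs_Re_le_cmod[of "q ((\<Phi> ^^ i) z) - 1"] by auto
      then show "q ((\<Phi> ^^ i) z) \<notin> \<real>\<^sub>\<le>\<^sub>0" by (auto simp: complex_nonpos_Reals_iff)
    qed
  qed
  \<comment> \<open>Halving the radius divides the squared modulus by 4: 8/5 r1^2 = 2/5 r2^2 lies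
    below 3/5 r2^2, so the twists at the two ends of a ray are at least 1/5 r2^2 apart per
    step.\<close>
  define r2 where "r2 = \<rho> / 5"
  define r1 where "r1 = r2 / 2"
  have r: "0 < r1" "r1 < r2" "r2 < \<rho> / 4" using \<rho> by (auto simp: r1_def r2_def)
  \<comment> \<open>A gap of 4 pi leaves a full turn after subtracting the error pi at each
    end.\<close>
  obtain N0 :: nat where N0: "4 * pi \<le> N0 * (\<bar>B\<bar> * (1/5 * r2\<^sup>2))"
  proof -
    have "\<bar>B\<bar> * (1/5 * r2\<^sup>2) > 0" using B r by simp
    then show ?thesis using that reals_Archimedean3 by (meson less_imp_le)
  qed
  have "infinite {z. (\<forall>i. cmod ((\<Phi> ^^ i) z) < r0) \<and> (\<Phi> ^^ N) z = z}" (is "infinite ?S") if "N \<ge> N0" for N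
  proof -
    have ray: "\<exists>s. r1 \<le> s \<and> s \<le> r2 \<and> (\<Phi> ^^ N) (of_real s * u) = of_real s * u" if u: "cmod u = 1" for u
    proof -
      \<comment> \<open>The sign makes the angle larger at the outer end also for negative
        \<open>B\<close>.\<close>
      define G where "G s = sgn B * A N (of_real s * u)" for s
      have G_cont: "continuous_on {r1..r2} G"
        unfolding G_def
        by (intro continuous_intros continuous_on_compose2[OF A_cont]) (use r u in \<open>auto simp: norm_mult\<close>)
      have ru: "cmod (of_real r1 * u) = r1" "cmod (of_real r2 * u) = r2" using r u by (auto simp: norm_mult)
      have "of_real r1 * u \<noteq> 0" "of_real r2 * u \<noteq> 0" using r u by auto
      from A_est[OF _ this(1), of N] A_est[OF _ this(2), of N] r obtain s1 s2 where
        s1: "\<bar>A N (of_real r1 * u) - N * \<omega> - B * s1\<bar> \<le> pi" "s1 \<le> 8/5 * N * r1\<^sup>2" and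
        s2: "\<bar>A N (of_real r2 * u) - N * \<omega> - B * s2\<bar> \<le> pi" "3/5 * N * r2\<^sup>2 \<le> s2"
        unfolding ru by auto
      have "8/5 * N * r1\<^sup>2 = 2/5 * N * r2\<^sup>2" by (simp add: r1_def power2_eq_square)
      then have "s1 \<le> 2/5 * N * r2\<^sup>2" using s1(2) by linarith
      then have "s2 - s1 \<ge> N * (1/5 * r2\<^sup>2)" using s2(2) by (simp add: algebra_simps)
      then have "\<bar>B\<bar> * (s2 - s1) \<ge> \<bar>B\<bar> * (N * (1/5 * r2\<^sup>2))" by (intro mult_left_mono) auto
      moreover have "N * (\<bar>B\<bar> * (1/5 * r2\<^sup>2)) \<ge> N0 * (\<bar>B\<bar> * (1/5 * r2\<^sup>2))"
        using \<open>N \<ge> N0\<close> by (intro mult_right_mono) auto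
      moreover have "\<bar>B\<bar> * (N * (1/5 * r2\<^sup>2)) = N * (\<bar>B\<bar> * (1/5 * r2\<^sup>2))" by simp
      ultimately have big: "\<bar>B\<bar> * (s2 - s1) \<ge> 4 * pi" using N0 by linarith
      have "G r2 - G r1 = \<bar>B\<bar> * (s2 - s1) + sgn B * (A N (of_real r2 * u) - N * \<omega> - B * s2)
          - sgn B * (A N (of_real r1 * u) - N * \<omega> - B * s1)"
        unfolding G_def abs_sgn by (simp add: algebra_simps)
      moreover have "\<bar>sgn B * (A N (of_real r2 * u) - N * \<omega> - B * s2)\<bar> \<le> pi"
        "\<bar>sgn B * (A N (of_real r1 * u) - N * \<omega> - B * s1)\<bar> \<le> pi"
        unfolding abs_mult using B s1 s2 by (simp_all add: abs_sgn_eq)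
      ultimately have "G r2 - G r1 \<ge> 2 * pi" using big unfolding abs_le_iff by linarith
      from exists_2pi_multiple_between[OF this] obtain k :: int where
        "G r1 \<le> 2 * pi * k" "2 * pi * k \<le> G r2" by blast
      from IVT'[OF this _ G_cont] r obtain s where s: "r1 \<le> s" "s \<le> r2" "G s = 2 * pi * k" by auto
      let ?z = "of_real s * u"
      have s0: "s > 0" using s r by linarith
      have z: "cmod ?z = s" "cmod ?z < \<rho> / 4" "?z \<noteq> 0" using s s0 r u by (auto simp: norm_mult)
      have "A N ?z = sgn B * (2 * pi * k)"
        using s(3) B by (simp add: G_def sgn_if split: if_splits)
      then have "A N ?z = 2 * pi * of_int (if B > 0 then k else - k)" using B by (auto simp: sgn_if)
      then have "cis (A N ?z) = 1" by (simp only: cis_multiple_2pi Ints_of_int)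
      define s' where "s' = cmod ((\<Phi> ^^ N) ?z)"
      have ret: "(\<Phi> ^^ N) ?z = of_real s' * u"
        using A_dir[OF z(2,3), of N] s0 unfolding \<open>cis (A N ?z) = 1\<close> z(1) s'_def by simp
      have "E (of_real s' * u) = E (of_real s * u)" using orbit[OF z(2), of N] ret by simp
      moreover have "s' > 0" using orbit_nz[OF z(2,3)] by (simp add: s'_def)
      moreover have "s' < r0" unfolding s'_def using orbit_norm[OF z(2), of N] \<rho> by (intro b6) simp
      moreover have "s < r0" using b6[of ?z] z \<rho> by simp
      ultimately have "s' = s" using mono[OF u, of s s'] mono[OF u, of s' s] s0 by (cases s s' rule: linorder_cases) auto
      then show ?thesis using s ret by auto
    qed
    \<comment> \<open>One periodic point on each ray: \<open>sgn\<close> maps them onto the unit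
      circle, which is infinite.\<close>
    have "\<exists>z\<in>?S. sgn z = u" if u: "u \<in> sphere 0 1" for u
    proof -
      have u1: "cmod u = 1" using u by simp
      from ray[OF this] obtain s where s: "r1 \<le> s" "s \<le> r2" "(\<Phi> ^^ N) (of_real s * u) = of_real s * u" by blast
      have n: "cmod (of_real s * u) = s" using u1 s r by (simp add: norm_mult)
      have "cmod ((\<Phi> ^^ i) (of_real s * u)) < r0" for i
        using orbit_norm[of "of_real s * u" i] n s r \<rho> by (intro b6) auto
      moreover have "sgn (of_real s * u) = u" using u1 s r by (simp add: sgn_eq norm_mult)
      ultimately show ?thesis using s(3) by blast
    qed
    then have "sphere 0 1 \<subseteq> sgn ` ?S" by force
    moreover have "infinite (sphere (0::complex) 1)"
    proof
      assume "finite (sphere (0::complex) 1)"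
      moreover have "{0..1} \<subseteq> Re ` sphere 0 1"
      proof
        fix x :: real assume "x \<in> {0..1}"
        then have "Complex x (sqrt (1 - x\<^sup>2)) \<in> sphere 0 1"
          by (simp add: cmod_def power_le_one)
        then show "x \<in> Re ` sphere 0 1" by force
      qed
      ultimately have "finite {0..1::real}" by (meson finite_surj)
      then show False using infinite_Icc[of "0::real" 1] by simp
    qed
    ultimately show ?thesis using finite_surj by blast
  qed
  then show ?thesis by blast
qed

section \<open>Normal form at an elliptic fixed point\<close>

text \<open>A Lipschitz bound that tends to 0 at the origin expresses that \<open>S\<close> has no
  linear part, so \<open>w + S w\<close> can be inverted near 0 by contraction. Fixing the unit disc
  lets such maps be added with no shrinking of domains.\<close>

definition quadratic_lipschitz :: "(complex \<Rightarrow> 'a::real_normed_vector) \<Rightarrow> bool" where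
  "quadratic_lipschitz S \<longleftrightarrow> (\<exists>K\<ge>0. \<forall>w w'. cmod w \<le> 1 \<longrightarrow> cmod w' \<le> 1 \<longrightarrow>
     norm (S w - S w') \<le> K * (cmod w + cmod w') * cmod (w - w'))"

lemma quadratic_lipschitzI:
  assumes "K \<ge> 0" "\<And>w w'. cmod w \<le> 1 \<Longrightarrow> cmod w' \<le> 1 \<Longrightarrow>
     norm (S w - S w') \<le> K * (cmod w + cmod w') * cmod (w - w')"
  shows "quadratic_lipschitz S"
  using assms unfolding quadratic_lipschitz_def by blast

lemma quadratic_lipschitz_add:
  assumes "quadratic_lipschitz S" "quadratic_lipschitz S'"
  shows "quadratic_lipschitz (\<lambda>w. S w + S' w)"
proof -
  from assms obtain K K' where K: "K \<ge> 0" "K' \<ge> 0" and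
    b: "\<And>w w'. cmod w \<le> 1 \<Longrightarrow> cmod w' \<le> 1 \<Longrightarrow> norm (S w - S w') \<le> K * (cmod w + cmod w') * cmod (w - w')"
    "\<And>w w'. cmod w \<le> 1 \<Longrightarrow> cmod w' \<le> 1 \<Longrightarrow> norm (S' w - S' w') \<le> K' * (cmod w + cmod w') * cmod (w - w')"
    unfolding quadratic_lipschitz_def by blast
  show ?thesis
  proof (rule quadratic_lipschitzI[of "K + K'"])
    fix w w' assume w: "cmod w \<le> 1" "cmod w' \<le> 1"
    have "norm (S w + S' w - (S w' + S' w')) \<le> norm (S w - S w') + norm (S' w - S' w')"
      by (metis add_diff_add norm_triangle_ineq)
    also have "\<dots> \<le> (K + K') * (cmod w + cmod w') * cmod (w - w')"
      using b[OF w] by (simp add: algebra_simps)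
    finally show "norm (S w + S' w - (S w' + S' w')) \<le> (K + K') * (cmod w + cmod w') * cmod (w - w')" .
  qed (use K in simp)
qed

lemma quadratic_lipschitz_bounded_linear:
  assumes "bounded_linear L" "quadratic_lipschitz S"
  shows "quadratic_lipschitz (\<lambda>w. L (S w))"
proof -
  interpret bounded_linear L by fact
  obtain M where M: "M > 0" "\<And>x. norm (L x) \<le> norm x * M" using pos_bounded by blast
  from assms(2) obtain K where K: "K \<ge> 0" and
    b: "\<And>w w'. cmod w \<le> 1 \<Longrightarrow> cmod w' \<le> 1 \<Longrightarrow> norm (S w - S w') \<le> K * (cmod w + cmod w') * cmod (w - w')"
    unfolding quadratic_lipschitz_def by blast
  show ?thesis
  proof (rule quadratic_lipschitzI[of "K * M"])
    fix w w' assume w: "cmod w \<le> 1" "cmod w' \<le> 1"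
    have "norm (L (S w) - L (S w')) \<le> norm (S w - S w') * M" using M(2) by (simp flip: diff)
    also have "\<dots> \<le> K * (cmod w + cmod w') * cmod (w - w') * M"
      using b[OF w] M(1) by (intro mult_right_mono) auto
    finally show "norm (L (S w) - L (S w')) \<le> K * M * (cmod w + cmod w') * cmod (w - w')"
      by (simp add: mult_ac)
  qed (use K M in simp)
qed

lemma quadratic_lipschitz_power2: "quadratic_lipschitz (\<lambda>w. w\<^sup>2)"
proof (rule quadratic_lipschitzI[of 1])
  fix w w' :: complex
  have "w\<^sup>2 - w'\<^sup>2 = (w + w') * (w - w')" by (simp add: power2_eq_square algebra_simps)
  then show "cmod (w\<^sup>2 - w'\<^sup>2) \<le> 1 * (cmod w + cmod w') * cmod (w - w')"
    by (auto simp: norm_mult intro!: mult_right_mono norm_triangle_ineq)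
qed simp

lemma quadratic_lipschitz_cmod2: "quadratic_lipschitz (\<lambda>w. (cmod w)\<^sup>2)"
proof (rule quadratic_lipschitzI[of 1])
  fix w w' :: complex
  have "(cmod w)\<^sup>2 - (cmod w')\<^sup>2 = (cmod w + cmod w') * (cmod w - cmod w')"
    by (simp add: power2_eq_square algebra_simps)
  then have "norm ((cmod w)\<^sup>2 - (cmod w')\<^sup>2) = (cmod w + cmod w') * \<bar>cmod w - cmod w'\<bar>"
    by (simp add: abs_mult)
  also have "\<dots> \<le> (cmod w + cmod w') * cmod (w - w')"
    by (intro mult_left_mono norm_triangle_ineq3) auto
  finally show "norm ((cmod w)\<^sup>2 - (cmod w')\<^sup>2) \<le> 1 * (cmod w + cmod w') * cmod (w - w')" by simp
qed simp

lemma quadratic_lipschitz_power3: "quadratic_lipschitz (\<lambda>w. w ^ 3)"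
proof (rule quadratic_lipschitzI[of 2])
  fix w w' :: complex assume w: "cmod w \<le> 1" "cmod w' \<le> 1"
  have "w ^ 3 - w' ^ 3 = (w * (w + w') + w' * w') * (w - w')"
    by (simp add: power3_eq_cube algebra_simps)
  moreover have "cmod (w * (w + w') + w' * w') \<le> 2 * (cmod w + cmod w')"
  proof -
    have "cmod (w * (w + w') + w' * w') \<le> cmod w * cmod (w + w') + cmod w' * cmod w'"
      by (metis norm_mult norm_triangle_ineq)
    also have "\<dots> \<le> 1 * (cmod w + cmod w') + 1 * cmod w'"
      using w by (intro add_mono mult_mono norm_triangle_ineq) auto
    finally show ?thesis by (smt (verit) norm_ge_zero)
  qed
  ultimately show "cmod (w ^ 3 - w' ^ 3) \<le> 2 * (cmod w + cmod w') * cmod (w - w')"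
    by (simp add: norm_mult mult_right_mono)
qed simp

lemma cmod_cis_diff_le: "cmod (cis a - cis b) \<le> \<bar>a - b\<bar>"
proof -
  have "cis a - cis b = cis b * (exp (\<i> * of_real (a - b)) - 1)"
    by (simp add: cis_conv_exp algebra_simps flip: exp_add)
  then have "cmod (cis a - cis b) = cmod (exp (\<i> * of_real (a - b)) - 1)" by (simp add: norm_mult)
  also have "\<dots> \<le> \<bar>a - b\<bar>"
    unfolding dist_exp_i_1 using abs_sin_x_le_abs_x[of "(a - b) / 2"] by simp
  finally show ?thesis .
qed

definition twist_map :: "real \<Rightarrow> real \<Rightarrow> complex \<Rightarrow> complex" where
  "twist_map \<omega> B w = cis (\<omega> + B * (cmod w)\<^sup>2) * w"

lemma cmod_twist_map [simp]: "cmod (twist_map \<omega> B w) = cmod w"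
  by (simp add: twist_map_def norm_mult)

lemma quadratic_lipschitz_twist_map: "quadratic_lipschitz (\<lambda>w. twist_map \<omega> B w - cis \<omega> * w)"
proof (rule quadratic_lipschitzI[of "2 * \<bar>B\<bar>"])
  fix w w' :: complex assume w: "cmod w \<le> 1" "cmod w' \<le> 1"
  let ?m = "\<lambda>w. cis (\<omega> + B * (cmod w)\<^sup>2)"
  have "twist_map \<omega> B w - cis \<omega> * w - (twist_map \<omega> B w' - cis \<omega> * w')
      = (?m w - cis \<omega>) * (w - w') + (?m w - ?m w') * w'"
    by (simp add: twist_map_def algebra_simps)
  then have "cmod (twist_map \<omega> B w - cis \<omega> * w - (twist_map \<omega> B w' - cis \<omega> * w'))
      \<le> cmod (?m w - cis \<omega>) * cmod (w - w') + cmod (?m w - ?m w') * cmod w'"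
    by (metis norm_mult norm_triangle_ineq)
  also have "\<dots> \<le> (\<bar>B\<bar> * cmod w) * cmod (w - w') + (\<bar>B\<bar> * ((cmod w + cmod w') * cmod (w - w'))) * 1"
  proof (intro add_mono mult_mono order_refl)
    have "cmod (?m w - cis \<omega>) \<le> \<bar>B\<bar> * (cmod w * cmod w)"
      using cmod_cis_diff_le[of "\<omega> + B * (cmod w)\<^sup>2" \<omega>] by (simp add: abs_mult power2_eq_square)
    also have "\<dots> \<le> \<bar>B\<bar> * (1 * cmod w)" using w by (intro mult_mono) auto
    finally show "cmod (?m w - cis \<omega>) \<le> \<bar>B\<bar> * cmod w" by simp
    have "cmod (?m w - ?m w') \<le> \<bar>B * ((cmod w)\<^sup>2 - (cmod w')\<^sup>2)\<bar>"
      using cmod_cis_diff_le[of "\<omega> + B * (cmod w)\<^sup>2" "\<omega> + B * (cmod w')\<^sup>2"] by (simp add: algebra_simps)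
    also have "\<dots> = \<bar>B\<bar> * ((cmod w + cmod w') * \<bar>cmod w - cmod w'\<bar>)"
    proof -
      have "B * ((cmod w)\<^sup>2 - (cmod w')\<^sup>2) = B * ((cmod w + cmod w') * (cmod w - cmod w'))"
        by (simp add: power2_eq_square algebra_simps)
      then show ?thesis by (simp only: abs_mult) simp
    qed
    also have "\<dots> \<le> \<bar>B\<bar> * ((cmod w + cmod w') * cmod (w - w'))"
      by (intro mult_left_mono norm_triangle_ineq3) auto
    finally show "cmod (?m w - ?m w') \<le> \<bar>B\<bar> * ((cmod w + cmod w') * cmod (w - w'))" .
  qed (use w in auto)
  also have "\<dots> \<le> 2 * \<bar>B\<bar> * (cmod w + cmod w') * cmod (w - w')"
    by (simp add: algebra_simps)
  finally show "cmod (twist_map \<omega> B w - cis \<omega> * w - (twist_map \<omega> B w' - cis \<omega> * w'))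
      \<le> 2 * \<bar>B\<bar> * (cmod w + cmod w') * cmod (w - w')" .
qed simp

text \<open>The twist preserves moduli, hence the unit disc, and is Lipschitz on it.\<close>

lemma quadratic_lipschitz_compose_twist_map:
  assumes "quadratic_lipschitz S"
  shows "quadratic_lipschitz (\<lambda>w. S (twist_map \<omega> B w))"
proof -
  from assms obtain K where K: "K \<ge> 0" and
    b: "\<And>w w'. cmod w \<le> 1 \<Longrightarrow> cmod w' \<le> 1 \<Longrightarrow> norm (S w - S w') \<le> K * (cmod w + cmod w') * cmod (w - w')"
    unfolding quadratic_lipschitz_def by blast
  from quadratic_lipschitz_twist_map[of \<omega> B] obtain M where M: "M \<ge> 0" and
    m: "\<And>w w'. cmod w \<le> 1 \<Longrightarrow> cmod w' \<le> 1 \<Longrightarrow>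
      cmod (twist_map \<omega> B w - cis \<omega> * w - (twist_map \<omega> B w' - cis \<omega> * w')) \<le> M * (cmod w + cmod w') * cmod (w - w')"
    unfolding quadratic_lipschitz_def by blast
  show ?thesis
  proof (rule quadratic_lipschitzI[of "K * (1 + 2 * M)"])
    fix w w' :: complex assume w: "cmod w \<le> 1" "cmod w' \<le> 1"
    have "twist_map \<omega> B w - twist_map \<omega> B w' =
        cis \<omega> * (w - w') + (twist_map \<omega> B w - cis \<omega> * w - (twist_map \<omega> B w' - cis \<omega> * w'))"
      by (simp add: algebra_simps)
    then have "cmod (twist_map \<omega> B w - twist_map \<omega> B w') \<le>
        cmod (cis \<omega> * (w - w')) + cmod (twist_map \<omega> B w - cis \<omega> * w - (twist_map \<omega> B w' - cis \<omega> * w'))"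
      by (metis norm_triangle_ineq)
    also have "\<dots> \<le> cmod (w - w') + M * 2 * cmod (w - w')"
    proof -
      have "M * (cmod w + cmod w') * cmod (w - w') \<le> M * 2 * cmod (w - w')"
        using w M by (intro mult_right_mono mult_left_mono) auto
      then show ?thesis using m[OF w] by (simp add: norm_mult)
    qed
    finally have l: "cmod (twist_map \<omega> B w - twist_map \<omega> B w') \<le> (1 + 2 * M) * cmod (w - w')"
      by (simp add: algebra_simps)
    have "norm (S (twist_map \<omega> B w) - S (twist_map \<omega> B w')) \<le>
        K * (cmod w + cmod w') * cmod (twist_map \<omega> B w - twist_map \<omega> B w')"
      using b[of "twist_map \<omega> B w" "twist_map \<omega> B w'"] w by simp
    also have "\<dots> \<le> K * (cmod w + cmod w') * ((1 + 2 * M) * cmod (w - w'))"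
      using l K by (intro mult_left_mono) auto
    finally show "norm (S (twist_map \<omega> B w) - S (twist_map \<omega> B w')) \<le>
        K * (1 + 2 * M) * (cmod w + cmod w') * cmod (w - w')" by (simp add: mult_ac)
  qed (use K M in simp)
qed

text \<open>The fixed point of the contraction \<open>w \<mapsto> z - S w\<close> serves as
  \<open>W z\<close>. The Lipschitz bound 1/2 is also exported because it takes the place of
  injectivity: it turns closeness of \<open>w + S w\<close> and \<open>w' + S w'\<close> into
  closeness of \<open>w\<close> and \<open>w'\<close>.\<close>

lemma near_identity_right_inverse:
  fixes S :: "complex \<Rightarrow> complex"
  assumes S: "quadratic_lipschitz S" and S0: "S 0 = 0"
  shows "\<exists>W K \<rho>. \<rho> > 0 \<and> K \<ge> 0 \<and>
    (\<forall>z. cmod z \<le> \<rho> / 2 \<longrightarrow> cmod (W z) \<le> \<rho> \<and> W z + S (W z) = z \<and>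
         cmod (W z) \<le> 2 * cmod z \<and> cmod (W z - z) \<le> K * (cmod z)\<^sup>2) \<and>
    (\<forall>w w'. cmod w \<le> \<rho> \<longrightarrow> cmod w' \<le> \<rho> \<longrightarrow> cmod (S w - S w') \<le> 1/2 * cmod (w - w'))"
proof -
  from S obtain K where K: "K \<ge> 0" and
    b: "\<And>w w'. cmod w \<le> 1 \<Longrightarrow> cmod w' \<le> 1 \<Longrightarrow> cmod (S w - S w') \<le> K * (cmod w + cmod w') * cmod (w - w')"
    unfolding quadratic_lipschitz_def by blast
  \<comment> \<open>Chosen such that 2 K \<rho>, the Lipschitz constant on the disc of radius
    \<rho>, is at most 1/2.\<close>
  define \<rho> where "\<rho> = 1 / (4 * K + 1)"
  have \<rho>: "\<rho> > 0" "\<rho> \<le> 1" using K by (auto simp: \<rho>_def)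
  have K\<rho>: "K * (2 * \<rho>) \<le> 1/2" using K by (simp add: \<rho>_def field_simps)
  have half: "cmod (S w - S w') \<le> 1/2 * cmod (w - w')" if "cmod w \<le> \<rho>" "cmod w' \<le> \<rho>" for w w'
  proof -
    have "cmod (S w - S w') \<le> K * (cmod w + cmod w') * cmod (w - w')" using b that \<rho> by simp
    also have "\<dots> \<le> K * (2 * \<rho>) * cmod (w - w')" using that K by (intro mult_right_mono mult_left_mono) auto
    also have "\<dots> \<le> 1/2 * cmod (w - w')" using K\<rho> by (intro mult_right_mono) auto
    finally show ?thesis .
  qed
  have half0: "cmod (S w) \<le> 1/2 * cmod w" if "cmod w \<le> \<rho>" for w
    using half[OF that, of 0] S0 \<rho> by simp
  have ex: "\<exists>w. cmod w \<le> \<rho> \<and> w + S w = z" if z: "cmod z \<le> \<rho> / 2" for z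
  proof -
    have "\<exists>!w\<in>cball 0 \<rho>. z - S w = w"
    proof (rule Banach_fix[of _ "1/2"])
      show "(\<lambda>w. z - S w) ` cball 0 \<rho> \<subseteq> cball 0 \<rho>"
      proof safe
        fix w :: complex assume "w \<in> cball 0 \<rho>"
        then have "cmod w \<le> \<rho>" by simp
        then show "z - S w \<in> cball 0 \<rho>"
          using norm_triangle_ineq4[of z "S w"] half0[of w] z by simp
      qed
      fix w w' :: complex assume "w \<in> cball 0 \<rho>" "w' \<in> cball 0 \<rho>"
      then show "dist (z - S w) (z - S w') \<le> 1/2 * dist w w'"
        using half[of w' w] by (simp add: dist_norm norm_minus_commute)
    qed (use \<rho> in \<open>auto simp: complete_eq_closed\<close>)
    then obtain w where w: "w \<in> cball 0 \<rho>" "z - S w = w" by blast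
    from w(2) have "w + S w = z" by (metis diff_add_cancel)
    with w(1) show ?thesis by auto
  qed
  define W where "W z = (SOME w. cmod w \<le> \<rho> \<and> w + S w = z)" for z
  have W: "cmod (W z) \<le> \<rho>" "W z + S (W z) = z" if "cmod z \<le> \<rho> / 2" for z
    using someI_ex[OF ex[OF that]] by (auto simp: W_def)
  have W2: "cmod (W z) \<le> 2 * cmod z" if "cmod z \<le> \<rho> / 2" for z
  proof -
    have "W z = z - S (W z)" using W(2)[OF that] by (simp add: eq_diff_eq)
    then have "cmod (W z) \<le> cmod z + cmod (S (W z))" by (metis norm_triangle_ineq4)
    then show ?thesis using half0[OF W(1)[OF that]] by linarith
  qed
  have W3: "cmod (W z - z) \<le> 4 * K * (cmod z)\<^sup>2" if "cmod z \<le> \<rho> / 2" for z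
  proof -
    have "z - W z = S (W z)" using W(2)[OF that] by (simp add: diff_eq_eq add.commute)
    then have "cmod (W z - z) = cmod (S (W z) - S 0)" unfolding S0 by (metis norm_minus_commute diff_zero)
    also have "\<dots> \<le> K * (cmod (W z) * cmod (W z))"
      using b[of "W z" 0] W(1)[OF that] \<rho> by (simp add: mult.assoc)
    also have "\<dots> \<le> K * ((2 * cmod z) * (2 * cmod z))"
      using W2[OF that] K by (intro mult_left_mono mult_mono) auto
    finally show ?thesis by (simp add: power2_eq_square)
  qed
  show ?thesis
  proof (rule exI[of _ W], rule exI[of _ "4 * K"], rule exI[of _ \<rho>], intro conjI allI impI)
  qed (use \<rho> K in simp, use K in simp, (fact W W2 W3 half)+)
qed

section \<open>Elementary bounds for the cosine\<close>

lemma abs_cos_diff_le: "\<bar>cos x - cos y\<bar> \<le> \<bar>x - y :: real\<bar>"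
proof -
  have "\<bar>Re (cis x - cis y)\<bar> \<le> cmod (cis x - cis y)" by (rule abs_Re_le_cmod)
  then show ?thesis using cmod_cis_diff_le[of x y] by simp
qed

lemma abs_cos_add_linear_le: "\<bar>cos (x + d) - cos x + sin x * d\<bar> \<le> (d::real)\<^sup>2"
proof -
  have "\<bar>sin d - (\<Sum>m<2. sin_coeff m * d ^ m)\<bar> \<le> inverse (fact 2) * \<bar>d\<bar> ^ 2"
    by (rule Maclaurin_sin_bound)
  then have s: "\<bar>sin d - d\<bar> \<le> d\<^sup>2 / 2"
    by (simp add: numeral_2_eq_2 sin_coeff_def)
  have "1 - cos d = 2 * (sin (d / 2))\<^sup>2" using cos_double_sin[of "d / 2"] by simp
  moreover have "(sin (d / 2))\<^sup>2 \<le> (d / 2)\<^sup>2"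
    using abs_sin_x_le_abs_x[of "d / 2"] unfolding abs_le_square_iff[symmetric] by simp
  ultimately have c: "0 \<le> 1 - cos d" "1 - cos d \<le> d\<^sup>2 / 2" by (auto simp: power_divide)
  have "\<bar>cos (x + d) - cos x + sin x * d\<bar> = \<bar>- cos x * (1 - cos d) - sin x * (sin d - d)\<bar>"
    by (simp add: cos_add algebra_simps)
  also have "\<dots> \<le> \<bar>cos x\<bar> * (1 - cos d) + \<bar>sin x\<bar> * \<bar>sin d - d\<bar>"
    using c(1) by (intro order.trans[OF abs_triangle_ineq4]) (simp add: abs_mult)
  also have "\<dots> \<le> 1 * (d\<^sup>2 / 2) + 1 * (d\<^sup>2 / 2)"
    using s c by (intro add_mono mult_mono) auto
  finally show ?thesis by simp
qed

text \<open>The second-order recurrence \<open>X(n+1) + X(n-1) = f (X n)\<close> near its equilibrium, in the complex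
  coordinate that diagonalizes the linear part. The coefficients below solve the recurrence by
  \<open>X n = U (\<mu>\<^sup>n w)\<close> with \<open>\<mu> = cis (\<omega> + B |w|\<^sup>2)\<close> up to third order (Lindstedt's method).\<close>

locale elliptic_expansion =
  fixes \<omega> a b :: real and f :: "real \<Rightarrow> real"
  assumes sin_nz: "sin \<omega> \<noteq> 0" and cos2_neq: "cos (2 * \<omega>) \<noteq> cos \<omega>" and cos3_neq: "cos (3 * \<omega>) \<noteq> cos \<omega>"
    and expansion: "(\<lambda>u. f u - (2 * cos \<omega> * u + a * u\<^sup>2 + b * u ^ 3)) \<in> o[nhds 0](\<lambda>u. u ^ 3)"
begin

text \<open>From matching harmonics: \<alpha> belongs to the second harmonic and \<beta> to the mean
  value at order 2, \<gamma> to the third harmonic at order 3. The first harmonic at order 3 is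
  resonant and cannot be matched by a further term of \<open>U\<close>; the frequency shift
  \<open>twist_coeff\<close> absorbs it.\<close>

definition \<alpha> where "\<alpha> = a / (2 * (cos (2 * \<omega>) - cos \<omega>))"
definition \<beta> where "\<beta> = a / (1 - cos \<omega>)"
definition \<gamma> where "\<gamma> = (2 * a * \<alpha> + b) / (2 * (cos (3 * \<omega>) - cos \<omega>))"
definition twist_coeff where "twist_coeff = - (2 * a * (\<alpha> + \<beta>) + 3 * b) / (2 * sin \<omega>)"

definition U :: "complex \<Rightarrow> real" where
  "U w = 2 * Re w + (2 * \<alpha> * Re (w\<^sup>2) + \<beta> * (cmod w)\<^sup>2 + 2 * \<gamma> * Re (w ^ 3))"

text \<open>The \<open>z\<close> with x = 2 Re z and y = 2 Re (cis \<omega> z). In this coordinate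
  the linear part \<open>(x, y) \<mapsto> (y, 2 cos \<omega> y - x)\<close> is multiplication by
  \<open>cis \<omega>\<close>.\<close>

definition coord :: "real \<Rightarrow> real \<Rightarrow> complex" where
  "coord x y = (of_real y - cis (-\<omega>) * of_real x) / (2 * \<i> * of_real (sin \<omega>))"

text \<open>The map \<open>(x, y) \<mapsto> (y, f y - x)\<close> in the coordinate
  \<open>coord\<close>, with the rotation split off from the nonlinear part of
  \<open>f\<close>.\<close>

definition \<Phi> :: "complex \<Rightarrow> complex" where
  "\<Phi> z = cis \<omega> * z + of_real (f (2 * Re (cis \<omega> * z)) - 4 * cos \<omega> * Re (cis \<omega> * z)) / (2 * \<i> * of_real (sin \<omega>))"

abbreviation N :: "complex \<Rightarrow> complex" where "N \<equiv> twist_map \<omega> twist_coeff"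

lemma cos_neq_1: "cos \<omega> \<noteq> 1"
  using sin_nz cos_one_sin_zero by blast

lemma coeff_eqs:
  "2 * \<alpha> * (cos \<omega> - cos (2 * \<omega>)) + a = 0" "cos \<omega> * \<beta> + a = \<beta>"
  "2 * \<gamma> * (cos \<omega> - cos (3 * \<omega>)) + 2 * a * \<alpha> + b = 0"
  "2 * a * \<alpha> + 2 * a * \<beta> + 3 * b + 2 * sin \<omega> * twist_coeff = 0"
proof -
  have "\<alpha> * (2 * (cos (2 * \<omega>) - cos \<omega>)) = a" "\<beta> * (1 - cos \<omega>) = a"
    "\<gamma> * (2 * (cos (3 * \<omega>) - cos \<omega>)) = 2 * a * \<alpha> + b"
    "twist_coeff * (2 * sin \<omega>) = - (2 * a * (\<alpha> + \<beta>) + 3 * b)"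
    using sin_nz cos2_neq cos3_neq cos_neq_1
    by (simp_all add: \<alpha>_def \<beta>_def \<gamma>_def twist_coeff_def)
  then show "2 * \<alpha> * (cos \<omega> - cos (2 * \<omega>)) + a = 0" "cos \<omega> * \<beta> + a = \<beta>"
    "2 * \<gamma> * (cos \<omega> - cos (3 * \<omega>)) + 2 * a * \<alpha> + b = 0"
    "2 * a * \<alpha> + 2 * a * \<beta> + 3 * b + 2 * sin \<omega> * twist_coeff = 0"
    by (simp_all add: algebra_simps)
qed

lemma U_polar: "U (of_real r * cis x) =
   2 * r * cos x + (2 * \<alpha> * r\<^sup>2 * cos (2 * x) + \<beta> * r\<^sup>2 + 2 * \<gamma> * r ^ 3 * cos (3 * x))"
  using arg_cong[OF Complex.DeMoivre[of x 2], of Re] arg_cong[OF Complex.DeMoivre[of x 3], of Re]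
  by (simp add: U_def power_mult_distrib norm_mult flip: of_real_power)

text \<open>With \<open>x\<close> the cosine of the angle, the harmonics become the Chebyshev
  polynomials \<open>x\<close>, \<open>2 x\<^sup>2 - 1\<close>, \<open>4 x ^ 3 - 3 x\<close>, and
  the expansion is an algebraic identity. The factor
  \<open>cos \<omega> - sin \<omega> * twist_coeff * r\<^sup>2\<close> linearizes the cosine of the
  shifted frequency; what exceeds order 3 is collected behind \<open>r ^ 4\<close>.\<close>

lemma lindstedt_polynomial:
  fixes r x :: real
  defines "P2 \<equiv> 2 * \<alpha> * (2 * x\<^sup>2 - 1) + \<beta>" and "P3 \<equiv> 2 * \<gamma> * (4 * x ^ 3 - 3 * x)"
  defines "v \<equiv> 2 * x + r * P2 + r\<^sup>2 * P3"
  shows "2 * cos \<omega> * (r * v) + a * (r * v)\<^sup>2 + b * (r * v) ^ 3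
    = 4 * r * (cos \<omega> - sin \<omega> * twist_coeff * r\<^sup>2) * x + 4 * \<alpha> * r\<^sup>2 * cos (2 * \<omega>) * (2 * x\<^sup>2 - 1)
      + 2 * \<beta> * r\<^sup>2 + 4 * \<gamma> * r ^ 3 * cos (3 * \<omega>) * (4 * x ^ 3 - 3 * x)
      + r ^ 4 * (a * (P2\<^sup>2 + 4 * x * P3 + 2 * r * P2 * P3 + r\<^sup>2 * P3\<^sup>2)
          + b * (P2 + r * P3) * (v\<^sup>2 + 2 * x * v + 4 * x\<^sup>2))"
proof -
  define c c2 c3 sB where cs: "c = cos \<omega>" "c2 = cos (2 * \<omega>)" "c3 = cos (3 * \<omega>)" "sB = sin \<omega> * twist_coeff"
  define R1 where "R1 = r ^ 4 * (a * (P2\<^sup>2 + 4 * x * P3 + 2 * r * P2 * P3 + r\<^sup>2 * P3\<^sup>2))"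
  define R2 where "R2 = r ^ 4 * (b * (P2 + r * P3) * (v\<^sup>2 + 2 * x * v + 4 * x\<^sup>2))"
  have sq: "a * (r * v)\<^sup>2 = 4 * a * r\<^sup>2 * x\<^sup>2 + 4 * a * r ^ 3 * x * P2 + R1"
    unfolding v_def R1_def by (simp add: power2_eq_square power3_eq_cube power4_eq_xxxx algebra_simps)
  have "v ^ 3 = 8 * x ^ 3 + (v - 2 * x) * (v\<^sup>2 + 2 * x * v + 4 * x\<^sup>2)"
    by (simp add: power2_eq_square power3_eq_cube algebra_simps)
  also have "v - 2 * x = r * (P2 + r * P3)" by (simp add: v_def power2_eq_square algebra_simps)
  finally have cu: "b * (r * v) ^ 3 = 8 * b * r ^ 3 * x ^ 3 + R2"
    by (simp add: R2_def power_mult_distrib power3_eq_cube power4_eq_xxxx algebra_simps)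
  have e: "2 * \<alpha> * (c - c2) + a = 0" "c * \<beta> + a - \<beta> = 0" "2 * \<gamma> * (c - c3) + 2 * a * \<alpha> + b = 0"
    "2 * a * \<alpha> + 2 * a * \<beta> + 3 * b + 2 * sB = 0"
    using coeff_eqs unfolding cs by simp_all
  \<comment> \<open>Sorted by harmonics, the coefficients of \<open>r\<^sup>2\<close> and
    \<open>r ^ 3\<close> are combinations of the four vanishing expressions in
    \<open>e\<close>.\<close>
  have "2 * c * (r * v) + (4 * a * r\<^sup>2 * x\<^sup>2 + 4 * a * r ^ 3 * x * P2) + 8 * b * r ^ 3 * x ^ 3
    - (4 * r * (c - sB * r\<^sup>2) * x + 4 * \<alpha> * r\<^sup>2 * c2 * (2 * x\<^sup>2 - 1) + 2 * \<beta> * r\<^sup>2 + 4 * \<gamma> * r ^ 3 * c3 * (4 * x ^ 3 - 3 * x))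
    = r\<^sup>2 * (2 * (2 * x\<^sup>2 - 1) * (2 * \<alpha> * (c - c2) + a) + 2 * (c * \<beta> + a - \<beta>))
      + r ^ 3 * (2 * (4 * x ^ 3 - 3 * x) * (2 * \<gamma> * (c - c3) + 2 * a * \<alpha> + b)
          + 2 * x * (2 * a * \<alpha> + 2 * a * \<beta> + 3 * b + 2 * sB))"
    unfolding v_def P2_def P3_def by (simp add: power2_eq_square power3_eq_cube algebra_simps)
  also have "\<dots> = 0" unfolding e by simp
  finally show ?thesis
    unfolding sq cu distrib_left[of "r ^ 4"] R1_def[symmetric] R2_def[symmetric] cs[symmetric]
      mult.assoc[of "sin \<omega>" twist_coeff] by (simp add: cs(4) mult.assoc)
qed

text \<open>There are two errors of order four: the explicit remainder, bounded by compactness, and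
  the replacement of the true cosines by their expansions at \<omega>. Harmonics two and three
  already carry \<open>r\<^sup>2\<close> and \<open>r ^ 3\<close>, so a bound of first order in the
  frequency shift is enough for them.\<close>

lemma lindstedt_polar_bound:
  "\<exists>M. \<forall>r\<in>{0..1}. \<forall>\<phi>. \<bar>2 * cos \<omega> * U (of_real r * cis \<phi>) + a * (U (of_real r * cis \<phi>))\<^sup>2 + b * U (of_real r * cis \<phi>) ^ 3
     - (U (of_real r * cis (\<phi> - (\<omega> + twist_coeff * r\<^sup>2))) + U (of_real r * cis (\<phi> + (\<omega> + twist_coeff * r\<^sup>2))))\<bar> \<le> M * r ^ 4"
proof -
  define P2 where "P2 x = 2 * \<alpha> * (2 * x\<^sup>2 - 1) + \<beta>" for x :: real
  define P3 where "P3 x = 2 * \<gamma> * (4 * x ^ 3 - 3 * x)" for x :: real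
  define v where "v r x = 2 * x + r * P2 x + r\<^sup>2 * P3 x" for r x :: real
  define Q where "Q r x = a * ((P2 x)\<^sup>2 + 4 * x * P3 x + 2 * r * P2 x * P3 x + r\<^sup>2 * (P3 x)\<^sup>2)
          + b * (P2 x + r * P3 x) * ((v r x)\<^sup>2 + 2 * x * v r x + 4 * x\<^sup>2)" for r x
  have "continuous_on (cbox (0, -1) (1, 1)) (\<lambda>p::real\<times>real. Q (fst p) (snd p))"
    unfolding Q_def v_def P2_def P3_def by (intro continuous_intros)
  then have "bounded ((\<lambda>p::real\<times>real. Q (fst p) (snd p)) ` cbox (0, -1) (1, 1))"
    by (intro compact_imp_bounded compact_continuous_image compact_cbox)
  then obtain MQ where MQ0: "\<forall>y\<in>(\<lambda>p::real\<times>real. Q (fst p) (snd p)) ` cbox (0, -1) (1, 1). norm y \<le> MQ"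
    unfolding bounded_iff by blast
  have MQ: "\<bar>Q r x\<bar> \<le> MQ" if "r \<in> {0..1}" "\<bar>x\<bar> \<le> 1" for r x
  proof -
    have "(r, x) \<in> cbox (0, -1) (1, 1)" using that by (auto simp: cbox_Pair_eq abs_le_iff)
    then show ?thesis using MQ0 by force
  qed
  let ?B = twist_coeff
  define M where "M = MQ + (4 * ?B\<^sup>2 + 8 * \<bar>\<alpha>\<bar> * \<bar>?B\<bar> + 12 * \<bar>\<gamma>\<bar> * \<bar>?B\<bar>)"
  show ?thesis
  proof (rule exI[of _ M], intro ballI allI)
    fix r \<phi> :: real assume r: "r \<in> {0..1}"
    define x where "x = cos \<phi>"
    define \<Omega> where "\<Omega> = \<omega> + ?B * r\<^sup>2"
    have x: "\<bar>x\<bar> \<le> 1" by (simp add: x_def)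
    have c2: "cos (2 * \<phi>) = 2 * x\<^sup>2 - 1" and c3: "cos (3 * \<phi>) = 4 * x ^ 3 - 3 * x"
      by (simp_all add: x_def cos_double_cos cos_treble_cos)
    have u: "U (of_real r * cis \<phi>) = r * v r x"
      unfolding U_polar c2 c3 by (simp add: v_def P2_def P3_def x_def power2_eq_square power3_eq_cube algebra_simps)
    have add: "cos (t - s) + cos (t + s) = 2 * cos s * cos t" for s t :: real
      by (simp add: cos_diff cos_add)
    have sum: "U (of_real r * cis (\<phi> - \<Omega>)) + U (of_real r * cis (\<phi> + \<Omega>))
      = 4 * r * cos \<Omega> * x + 4 * \<alpha> * r\<^sup>2 * cos (2 * \<Omega>) * (2 * x\<^sup>2 - 1) + 2 * \<beta> * r\<^sup>2
        + 4 * \<gamma> * r ^ 3 * cos (3 * \<Omega>) * (4 * x ^ 3 - 3 * x)"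
    proof -
      have "U (of_real r * cis (\<phi> - \<Omega>)) + U (of_real r * cis (\<phi> + \<Omega>))
         = 2 * r * (cos (\<phi> - \<Omega>) + cos (\<phi> + \<Omega>)) + 2 * \<alpha> * r\<^sup>2 * (cos (2 * \<phi> - 2 * \<Omega>) + cos (2 * \<phi> + 2 * \<Omega>))
           + 2 * \<beta> * r\<^sup>2 + 2 * \<gamma> * r ^ 3 * (cos (3 * \<phi> - 3 * \<Omega>) + cos (3 * \<phi> + 3 * \<Omega>))"
        unfolding U_polar right_diff_distrib distrib_left by (simp add: algebra_simps)
      then show ?thesis unfolding add c2 c3 x_def[symmetric] by (simp add: algebra_simps)
    qed
    have x2: "\<bar>2 * x\<^sup>2 - 1\<bar> \<le> 1" unfolding c2[symmetric] by simp
    have x3: "\<bar>4 * x ^ 3 - 3 * x\<bar> \<le> 1" unfolding c3[symmetric] by simp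
    define d1 where "d1 = cos \<Omega> - cos \<omega> + sin \<omega> * (?B * r\<^sup>2)"
    define d2 where "d2 = cos (2 * \<Omega>) - cos (2 * \<omega>)"
    define d3 where "d3 = cos (3 * \<Omega>) - cos (3 * \<omega>)"
    have d1: "\<bar>d1\<bar> \<le> ?B\<^sup>2 * r ^ 4"
      using abs_cos_add_linear_le[of \<omega> "?B * r\<^sup>2"] by (simp add: d1_def \<Omega>_def power_mult_distrib flip: power_mult)
    have d2: "\<bar>d2\<bar> \<le> 2 * \<bar>?B\<bar> * r\<^sup>2"
      using abs_cos_diff_le[of "2 * \<Omega>" "2 * \<omega>"] by (simp add: d2_def \<Omega>_def abs_mult)
    have d3: "\<bar>d3\<bar> \<le> 3 * \<bar>?B\<bar> * r\<^sup>2"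
      using abs_cos_diff_le[of "3 * \<Omega>" "3 * \<omega>"] by (simp add: d3_def \<Omega>_def abs_mult)
    have poly: "2 * cos \<omega> * (r * v r x) + a * (r * v r x)\<^sup>2 + b * (r * v r x) ^ 3
      = 4 * r * (cos \<omega> - sin \<omega> * ?B * r\<^sup>2) * x + 4 * \<alpha> * r\<^sup>2 * cos (2 * \<omega>) * (2 * x\<^sup>2 - 1)
      + 2 * \<beta> * r\<^sup>2 + 4 * \<gamma> * r ^ 3 * cos (3 * \<omega>) * (4 * x ^ 3 - 3 * x) + r ^ 4 * Q r x"
      unfolding Q_def v_def P2_def P3_def by (rule lindstedt_polynomial)
    have diff: "2 * cos \<omega> * U (of_real r * cis \<phi>) + a * (U (of_real r * cis \<phi>))\<^sup>2 + b * U (of_real r * cis \<phi>) ^ 3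
       - (U (of_real r * cis (\<phi> - \<Omega>)) + U (of_real r * cis (\<phi> + \<Omega>)))
      = r ^ 4 * Q r x - (4 * r * d1 * x + 4 * \<alpha> * r\<^sup>2 * d2 * (2 * x\<^sup>2 - 1) + 4 * \<gamma> * r ^ 3 * d3 * (4 * x ^ 3 - 3 * x))"
    proof -
      have "4 * r * (c - s * B * r2) * x + 4 * k * r2 * C2 * y + e + 4 * g * r3 * C3 * z + q
          - (4 * r * c' * x + 4 * k * r2 * C2' * y + e + 4 * g * r3 * C3' * z)
        = q - (4 * r * (c' - c + s * (B * r2)) * x + 4 * k * r2 * (C2' - C2) * y + 4 * g * r3 * (C3' - C3) * z)"
        for c s B r2 k C2 y e g r3 C3 z q c' C2' C3' :: real by (simp add: algebra_simps)
      then show ?thesis unfolding u sum poly d1_def d2_def d3_def .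
    qed
    have "\<bar>2 * cos \<omega> * U (of_real r * cis \<phi>) + a * (U (of_real r * cis \<phi>))\<^sup>2 + b * U (of_real r * cis \<phi>) ^ 3
       - (U (of_real r * cis (\<phi> - \<Omega>)) + U (of_real r * cis (\<phi> + \<Omega>)))\<bar> \<le> \<bar>r ^ 4 * Q r x\<bar> + (\<bar>4 * r * d1 * x\<bar> + \<bar>4 * \<alpha> * r\<^sup>2 * d2 * (2 * x\<^sup>2 - 1)\<bar> + \<bar>4 * \<gamma> * r ^ 3 * d3 * (4 * x ^ 3 - 3 * x)\<bar>)"
    proof -
      have "\<bar>A - (B + C + D)\<bar> \<le> \<bar>A\<bar> + (\<bar>B\<bar> + \<bar>C\<bar> + \<bar>D\<bar>)" for A B C D :: real by linarith
      then show ?thesis unfolding diff .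
    qed
    also have "\<dots> \<le> r ^ 4 * MQ + (4 * 1 * (?B\<^sup>2 * r ^ 4) * 1 + 4 * \<bar>\<alpha>\<bar> * r\<^sup>2 * (2 * \<bar>?B\<bar> * r\<^sup>2) * 1 + 4 * \<bar>\<gamma>\<bar> * r\<^sup>2 * (3 * \<bar>?B\<bar> * r\<^sup>2) * 1)"
    proof (intro add_mono)
      show "\<bar>r ^ 4 * Q r x\<bar> \<le> r ^ 4 * MQ" using MQ[OF r x] by (simp add: abs_mult mult_left_mono)
      show "\<bar>4 * r * d1 * x\<bar> \<le> 4 * 1 * (?B\<^sup>2 * r ^ 4) * 1"
        unfolding abs_mult using d1 x r by (intro mult_mono) auto
      show "\<bar>4 * \<alpha> * r\<^sup>2 * d2 * (2 * x\<^sup>2 - 1)\<bar> \<le> 4 * \<bar>\<alpha>\<bar> * r\<^sup>2 * (2 * \<bar>?B\<bar> * r\<^sup>2) * 1"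
        unfolding abs_mult using d2 x2 r by (intro mult_mono) auto
      have "r ^ 3 \<le> r\<^sup>2" using r by (intro power_decreasing) auto
      then show "\<bar>4 * \<gamma> * r ^ 3 * d3 * (4 * x ^ 3 - 3 * x)\<bar> \<le> 4 * \<bar>\<gamma>\<bar> * r\<^sup>2 * (3 * \<bar>?B\<bar> * r\<^sup>2) * 1"
        unfolding abs_mult using d3 x3 r by (intro mult_mono) auto
    qed
    also have "\<dots> = M * r ^ 4" by (simp add: M_def power2_eq_square power4_eq_xxxx algebra_simps)
    finally show "\<bar>2 * cos \<omega> * U (of_real r * cis \<phi>) + a * (U (of_real r * cis \<phi>))\<^sup>2 + b * U (of_real r * cis \<phi>) ^ 3
     - (U (of_real r * cis (\<phi> - (\<omega> + ?B * r\<^sup>2))) + U (of_real r * cis (\<phi> + (\<omega> + ?B * r\<^sup>2))))\<bar> \<le> M * r ^ 4"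
      by (simp add: \<Omega>_def)
  qed
qed

end

section \<open>Conjugacy with the twist up to third order\<close>

context elliptic_expansion
begin

lemma expansion_bound:
  assumes "e > 0"
  shows "\<exists>d>0. \<forall>u. \<bar>u\<bar> < d \<longrightarrow> \<bar>f u - (2 * cos \<omega> * u + a * u\<^sup>2 + b * u ^ 3)\<bar> \<le> e * \<bar>u\<bar> ^ 3"
  using landau_o.smallD[OF expansion assms]
  unfolding eventually_nhds_metric by (simp add: power_abs)

lemma abs_U_le:
  assumes "cmod w \<le> 1"
  shows "\<bar>U w\<bar> \<le> (2 + 2 * \<bar>\<alpha>\<bar> + \<bar>\<beta>\<bar> + 2 * \<bar>\<gamma>\<bar>) * cmod w"
proof -
  have p: "cmod w ^ 2 \<le> cmod w" "cmod w ^ 3 \<le> cmod w"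
    using power_decreasing[of 1 2 "cmod w"] power_decreasing[of 1 3 "cmod w"] assms by auto
  have "\<bar>2 * Re w\<bar> \<le> 2 * cmod w" using abs_Re_le_cmod[of w] by simp
  moreover have "\<bar>2 * \<alpha> * Re (w\<^sup>2)\<bar> \<le> 2 * \<bar>\<alpha>\<bar> * cmod w"
    unfolding abs_mult using abs_Re_le_cmod[of "w\<^sup>2"] p by (intro mult_mono) (auto simp: norm_power)
  moreover have "\<bar>\<beta> * (cmod w)\<^sup>2\<bar> \<le> \<bar>\<beta>\<bar> * cmod w"
    unfolding abs_mult using p by (intro mult_mono) auto
  moreover have "\<bar>2 * \<gamma> * Re (w ^ 3)\<bar> \<le> 2 * \<bar>\<gamma>\<bar> * cmod w"
    unfolding abs_mult using abs_Re_le_cmod[of "w ^ 3"] p by (intro mult_mono) (auto simp: norm_power)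
  ultimately have "\<bar>U w\<bar> \<le> 2 * cmod w + (2 * \<bar>\<alpha>\<bar> * cmod w + \<bar>\<beta>\<bar> * cmod w + 2 * \<bar>\<gamma>\<bar> * cmod w)"
    unfolding U_def by linarith
  then show ?thesis by (simp add: algebra_simps)
qed

text \<open>\<open>U w\<close>, \<open>U (N w)\<close> and \<open>U (N (N w))\<close> play three
  consecutive terms of the recurrence. \<open>N\<close> preserves the modulus, so both steps rotate
  by the same angle and the polar bound applies.\<close>

lemma recurrence_error:
  assumes "e > 0"
  shows "\<exists>d>0. \<forall>w. cmod w < d \<longrightarrow> \<bar>f (U (N w)) - U w - U (N (N w))\<bar> \<le> e * cmod w ^ 3"
proof -
  obtain M where M: "\<And>r \<phi>. r \<in> {0..1} \<Longrightarrow> \<bar>2 * cos \<omega> * U (of_real r * cis \<phi>) + a * (U (of_real r * cis \<phi>))\<^sup>2 + b * U (of_real r * cis \<phi>) ^ 3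
     - (U (of_real r * cis (\<phi> - (\<omega> + twist_coeff * r\<^sup>2))) + U (of_real r * cis (\<phi> + (\<omega> + twist_coeff * r\<^sup>2))))\<bar> \<le> M * r ^ 4"
    using lindstedt_polar_bound by blast
  define K where "K = 2 + 2 * \<bar>\<alpha>\<bar> + \<bar>\<beta>\<bar> + 2 * \<bar>\<gamma>\<bar>"
  have K: "K > 0" unfolding K_def by (smt (verit) abs_ge_zero)
  \<comment> \<open>Half of the error is granted to the expansion of \<open>f\<close>, with
    \<open>K ^ 3\<close> from the bound K |w| on \<open>U\<close>; the other half covers the
    fourth-order term.\<close>
  define e' where "e' = e / (2 * K ^ 3)"
  have e': "e' > 0" using assms K by (simp add: e'_def)
  then obtain d where d: "d > 0" "\<And>u. \<bar>u\<bar> < d \<Longrightarrow> \<bar>f u - (2 * cos \<omega> * u + a * u\<^sup>2 + b * u ^ 3)\<bar> \<le> e' * \<bar>u\<bar> ^ 3"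
    using expansion_bound by blast
  define \<rho> where "\<rho> = min 1 (min (d / K) (e / (2 * (\<bar>M\<bar> + 1))))"
  have \<rho>: "\<rho> > 0" using d K assms by (simp add: \<rho>_def)
  show ?thesis
  proof (intro exI[of _ \<rho>] conjI allI impI \<rho>)
    fix w assume w: "cmod w < \<rho>"
    define r where "r = cmod w"
    define \<Omega> where "\<Omega> = \<omega> + twist_coeff * r\<^sup>2"
    \<comment> \<open>The angle of the middle point, such that \<open>w\<close> and
      \<open>N (N w)\<close> lie symmetrically at \<phi> - \<Omega> and \<phi> + \<Omega>.\<close>
    define \<phi> where "\<phi> = Arg w + \<Omega>"
    have r: "0 \<le> r" "r \<le> 1" "K * r < d" "\<bar>M\<bar> * r \<le> e / 2"
    proof -
      show "0 \<le> r" "r \<le> 1" using w by (auto simp: \<rho>_def r_def)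
      show "K * r < d" using w K by (simp add: \<rho>_def r_def less_divide_eq mult.commute)
      have "r * (2 * (\<bar>M\<bar> + 1)) < e" using w by (simp add: \<rho>_def r_def less_divide_eq)
      then show "\<bar>M\<bar> * r \<le> e / 2" using \<open>0 \<le> r\<close> by (simp add: algebra_simps)
    qed
    have w0: "w = of_real r * cis (\<phi> - \<Omega>)" by (simp add: r_def \<phi>_def rcis_cmod_Arg flip: rcis_def)
    have rot: "N v = cis \<Omega> * v" if "cmod v = r" for v
      unfolding twist_map_def that \<Omega>_def ..
    have w1: "N w = of_real r * cis \<phi>"
      by (subst rot) (simp_all add: r_def[symmetric], subst w0, simp add: cis_mult mult.left_commute)
    have w2: "N (N w) = of_real r * cis (\<phi> + \<Omega>)"
      by (subst rot) (simp_all add: r_def[symmetric], subst w1, simp add: cis_mult mult.left_commute add.commute)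
    let ?u = "U (N w)"
    have u: "\<bar>?u\<bar> \<le> K * r" using abs_U_le[of "N w"] r by (simp add: K_def r_def)
    have 1: "\<bar>f ?u - (2 * cos \<omega> * ?u + a * ?u\<^sup>2 + b * ?u ^ 3)\<bar> \<le> e / 2 * r ^ 3"
    proof -
      have "\<bar>f ?u - (2 * cos \<omega> * ?u + a * ?u\<^sup>2 + b * ?u ^ 3)\<bar> \<le> e' * \<bar>?u\<bar> ^ 3" using d(2) u r by simp
      also have "\<dots> \<le> e' * (K * r) ^ 3" using u e' by (intro mult_left_mono power_mono) auto
      also have "\<dots> = e / 2 * r ^ 3" using K by (simp add: e'_def power_mult_distrib)
      finally show ?thesis .
    qed
    have "\<bar>2 * cos \<omega> * ?u + a * ?u\<^sup>2 + b * ?u ^ 3 - (U w + U (N (N w)))\<bar> \<le> M * r ^ 4"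
      using M[of r \<phi>] r unfolding \<Omega>_def[symmetric] w0[symmetric] w1[symmetric] w2[symmetric] by simp
    also have "\<dots> \<le> \<bar>M\<bar> * r ^ 4" by (intro mult_right_mono) auto
    also have "\<dots> = (\<bar>M\<bar> * r) * r ^ 3" by (simp add: power3_eq_cube power4_eq_xxxx)
    also have "\<dots> \<le> e / 2 * r ^ 3" using r by (intro mult_right_mono) auto
    finally have 2: "\<bar>2 * cos \<omega> * ?u + a * ?u\<^sup>2 + b * ?u ^ 3 - (U w + U (N (N w)))\<bar> \<le> e / 2 * r ^ 3" .
    show "\<bar>f ?u - U w - U (N (N w))\<bar> \<le> e * cmod w ^ 3"
      using 1 2 unfolding r_def[symmetric] by linarith
  qed
qed

lemma \<Phi>_diff: "\<Phi> z - cis \<omega> * z =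
    of_real (f (2 * Re (cis \<omega> * z)) - 2 * cos \<omega> * (2 * Re (cis \<omega> * z))) / (2 * \<i> * of_real (sin \<omega>))"
  by (simp add: \<Phi>_def)

lemma \<Phi>_linear: "(\<lambda>z. \<Phi> z - cis \<omega> * z) \<in> o[nhds 0](\<lambda>z. z)"
proof (rule landau_o.smallI)
  fix e :: real assume e: "e > 0"
  obtain d where d: "d > 0" "\<And>u. \<bar>u\<bar> < d \<Longrightarrow> \<bar>f u - (2 * cos \<omega> * u + a * u\<^sup>2 + b * u ^ 3)\<bar> \<le> 1 * \<bar>u\<bar> ^ 3"
    using expansion_bound[of 1] by auto
  define K where "K = \<bar>a\<bar> + \<bar>b\<bar> + 1"
  have K: "K > 0" by (simp add: K_def add_nonneg_pos)
  define \<rho> where "\<rho> = min (1/2) (min (d / 2) (e * \<bar>sin \<omega>\<bar> / (2 * K)))"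
  have \<rho>: "\<rho> > 0" using d K e sin_nz by (simp add: \<rho>_def)
  have "cmod (\<Phi> z - cis \<omega> * z) \<le> e * cmod z" if z: "cmod z < \<rho>" for z
  proof -
    define u where "u = 2 * Re (cis \<omega> * z)"
    have u: "\<bar>u\<bar> \<le> 2 * cmod z" using abs_Re_le_cmod[of "cis \<omega> * z"] unfolding u_def by (simp add: norm_mult)
    have u1: "\<bar>u\<bar> \<le> 1" "\<bar>u\<bar> < d" using u z by (auto simp: \<rho>_def)
    have "\<bar>f u - 2 * cos \<omega> * u\<bar> \<le> \<bar>a\<bar> * \<bar>u\<bar>\<^sup>2 + \<bar>b\<bar> * \<bar>u\<bar> ^ 3 + \<bar>u\<bar> ^ 3"
    proof -
      have "\<bar>a * u\<^sup>2\<bar> = \<bar>a\<bar> * \<bar>u\<bar>\<^sup>2" "\<bar>b * u ^ 3\<bar> = \<bar>b\<bar> * \<bar>u\<bar> ^ 3" by (simp_all add: abs_mult power_abs)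
      then show ?thesis using d(2)[OF u1(2)] by linarith
    qed
    also have "\<dots> \<le> \<bar>a\<bar> * \<bar>u\<bar>\<^sup>2 + \<bar>b\<bar> * \<bar>u\<bar>\<^sup>2 + \<bar>u\<bar>\<^sup>2"
      using u1 power_decreasing[of 2 3 "\<bar>u\<bar>"] by (intro add_mono mult_left_mono) auto
    also have "\<dots> = K * (\<bar>u\<bar> * \<bar>u\<bar>)" by (simp add: K_def power2_eq_square algebra_simps)
    also have "\<dots> \<le> K * ((2 * cmod z) * (2 * cmod z))" using u K by (intro mult_left_mono mult_mono) auto
    also have "\<dots> = 4 * K * cmod z * cmod z" by simp
    finally have "\<bar>f u - 2 * cos \<omega> * u\<bar> \<le> 4 * K * cmod z * cmod z" .
    moreover have "4 * K * cmod z \<le> 2 * (e * \<bar>sin \<omega>\<bar>)"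
      using z K by (simp add: \<rho>_def less_divide_eq field_simps)
    ultimately have "\<bar>f u - 2 * cos \<omega> * u\<bar> \<le> 2 * (e * \<bar>sin \<omega>\<bar>) * cmod z"
      by (meson mult_right_mono norm_ge_zero order_trans)
    moreover have "cmod (\<Phi> z - cis \<omega> * z) = \<bar>f u - 2 * cos \<omega> * u\<bar> / (2 * \<bar>sin \<omega>\<bar>)"
      unfolding \<Phi>_diff u_def[symmetric] norm_divide norm_mult norm_of_real by simp
    ultimately show ?thesis using sin_nz by (simp add: divide_le_eq mult_ac)
  qed
  then show "\<forall>\<^sub>F z in nhds 0. norm (\<Phi> z - cis \<omega> * z) \<le> e * norm z"
    unfolding eventually_nhds_metric using \<rho> by auto
qed

lemma two_i_sin: "cis \<omega> - cis (-\<omega>) = 2 * \<i> * of_real (sin \<omega>)"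
  by (simp add: complex_eq_iff)

lemma coord_Re: "coord (2 * Re w) (2 * Re (cis \<omega> * w)) = w"
proof -
  have re: "of_real (2 * Re v) = v + cnj v" for v by (simp add: complex_eq_iff)
  have "of_real (2 * Re (cis \<omega> * w)) - cis (-\<omega>) * of_real (2 * Re w)
      = cis \<omega> * w + cis (-\<omega>) * cnj w - cis (-\<omega>) * (w + cnj w)"
    unfolding re by (simp add: cis_cnj)
  also have "\<dots> = (cis \<omega> - cis (-\<omega>)) * w" by (simp add: algebra_simps)
  finally show ?thesis unfolding coord_def two_i_sin using sin_nz by simp
qed

lemma cis_times_coord:
  "cis \<omega> * coord x y = (cis \<omega> * of_real y - of_real x) / (2 * \<i> * of_real (sin \<omega>))"
proof -
  have "cis \<omega> * (of_real y - cis (-\<omega>) * of_real x) = cis \<omega> * of_real y - of_real x"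
    by (simp only: right_diff_distrib mult.assoc[symmetric] cis_mult) simp
  then show ?thesis by (simp only: coord_def times_divide_eq_right)
qed

lemma Re_divide_2i: "Re (w / (2 * \<i> * of_real s)) = Im w / (2 * s)"
  by (cases "s = 0") (simp_all add: Re_divide power2_eq_square)

lemma Re_coord: "2 * Re (cis \<omega> * coord x y) = y"
  unfolding cis_times_coord Re_divide_2i using sin_nz by simp

lemma Re_coord': "2 * Re (coord x y) = x"
  unfolding coord_def Re_divide_2i using sin_nz by simp

lemma \<Phi>_coord: "\<Phi> (coord x y) = coord y (- x + f y)"
proof -
  have "\<Phi> (coord x y) = (cis \<omega> * of_real y - of_real x + of_real (f y - 2 * cos \<omega> * y)) / (2 * \<i> * of_real (sin \<omega>))"
  proof -
    have "f (2 * Re (cis \<omega> * coord x y)) - 4 * cos \<omega> * Re (cis \<omega> * coord x y) = f y - 2 * cos \<omega> * y"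
      using Re_coord[of x y] by simp
    then show ?thesis unfolding \<Phi>_def by (simp only: cis_times_coord add_divide_distrib)
  qed
  also have "cis \<omega> * of_real y - of_real x + of_real (f y - 2 * cos \<omega> * y) = of_real (- x + f y) - cis (-\<omega>) * of_real y"
    by (simp add: complex_eq_iff)
  finally show ?thesis by (simp add: coord_def)
qed

lemma coord_add: "coord (x + x') (y + y') = coord x y + coord x' y'"
  by (simp add: coord_def add_divide_distrib diff_divide_distrib algebra_simps)

lemma coord_diff: "coord (x - x') (y - y') = coord x y - coord x' y'"
  by (simp add: coord_def add_divide_distrib diff_divide_distrib algebra_simps)

text \<open>The map \<open>w \<mapsto> coord (U w) (U (N w))\<close>, which is
  \<open>w + S w\<close>, carries \<open>N\<close> to \<Phi> up to \<open>o(w ^ 3)\<close>: \<Phi>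
  shifts the pair of consecutive terms, so the recurrence error is all that appears.
  \<open>W\<close> is its right inverse.\<close>

lemma normal_form:
  "\<exists>W. (\<lambda>z. W z - z) \<in> o[nhds 0](\<lambda>z. z) \<and>
       (\<lambda>z. W (\<Phi> z) - cis (\<omega> + twist_coeff * (cmod (W z))\<^sup>2) * W z) \<in> o[nhds 0](\<lambda>z. z ^ 3)"
proof -
  define S1 where "S1 w = 2 * \<alpha> * Re (w\<^sup>2) + \<beta> * (cmod w)\<^sup>2 + 2 * \<gamma> * Re (w ^ 3)" for w
  define S2 where "S2 w = 2 * Re (N w - cis \<omega> * w) + S1 (N w)" for w
  define S where "S w = coord (S1 w) (S2 w)" for w
  have Z: "w + S w = coord (U w) (U (N w))" for w
  proof -
    have "coord (U w) (U (N w)) = coord (2 * Re w + S1 w) (2 * Re (cis \<omega> * w) + S2 w)"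
      by (simp add: U_def S1_def S2_def add.assoc)
    then show ?thesis by (simp only: coord_add coord_Re S_def)
  qed
  have bl: "bounded_linear (\<lambda>x::complex. c * Re x)" "bounded_linear (\<lambda>x::real. c * x)" for c
    by (auto intro!: bounded_linear_const_mult bounded_linear_Re bounded_linear_ident)
  have q1: "quadratic_lipschitz S1"
    unfolding S1_def
    by (intro quadratic_lipschitz_add quadratic_lipschitz_bounded_linear[OF bl(1)]
        quadratic_lipschitz_bounded_linear[OF bl(2)] quadratic_lipschitz_power2
        quadratic_lipschitz_power3 quadratic_lipschitz_cmod2)
  have q2: "quadratic_lipschitz S2"
    unfolding S2_def
    by (rule quadratic_lipschitz_add[OF quadratic_lipschitz_bounded_linear[OF bl(1) quadratic_lipschitz_twist_map]
          quadratic_lipschitz_compose_twist_map[OF q1]])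
  have q: "quadratic_lipschitz S"
  proof -
    define k where "k = inverse (2 * \<i> * complex_of_real (sin \<omega>))"
    have "S = (\<lambda>w. k * of_real (S2 w) + (- cis (-\<omega>) * k) * of_real (S1 w))"
    proof -
      have "(y - c * x) / d = inverse d * y + (- c * inverse d) * x" for x y c d :: complex
        by (simp add: divide_inverse algebra_simps)
      then show ?thesis unfolding fun_eq_iff S_def coord_def k_def by blast
    qed
    moreover have "quadratic_lipschitz \<dots>"
      by (rule quadratic_lipschitz_add[OF quadratic_lipschitz_bounded_linear[OF _ q2]
            quadratic_lipschitz_bounded_linear[OF _ q1]])
        (intro bounded_linear_const_mult bounded_linear_of_real)+
    ultimately show ?thesis by simp
  qed
  have "N 0 = 0" by (simp add: twist_map_def)
  then have S0: "S 0 = 0" by (simp add: S_def S1_def S2_def coord_def)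
  from near_identity_right_inverse[OF q S0] obtain W K \<rho> where \<rho>: "\<rho> > 0" "K \<ge> 0" and
    W: "\<And>z. cmod z \<le> \<rho> / 2 \<Longrightarrow> cmod (W z) \<le> \<rho>" "\<And>z. cmod z \<le> \<rho> / 2 \<Longrightarrow> W z + S (W z) = z"
       "\<And>z. cmod z \<le> \<rho> / 2 \<Longrightarrow> cmod (W z) \<le> 2 * cmod z" "\<And>z. cmod z \<le> \<rho> / 2 \<Longrightarrow> cmod (W z - z) \<le> K * (cmod z)\<^sup>2" and
    lip: "\<And>w w'. cmod w \<le> \<rho> \<Longrightarrow> cmod w' \<le> \<rho> \<Longrightarrow> cmod (S w - S w') \<le> 1/2 * cmod (w - w')"
    by blast
  have "(\<lambda>z. W z - z) \<in> o[nhds 0](\<lambda>z. z)"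
  proof (rule landau_o.smallI)
    fix e :: real assume e: "e > 0"
    have "cmod (W z - z) \<le> e * cmod z" if "cmod z < min (\<rho> / 2) (e / (K + 1))" for z
    proof -
      have "K * cmod z \<le> (K + 1) * cmod z" by (simp add: algebra_simps)
      also have "\<dots> \<le> e" using that \<rho>(2) by (simp add: less_divide_eq mult.commute)
      finally have "K * cmod z * cmod z \<le> e * cmod z" by (intro mult_right_mono) auto
      then show ?thesis using W(4)[of z] that by (simp add: power2_eq_square)
    qed
    then show "\<forall>\<^sub>F z in nhds 0. norm (W z - z) \<le> e * norm z"
      unfolding eventually_nhds_metric using \<rho> e by (intro exI[of _ "min (\<rho> / 2) (e / (K + 1))"]) auto
  qed
  moreover have "(\<lambda>z. W (\<Phi> z) - N (W z)) \<in> o[nhds 0](\<lambda>z. z ^ 3)"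
  proof (rule landau_o.smallI)
    fix e :: real assume e: "e > 0"
    \<comment> \<open>Compensates \<open>(2 * cmod z) ^ 3\<close> and the denominator of
      \<open>coord\<close>, so that \<open>e / 2\<close> is left.\<close>
    define e' where "e' = e * \<bar>sin \<omega>\<bar> / 8"
    have e': "e' > 0" using e sin_nz by (simp add: e'_def)
    from recurrence_error[OF this] obtain d where d: "d > 0"
      "\<And>w. cmod w < d \<Longrightarrow> \<bar>f (U (N w)) - U w - U (N (N w))\<bar> \<le> e' * cmod w ^ 3" by blast
    have ev: "\<forall>\<^sub>F z in nhds 0. cmod (\<Phi> z - cis \<omega> * z) \<le> 1 * cmod z"
      using landau_o.smallD[OF \<Phi>_linear, of 1] by simp
    have ev2: "\<forall>\<^sub>F z::complex in nhds 0. cmod z < min (\<rho> / 4) (d / 2)"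
      unfolding eventually_nhds_metric using \<rho> d by (intro exI[of _ "min (\<rho> / 4) (d / 2)"]) auto
    show "\<forall>\<^sub>F z in nhds 0. norm (W (\<Phi> z) - N (W z)) \<le> e * norm (z ^ 3)"
      using ev ev2
    proof eventually_elim
      case (elim z)
      have "cmod (\<Phi> z) \<le> cmod (cis \<omega> * z) + cmod (\<Phi> z - cis \<omega> * z)" by (metis norm_triangle_sub)
      then have \<Phi>z: "cmod (\<Phi> z) \<le> \<rho> / 2" using elim by (simp add: norm_mult)
      have z: "cmod z \<le> \<rho> / 2" using elim \<rho> by simp
      let ?w = "W z" and ?w' = "W (\<Phi> z)"
      have w: "cmod ?w < d" using W(3)[OF z] elim by simp
      have "?w' + S ?w' = \<Phi> (coord (U ?w) (U (N ?w)))" using W(2)[OF \<Phi>z] W(2)[OF z] Z by metis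
      also have "\<dots> = coord (U (N ?w)) (- U ?w + f (U (N ?w)))" by (rule \<Phi>_coord)
      finally have "(?w' + S ?w') - (N ?w + S (N ?w)) = coord 0 (f (U (N ?w)) - U ?w - U (N (N ?w)))"
        unfolding Z by (simp flip: coord_diff)
      then have "cmod ((?w' + S ?w') - (N ?w + S (N ?w))) = \<bar>f (U (N ?w)) - U ?w - U (N (N ?w))\<bar> / (2 * \<bar>sin \<omega>\<bar>)"
        by (simp add: coord_def norm_divide norm_mult del: of_real_diff)
      also have "\<dots> \<le> (e' * cmod ?w ^ 3) / (2 * \<bar>sin \<omega>\<bar>)"
        using d(2)[OF w] by (intro divide_right_mono) auto
      also have "\<dots> \<le> (e' * (2 * cmod z) ^ 3) / (2 * \<bar>sin \<omega>\<bar>)"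
        using W(3)[OF z] e' by (intro divide_right_mono mult_left_mono power_mono) auto
      also have "\<dots> = e / 2 * cmod z ^ 3" using sin_nz by (simp add: e'_def power_mult_distrib)
      finally have 1: "cmod ((?w' + S ?w') - (N ?w + S (N ?w))) \<le> e / 2 * cmod z ^ 3" .
      have 2: "cmod (S ?w' - S (N ?w)) \<le> 1/2 * cmod (?w' - N ?w)"
        using W(1)[OF z] W(1)[OF \<Phi>z] by (intro lip) auto
      \<comment> \<open>The unknown difference reappears on the right with the factor 1/2 and is
        absorbed, which doubles the bound \<open>e / 2\<close>.\<close>
      have "?w' - N ?w = ((?w' + S ?w') - (N ?w + S (N ?w))) - (S ?w' - S (N ?w))" by simp
      then have "cmod (?w' - N ?w) \<le> cmod ((?w' + S ?w') - (N ?w + S (N ?w))) + cmod (S ?w' - S (N ?w))"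
        by (metis norm_triangle_ineq4)
      with 1 2 show ?case by (simp add: norm_power)
    qed
  qed
  ultimately show ?thesis unfolding twist_map_def by blast
qed

end

section \<open>First integrals in complex coordinates\<close>

text \<open>\<open>\<Gamma>\<close> is twice the Wirtinger derivative of \<open>E\<close> with
  respect to \<open>z\<close>; \<open>P\<close> and \<open>R\<close> encode the derivative of
  \<open>\<Gamma>\<close> at 0, that is, the Hessian. Its symmetry amounts to
  \<open>Im R = 0\<close>, and \<open>P = 0\<close> means that the quadratic part is a multiple of
  |z|^2.\<close>

locale complex_first_integral =
  fixes E :: "complex \<Rightarrow> real" and \<Gamma> :: "complex \<Rightarrow> complex" and P R :: complex and r0 :: real
  assumes r0: "r0 > 0"
    and deriv: "\<And>z. cmod z < r0 \<Longrightarrow> (E has_derivative (\<lambda>v. Re (\<Gamma> z * v))) (at z)"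
    and gradient: "(\<lambda>z. \<Gamma> z - (P * z + R * cnj z)) \<in> o[nhds 0](\<lambda>z. z)"
begin

lemma gradient_bound:
  assumes "e > 0"
  shows "\<exists>d>0. d \<le> r0 \<and> (\<forall>z. cmod z < d \<longrightarrow> cmod (\<Gamma> z - (P * z + R * cnj z)) \<le> e * cmod z)"
proof -
  from landau_o.smallD[OF gradient assms] obtain d where
    "d > 0" "\<And>z. cmod z < d \<Longrightarrow> cmod (\<Gamma> z - (P * z + R * cnj z)) \<le> e * cmod z"
    unfolding eventually_nhds_metric by auto
  then show ?thesis using r0 by (intro exI[of _ "min d r0"]) auto
qed

lemma deriv_along:
  assumes "(\<gamma> has_vector_derivative v) (at t)" "cmod (\<gamma> t) < r0"
  shows "((\<lambda>t. E (\<gamma> t)) has_real_derivative Re (\<Gamma> (\<gamma> t) * v)) (at t)"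
proof -
  have "((\<lambda>t. E (\<gamma> t)) has_derivative (\<lambda>h. Re (\<Gamma> (\<gamma> t) * (h *\<^sub>R v)))) (at t)"
    using has_derivative_compose[OF assms(1)[unfolded has_vector_derivative_def] deriv[OF assms(2)]] .
  then show ?thesis unfolding has_field_derivative_def
    by (rule has_derivative_eq_rhs) (auto simp: algebra_simps)
qed

definition qform :: "complex \<Rightarrow> real" where "qform z = Re (P * z\<^sup>2) + Re R * (cmod z)\<^sup>2"

text \<open>The gradient is expanded at 0 only, so the expansion of \<open>E\<close> is obtained
  from the mean value theorem for \<open>t \<mapsto> E (t z) - t\<^sup>2 / 2 * qform z\<close> on
  the segment from 0 to \<open>z\<close>.\<close>

lemma quadratic_approx:
  assumes "e > 0"
  shows "\<exists>d>0. d \<le> r0 \<and> (\<forall>z. cmod z < d \<longrightarrow> \<bar>E z - E 0 - qform z / 2\<bar> \<le> e * (cmod z)\<^sup>2)"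
proof -
  obtain d where d: "d > 0" "d \<le> r0" "\<And>z. cmod z < d \<Longrightarrow> cmod (\<Gamma> z - (P * z + R * cnj z)) \<le> e * cmod z"
    using gradient_bound[OF assms] by blast
  have "\<bar>E z - E 0 - qform z / 2\<bar> \<le> e * (cmod z)\<^sup>2" if z: "cmod z < d" for z
  proof -
    have tz: "cmod (of_real t * z) < d" if "0 \<le> t" "t \<le> 1" for t
      using that z mult_left_le_one_le[of "cmod z" t] by (simp add: norm_mult)
    have der: "((\<lambda>t. E (of_real t * z) - t\<^sup>2 / 2 * qform z) has_real_derivative
        Re (\<Gamma> (of_real t * z) * z) - t * qform z) (at t)" if "0 \<le> t" "t \<le> 1" for t
    proof -
      have "((\<lambda>t. of_real t * z) has_vector_derivative z) (at t)"
        by (auto intro!: derivative_eq_intros)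
      from deriv_along[OF this] tz[OF that] d show ?thesis
        by (auto intro!: derivative_eq_intros)
    qed
    have "\<exists>t>0. t < 1 \<and> (E (of_real 1 * z) - 1\<^sup>2 / 2 * qform z) - (E (of_real 0 * z) - 0\<^sup>2 / 2 * qform z)
        = (1 - 0) * (Re (\<Gamma> (of_real t * z) * z) - t * qform z)"
      by (rule MVT2) (use der in auto)
    then obtain t where t: "0 < t" "t < 1" "E z - E 0 - qform z / 2 = Re (\<Gamma> (of_real t * z) * z) - t * qform z"
      by auto
    have qform: "qform z = Re ((P * z + R * cnj z) * z)"
    proof -
      have "(P * z + R * cnj z) * z = P * z\<^sup>2 + R * of_real ((cmod z)\<^sup>2)"
        unfolding complex_norm_square by (simp add: power2_eq_square algebra_simps)
      then show ?thesis by (simp add: qform_def)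
    qed
    have "(P * (of_real t * z) + R * cnj (of_real t * z)) * z = of_real t * ((P * z + R * cnj z) * z)"
      by (simp add: algebra_simps)
    then have "t * qform z = Re ((P * (of_real t * z) + R * cnj (of_real t * z)) * z)"
      unfolding qform by (simp only: scaleR_conv_of_real[symmetric] scaleR_complex.sel)
    then have "E z - E 0 - qform z / 2 = Re ((\<Gamma> (of_real t * z) - (P * (of_real t * z) + R * cnj (of_real t * z))) * z)"
      unfolding t(3) left_diff_distrib[of _ _ z] by simp
    also have "\<bar>\<dots>\<bar> \<le> cmod (\<Gamma> (of_real t * z) - (P * (of_real t * z) + R * cnj (of_real t * z))) * cmod z"
      by (metis abs_Re_le_cmod norm_mult)
    also have "\<dots> \<le> (e * cmod (of_real t * z)) * cmod z"
      using d(3)[OF tz[of t]] t by (intro mult_right_mono) auto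
    also have "\<dots> \<le> (e * cmod z) * cmod z"
      using t assms mult_left_le_one_le[of "cmod z" t] by (intro mult_right_mono mult_left_mono) (auto simp: norm_mult)
    finally show ?thesis by (simp add: power2_eq_square)
  qed
  with d show ?thesis by blast
qed

text \<open>Otherwise \<open>E\<close> would be strictly monotone along small circles.\<close>

lemma Im_R: "Im R = 0" if P: "P = 0"
proof (rule ccontr)
  assume "Im R \<noteq> 0"
  then have e: "\<bar>Im R\<bar> / 2 > 0" by simp
  obtain d where d: "d > 0" "d \<le> r0" "\<And>z. cmod z < d \<Longrightarrow> cmod (\<Gamma> z - (P * z + R * cnj z)) \<le> \<bar>Im R\<bar> / 2 * cmod z"
    using gradient_bound[OF e] by blast
  define r where "r = d / 2"
  have r: "r > 0" "r < d" using d by (auto simp: r_def)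
  let ?\<gamma> = "\<lambda>t. of_real r * cis t"
  have der: "((\<lambda>t. E (?\<gamma> t)) has_real_derivative Re (\<Gamma> (?\<gamma> t) * (of_real r * (\<i> * cis t)))) (at t)" for t
  proof (rule deriv_along)
    have "(cis has_vector_derivative \<i> * cis t) (at t)"
      unfolding has_vector_derivative_def by (rule has_derivative_cis[OF has_derivative_ident])
    then show "(?\<gamma> has_vector_derivative of_real r * (\<i> * cis t)) (at t)"
      by (rule has_vector_derivative_mult_right)
  qed (use r d in \<open>simp add: norm_mult\<close>)
  \<comment> \<open>After a full turn \<open>E\<close> is back at its value, so the angular
    derivative vanishes at some \<open>t\<close>; but it equals \<open>- Im R * r\<^sup>2\<close> up
    to half of that size.\<close>
  have "\<exists>t>0. t < 2 * pi \<and> E (?\<gamma> (2 * pi)) - E (?\<gamma> 0) = (2 * pi - 0) * Re (\<Gamma> (?\<gamma> t) * (of_real r * (\<i> * cis t)))"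
    by (rule MVT2) (use der in auto)
  then obtain t where t: "Re (\<Gamma> (?\<gamma> t) * (of_real r * (\<i> * cis t))) = 0" by auto
  let ?z = "?\<gamma> t"
  have prod: "(R * cnj ?z) * (\<i> * ?z) = (\<i> * R) * of_real (r\<^sup>2)"
    by (simp add: power2_eq_square algebra_simps cis_cnj cis_mult)
  have "Re ((R * cnj ?z) * (\<i> * ?z)) = - Im R * r\<^sup>2" unfolding prod by (simp flip: of_real_power)
  then have "\<bar>Im R\<bar> * r\<^sup>2 = \<bar>Re ((R * cnj ?z) * (\<i> * ?z))\<bar>" by (simp only: abs_mult abs_minus abs_power2)
  also have "\<dots> = \<bar>Re ((\<Gamma> ?z - (P * ?z + R * cnj ?z)) * (\<i> * ?z))\<bar>"
  proof -
    have "\<Gamma> ?z * (\<i> * ?z) = \<Gamma> ?z * (of_real r * (\<i> * cis t))" by (simp add: mult.left_commute)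
    then have "Re (\<Gamma> ?z * (\<i> * ?z)) = 0" using t by (simp only:)
    then show ?thesis unfolding P left_diff_distrib minus_complex.sel mult_zero_left add_0 by (simp only: diff_0 abs_minus_cancel)
  qed
  also have "\<dots> \<le> cmod (\<Gamma> ?z - (P * ?z + R * cnj ?z)) * cmod (\<i> * ?z)"
    by (metis abs_Re_le_cmod norm_mult)
  also have "\<dots> \<le> (\<bar>Im R\<bar> / 2 * r) * r"
    using d(3)[of ?z] r by (intro mult_mono) (auto simp: norm_mult)
  finally have "\<bar>Im R\<bar> * r\<^sup>2 \<le> \<bar>Im R\<bar> * r\<^sup>2 / 2" by (simp add: power2_eq_square)
  moreover have "\<bar>Im R\<bar> * r\<^sup>2 > 0" using e r by simp
  ultimately show False by linarith
qed

text \<open>To second order, invariance says that \<open>qform\<close> is invariant under the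
  rotation by \<omega>. The term with |z|^2 always is, while \<open>P\<close> gets multiplied by
  \<open>(cis \<omega>)\<^sup>2\<close>, which differs from 1.\<close>

lemma P_eq_0:
  assumes sin: "sin \<omega> \<noteq> 0" and lin: "(\<lambda>z. \<Phi> z - cis \<omega> * z) \<in> o[nhds 0](\<lambda>z. z)"
    and inv: "\<And>z. cmod z < r0 \<Longrightarrow> cmod (\<Phi> z) < r0 \<Longrightarrow> E (\<Phi> z) = E z"
  shows "P = 0"
proof -
  define A where "A = P * ((cis \<omega>)\<^sup>2 - 1)"
  define C where "C = cmod P + \<bar>Re R\<bar>"
  have C: "C \<ge> 0" by (simp add: C_def)
  \<comment> \<open>The constant 10 is 2(1 + 4), from the approximation of \<open>E\<close> at
    \<open>z\<close> and at its image of modulus at most 2t; the 3 bounds the sum of the image and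
    the rotated point by 3t.\<close>
  have small: "\<bar>Re (A * u\<^sup>2)\<bar> \<le> e * (10 + 3 * C)" if u: "cmod u = 1" and e: "0 < e" "e \<le> 1" for u e
  proof -
    obtain d where d: "d > 0" "d \<le> r0" "\<And>z. cmod z < d \<Longrightarrow> \<bar>E z - E 0 - qform z / 2\<bar> \<le> e * (cmod z)\<^sup>2"
      using quadratic_approx[OF e(1)] by blast
    from landau_o.smallD[OF lin e(1)] obtain d' where d': "d' > 0"
      "\<And>z. cmod z < d' \<Longrightarrow> cmod (\<Phi> z - cis \<omega> * z) \<le> e * cmod z"
      unfolding eventually_nhds_metric by auto
    define t where "t = min d d' / 3"
    have t: "t > 0" "t < d'" "2 * t < d" using d d' by (auto simp: t_def)
    let ?z = "of_real t * u"
    let ?y = "cis \<omega> * ?z" and ?x = "\<Phi> (of_real t * u)"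
    have z: "cmod ?z = t" "cmod ?y = t" using t u by (auto simp: norm_mult)
    have xy: "cmod (?x - ?y) \<le> e * t" using d'(2)[of ?z] z t by simp
    have "cmod ?x \<le> cmod ?y + cmod (?x - ?y)" by (metis norm_triangle_sub)
    moreover have "e * t \<le> 1 * t" using e t by (intro mult_right_mono) auto
    ultimately have x: "cmod ?x \<le> 2 * t" using xy z by linarith
    have "\<bar>E ?z - E 0 - qform ?z / 2\<bar> \<le> e * t\<^sup>2" using d(3)[of ?z] z t by simp
    moreover have "\<bar>E ?x - E 0 - qform ?x / 2\<bar> \<le> e * (4 * t\<^sup>2)"
    proof -
      have "\<bar>E ?x - E 0 - qform ?x / 2\<bar> \<le> e * (cmod ?x)\<^sup>2" using d(3)[of ?x] x t by simp
      also have "\<dots> \<le> e * (2 * t)\<^sup>2" using x e by (intro mult_left_mono power_mono) auto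
      finally show ?thesis by (simp add: power_mult_distrib)
    qed
    moreover have "E ?x = E ?z" using x z t d by (intro inv) auto
    ultimately have 1: "\<bar>qform ?x - qform ?z\<bar> \<le> 10 * (e * t\<^sup>2)" by linarith
    have 2: "\<bar>qform ?x - qform ?y\<bar> \<le> 3 * C * (e * t\<^sup>2)"
    proof -
      have sum: "cmod (?x + ?y) \<le> 3 * t" using norm_triangle_ineq[of ?x ?y] x z by linarith
      have ncm: "\<bar>cmod ?x - cmod ?y\<bar> \<le> e * t" using norm_triangle_ineq3[of ?x ?y] xy by linarith
      have "qform ?x - qform ?y = Re (P * ((?x + ?y) * (?x - ?y))) + Re R * ((cmod ?x + cmod ?y) * (cmod ?x - cmod ?y))"
        unfolding qform_def by (simp add: power2_eq_square algebra_simps)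
      also have "\<bar>\<dots>\<bar> \<le> cmod (P * ((?x + ?y) * (?x - ?y))) + \<bar>Re R * ((cmod ?x + cmod ?y) * (cmod ?x - cmod ?y))\<bar>"
        by (rule order.trans[OF abs_triangle_ineq add_right_mono[OF abs_Re_le_cmod]])
      also have "\<dots> \<le> cmod P * ((3 * t) * (e * t)) + \<bar>Re R\<bar> * ((3 * t) * (e * t))"
        unfolding norm_mult[of P] norm_mult[of "?x + ?y"] abs_mult using sum ncm xy x z t
        by (intro add_mono mult_mono mult_nonneg_nonneg) auto
      also have "\<dots> = 3 * C * (e * t\<^sup>2)" by (simp add: C_def power2_eq_square algebra_simps)
      finally show ?thesis .
    qed
    have "qform ?y - qform ?z = Re (A * u\<^sup>2) * t\<^sup>2"
    proof -
      have "P * ?y\<^sup>2 - P * ?z\<^sup>2 = of_real (t\<^sup>2) * (A * u\<^sup>2)"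
        by (simp add: A_def power_mult_distrib algebra_simps)
      then have "Re (P * ?y\<^sup>2) - Re (P * ?z\<^sup>2) = Re (of_real (t\<^sup>2) * (A * u\<^sup>2))" by (metis minus_complex.sel(1))
      then show ?thesis unfolding qform_def z by (simp only: Re_complex_of_real Re_divide times_complex.sel Im_complex_of_real) simp
    qed
    then have "\<bar>Re (A * u\<^sup>2)\<bar> * t\<^sup>2 = \<bar>qform ?y - qform ?z\<bar>" by (simp add: abs_mult)
    also have "\<dots> \<le> (e * (10 + 3 * C)) * t\<^sup>2" using 1 2 by (simp add: algebra_simps)
    finally show ?thesis using t by simp
  qed
  have zero: "Re (A * u\<^sup>2) = 0" if "cmod u = 1" for u
  proof (rule ccontr)
    assume n: "Re (A * u\<^sup>2) \<noteq> 0"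
    define e where "e = min 1 (\<bar>Re (A * u\<^sup>2)\<bar> / (2 * (10 + 3 * C)))"
    have e: "0 < e" "e \<le> 1" using n C by (auto simp: e_def)
    have "e * (10 + 3 * C) \<le> \<bar>Re (A * u\<^sup>2)\<bar> / (2 * (10 + 3 * C)) * (10 + 3 * C)"
      using C by (intro mult_right_mono) (auto simp: e_def)
    also have "\<dots> = \<bar>Re (A * u\<^sup>2)\<bar> / 2" using C by (simp add: field_simps)
    finally show False using small[OF that e] n by linarith
  qed
  \<comment> \<open>The directions \<open>1\<close> and \<open>cis (pi / 4)\<close> detect the real
    and the imaginary part of \<open>A\<close>.\<close>
  have "(cis (pi / 4))\<^sup>2 = \<i>" by (simp add: power2_eq_square cis_mult)
  then have "A = 0" using zero[of 1] zero[of "cis (pi / 4)"] by (simp add: complex_eq_iff)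
  moreover have "(cis \<omega>)\<^sup>2 \<noteq> 1"
  proof
    assume "(cis \<omega>)\<^sup>2 = 1"
    then have "cis \<omega> = 1 \<or> cis \<omega> = -1" by (simp add: power2_eq_1_iff)
    then show False using sin by (auto simp: complex_eq_iff)
  qed
  ultimately show ?thesis by (simp add: A_def)
qed

text \<open>Along a ray the derivative of \<open>E\<close> is \<open>Re R\<close> times the radius,
  with an error of at most half of it.\<close>

lemma radially_increasing:
  assumes P: "P = 0" and R: "Re R > 0"
  shows "\<exists>d>0. d \<le> r0 \<and> (\<forall>u s t. cmod u = 1 \<longrightarrow> 0 < s \<longrightarrow> s < t \<longrightarrow> t < d \<longrightarrow> E (of_real s * u) < E (of_real t * u))"
proof -
  have e: "Re R / 2 > 0" using R by simp
  obtain d where d: "d > 0" "d \<le> r0" "\<And>z. cmod z < d \<Longrightarrow> cmod (\<Gamma> z - (P * z + R * cnj z)) \<le> Re R / 2 * cmod z"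
    using gradient_bound[OF e] by blast
  have "E (of_real s * u) < E (of_real t * u)" if u: "cmod u = 1" and st: "0 < s" "s < t" "t < d" for u s t
  proof (rule DERIV_pos_imp_increasing[OF st(2)])
    fix x assume x: "s \<le> x" "x \<le> t"
    let ?z = "of_real x * u"
    have z: "cmod ?z = x" using x st u by (simp add: norm_mult)
    have "((\<lambda>t. of_real t * u) has_vector_derivative u) (at x)"
      by (auto intro!: derivative_eq_intros)
    from deriv_along[OF this] z x st d have der: "((\<lambda>x. E (of_real x * u)) has_real_derivative Re (\<Gamma> ?z * u)) (at x)"
      by auto
    have prod: "R * cnj ?z * u = of_real x * R * of_real ((cmod u)\<^sup>2)"
      unfolding complex_norm_square by (simp add: algebra_simps)
    have "Re (R * cnj ?z * u) = x * Re R" unfolding prod u by simp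
    moreover have "\<bar>Re ((\<Gamma> ?z - (P * ?z + R * cnj ?z)) * u)\<bar> \<le> Re R / 2 * x"
      using abs_Re_le_cmod[of "(\<Gamma> ?z - (P * ?z + R * cnj ?z)) * u"] d(3)[of ?z] z x st u
      by (simp add: norm_mult)
    moreover have "Re (\<Gamma> ?z * u) = Re ((\<Gamma> ?z - (P * ?z + R * cnj ?z)) * u) + Re (R * cnj ?z * u)"
      using P by (simp add: algebra_simps)
    moreover have "x * Re R > 0" using x st R by simp
    moreover have "Re R / 2 * x = x * Re R / 2" by simp
    ultimately have "Re (\<Gamma> ?z * u) > 0" by linarith
    with der show "\<exists>y. ((\<lambda>x. E (of_real x * u)) has_real_derivative y) (at x) \<and> y > 0" by blast
  qed
  with d show ?thesis by blast
qed

end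

lemma (in elliptic_expansion) infinitely_many_periodic_points:
  assumes "twist_coeff \<noteq> 0"
    and fi: "complex_first_integral E \<Gamma> P R r0" and nz: "P \<noteq> 0 \<or> R \<noteq> 0"
    and cont: "continuous_on (ball 0 r0) \<Phi>"
    and inv: "\<And>z. cmod z < r0 \<Longrightarrow> cmod (\<Phi> z) < r0 \<Longrightarrow> E (\<Phi> z) = E z"
  shows "\<exists>N0. \<forall>N\<ge>N0. infinite {z. (\<forall>i. cmod ((\<Phi> ^^ i) z) < r0) \<and> (\<Phi> ^^ N) z = z}"
proof -
  interpret complex_first_integral E \<Gamma> P R r0 by fact
  have P: "P = 0" by (rule P_eq_0[OF sin_nz \<Phi>_linear inv])
  then have "Im R = 0" by (rule Im_R)
  then have R: "Re R \<noteq> 0" using nz P by (auto simp: complex_eq_iff)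
  \<comment> \<open>If \<open>E\<close> has a maximum at 0 its sign is reversed, so that
    \<open>E'\<close> has a minimum with value 0 there, as the twist argument requires.\<close>
  define \<sigma> where "\<sigma> = sgn (Re R)"
  have \<sigma>: "\<sigma> \<noteq> 0" "\<sigma> * Re R > 0" using R by (auto simp: \<sigma>_def sgn_if)
  define E' where "E' z = \<sigma> * (E z - E 0)" for z
  interpret E': complex_first_integral E' "\<lambda>z. of_real \<sigma> * \<Gamma> z" 0 "of_real \<sigma> * R" r0
  proof
    fix z assume "cmod z < r0"
    from deriv[OF this] show "(E' has_derivative (\<lambda>v. Re (of_real \<sigma> * \<Gamma> z * v))) (at z)"
      unfolding E'_def by (auto intro!: derivative_eq_intros simp: algebra_simps)
  next
    have "(\<lambda>z. of_real \<sigma> * (\<Gamma> z - (P * z + R * cnj z))) \<in> o[nhds 0](\<lambda>z. z)"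
      using gradient by (rule landau_o.small.cmult_in_iff[THEN iffD2, rotated]) (use \<sigma> in simp)
    then show "(\<lambda>z. of_real \<sigma> * \<Gamma> z - (0 * z + of_real \<sigma> * R * cnj z)) \<in> o[nhds 0](\<lambda>z. z)"
      using P by (simp add: algebra_simps)
  qed (rule r0)
  have R': "Re (of_real \<sigma> * R) > 0" using \<sigma> by simp
  from E'.radially_increasing[OF refl R'] obtain d where d: "d > 0" "d \<le> r0"
    "\<And>u s t. cmod u = 1 \<Longrightarrow> 0 < s \<Longrightarrow> s < t \<Longrightarrow> t < d \<Longrightarrow> E' (of_real s * u) < E' (of_real t * u)"
    by blast
  define \<kappa> where "\<kappa> = Re (of_real \<sigma> * R) / 2"
  have \<kappa>: "\<kappa> > 0" using R' by (simp add: \<kappa>_def)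
  have quad: "(\<lambda>z. E' z - \<kappa> * (cmod z)\<^sup>2) \<in> o[nhds 0](\<lambda>z. (cmod z)\<^sup>2)"
  proof (rule landau_o.smallI)
    fix e :: real assume "e > 0"
    from E'.quadratic_approx[OF this] obtain c where c: "c > 0"
      "\<And>z. cmod z < c \<Longrightarrow> \<bar>E' z - E' 0 - E'.qform z / 2\<bar> \<le> e * (cmod z)\<^sup>2" by blast
    have "norm (E' z - \<kappa> * (cmod z)\<^sup>2) \<le> e * norm ((cmod z)\<^sup>2)" if "cmod z < c" for z
      using c(2)[OF that] by (simp add: E'_def E'.qform_def \<kappa>_def)
    then show "\<forall>\<^sub>F z in nhds 0. norm (E' z - \<kappa> * (cmod z)\<^sup>2) \<le> e * norm ((cmod z)\<^sup>2)"
      unfolding eventually_nhds_metric using c(1) by auto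
  qed
  from normal_form obtain W where W: "(\<lambda>z. W z - z) \<in> o[nhds 0](\<lambda>z. z)"
    "(\<lambda>z. W (\<Phi> z) - cis (\<omega> + twist_coeff * (cmod (W z))\<^sup>2) * W z) \<in> o[nhds 0](\<lambda>z. z ^ 3)" by blast
  have "\<exists>N0. \<forall>N\<ge>N0. infinite {z. (\<forall>i. cmod ((\<Phi> ^^ i) z) < d) \<and> (\<Phi> ^^ N) z = z}"
  proof (rule twist_infinite_periodic[OF d(1) \<kappa> assms(1) _ \<Phi>_linear W quad])
    show "continuous_on (ball 0 d) \<Phi>" by (rule continuous_on_subset[OF cont]) (use d in auto)
    show "E' (\<Phi> z) = E' z" if "cmod z < d" "cmod (\<Phi> z) < d" for z
      using inv[of z] that d by (simp add: E'_def)
  qed (rule d(3))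
  then obtain N0 where N0: "\<And>N. N \<ge> N0 \<Longrightarrow> infinite {z. (\<forall>i. cmod ((\<Phi> ^^ i) z) < d) \<and> (\<Phi> ^^ N) z = z}" by blast
  have "infinite {z. (\<forall>i. cmod ((\<Phi> ^^ i) z) < r0) \<and> (\<Phi> ^^ N) z = z}" if "N \<ge> N0" for N
  proof (rule infinite_super[OF _ N0[OF that]], safe)
    fix z i assume "\<forall>i. cmod ((\<Phi> ^^ i) z) < d"
    then have "cmod ((\<Phi> ^^ i) z) < d" by blast
    then show "cmod ((\<Phi> ^^ i) z) < r0" using d(2) by linarith
  qed
  then show ?thesis by blast
qed

section \<open>From a real first integral to its complex form\<close>

lemma Cm_on_Suc_Suc_imp:
  assumes "Cm_on (Suc (Suc m)) f S" "x \<in> S"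
  shows "(f has_derivative frechet_derivative f (at x)) (at x)"
    "((\<lambda>x. frechet_derivative f (at x) v) has_derivative
        frechet_derivative (\<lambda>x. frechet_derivative f (at x) v) (at x)) (at x)"
  using assms by (auto simp: frechet_derivative_works[symmetric])

text \<open>In the linear coordinates given by the basis, the derivatives of \<open>V\<close> along
  \<open>M1\<close> and \<open>M2\<close> make up \<open>\<Gamma>\<close>. The radius is left free
  up to \<open>r1\<close>, so that it can be adapted to the domain on which the map is
  continuous.\<close>

lemma first_integral_complex_coordinates:
  fixes M1 M2 p :: "real^2"
  assumes fi: "first_integral_on (Suc (Suc m)) F p U V" and U: "open U" "p \<in> U"
    and basis: "\<And>v. \<exists>s t. v = s *\<^sub>R M1 + t *\<^sub>R M2"
  defines "L \<equiv> \<lambda>z. Re z *\<^sub>R M1 + Im z *\<^sub>R M2"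
  shows "\<exists>\<Gamma> P R r1. r1 > 0 \<and> (P \<noteq> 0 \<or> R \<noteq> 0) \<and> (\<forall>z. cmod z < r1 \<longrightarrow> p + L z \<in> U) \<and>
     (\<forall>r. 0 < r \<longrightarrow> r \<le> r1 \<longrightarrow> complex_first_integral (\<lambda>z. V (p + L z)) \<Gamma> P R r)"
proof -
  have Cm: "Cm_on (Suc (Suc m)) V U" and crit: "critical_point V p" and hess: "det (hessian V p) \<noteq> 0"
    using fi unfolding first_integral_on_def by blast+
  define D where "D v x = frechet_derivative V (at x) v" for v x
  have dV: "(V has_derivative (\<lambda>v. D v x)) (at x)" if "x \<in> U" for x
    using Cm_on_Suc_Suc_imp(1)[OF Cm that] by (simp add: D_def)
  have dD: "(D v has_derivative frechet_derivative (D v) (at p)) (at p)" for v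
    using Cm_on_Suc_Suc_imp(2)[OF Cm U(2), of v] unfolding D_def by simp
  have lin: "D (s *\<^sub>R v + t *\<^sub>R w) x = s * D v x + t * D w x" if "x \<in> U" for s t v w x
  proof -
    interpret linear "\<lambda>v. D v x" using dV[OF that] by (rule has_derivative_linear)
    show ?thesis by (simp add: add scale)
  qed
  have D0: "D v p = 0" for v
    using crit frechet_derivative_at unfolding critical_point_def D_def by metis
  have blL: "bounded_linear L"
    unfolding L_def by (intro bounded_linear_intros bounded_linear_Re bounded_linear_Im)
  interpret L: bounded_linear L by (rule blL)
  have "open ((\<lambda>z. p + L z) -` U)"
    by (intro open_vimage U(1) continuous_intros L.continuous_on)
  moreover have "0 \<in> (\<lambda>z. p + L z) -` U" using U(2) by (simp add: L.zero)
  ultimately obtain r1 where "r1 > 0" "ball 0 r1 \<subseteq> (\<lambda>z. p + L z) -` U"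
    unfolding open_contains_ball by blast
  then have r1: "r1 > 0" "\<And>z. cmod z < r1 \<Longrightarrow> p + L z \<in> U" by auto
  define \<Gamma> where "\<Gamma> z = of_real (D M1 (p + L z)) - \<i> * of_real (D M2 (p + L z))" for z
  define G1 where "G1 = frechet_derivative (D M1) (at p)"
  define G2 where "G2 = frechet_derivative (D M2) (at p)"
  define \<Lambda> where "\<Lambda> z = of_real (G1 (L z)) - \<i> * of_real (G2 (L z))" for z
  have d1: "(D M1 has_derivative G1) (at p)" and d2: "(D M2 has_derivative G2) (at p)"
    unfolding G1_def G2_def by (rule dD)+
  have dL: "((\<lambda>z. p + L z) has_derivative L) (at 0)"
    using L.has_derivative[OF has_derivative_ident, of "at 0"] by (auto intro!: derivative_eq_intros)
  have c: "((\<lambda>z. D v (p + L z)) has_derivative (\<lambda>z. G (L z))) (at 0)" if "(D v has_derivative G) (at p)" for v G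
    using has_derivative_compose[OF dL, of "D v" G] that by (simp add: L.zero)
  have d\<Gamma>: "(\<Gamma> has_derivative \<Lambda>) (at 0)"
    unfolding \<Gamma>_def \<Lambda>_def
    by (intro has_derivative_diff has_derivative_mult_right has_derivative_of_real c d1 d2)
  have "\<Gamma> 0 = 0" by (simp add: \<Gamma>_def L.zero D0)
  interpret \<Lambda>: linear \<Lambda> by (rule has_derivative_linear[OF d\<Gamma>])
  \<comment> \<open>Wirtinger coefficients: every real-linear map of the plane has the form
    \<open>P * z + R * cnj z\<close>.\<close>
  define P where "P = (\<Lambda> 1 - \<i> * \<Lambda> \<i>) / 2"
  define R where "R = (\<Lambda> 1 + \<i> * \<Lambda> \<i>) / 2"
  have \<Lambda>: "\<Lambda> z = P * z + R * cnj z" for z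
  proof -
    have "z = Re z *\<^sub>R 1 + Im z *\<^sub>R \<i>" by (simp add: complex_eq_iff)
    then have "\<Lambda> z = \<Lambda> (Re z *\<^sub>R 1 + Im z *\<^sub>R \<i>)" by (rule arg_cong)
    also have "\<dots> = of_real (Re z) * \<Lambda> 1 + of_real (Im z) * \<Lambda> \<i>"
      by (simp only: \<Lambda>.add \<Lambda>.scale) (simp only: scaleR_conv_of_real)
    also have "\<dots> = P * (of_real (Re z) + \<i> * of_real (Im z)) + R * (of_real (Re z) - \<i> * of_real (Im z))"
      by (simp add: P_def R_def field_simps)
    also have "\<dots> = P * z + R * cnj z" by (simp add: complex_eq_iff)
    finally show ?thesis .
  qed
  \<comment> \<open>If both vanish, the derivatives of \<open>D M1\<close> and \<open>D M2\<close>
    at \<open>p\<close> are 0. As \<open>D\<close> is linear in the direction, this holds for all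
    \<open>D v\<close>, and the Hessian would be 0.\<close>
  have "P \<noteq> 0 \<or> R \<noteq> 0"
  proof (rule ccontr)
    assume "\<not> ?thesis"
    then have "\<Lambda> z = 0" for z by (simp add: \<Lambda>)
    then have z: "G1 (L z) = 0" "G2 (L z) = 0" for z
      by (auto simp: \<Lambda>_def complex_eq_iff)
    have G0: "G1 v = 0" "G2 v = 0" for v
    proof -
      obtain s t where "v = s *\<^sub>R M1 + t *\<^sub>R M2" using basis by blast
      then have "v = L (Complex s t)" by (simp add: L_def)
      then show "G1 v = 0" "G2 v = 0" using z by auto
    qed
    have "frechet_derivative (D v) (at p) = (\<lambda>_. 0)" for v
    proof -
      obtain s t where v: "v = s *\<^sub>R M1 + t *\<^sub>R M2" using basis by blast
      have "((\<lambda>x. s * D M1 x + t * D M2 x) has_derivative (\<lambda>h. s * G1 h + t * G2 h)) (at p)"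
        by (intro derivative_intros d1 d2)
      then have "(D v has_derivative (\<lambda>h. s * G1 h + t * G2 h)) (at p)"
        by (rule has_derivative_transform_within_open[OF _ U]) (simp add: v lin)
      then show ?thesis using frechet_derivative_at by (force simp: G0)
    qed
    then have "hessian V p = 0"
      unfolding hessian_def D_def by (simp add: vec_eq_iff)
    then show False using hess by (simp add: det_2)
  qed
  moreover have "complex_first_integral (\<lambda>z. V (p + L z)) \<Gamma> P R r" if r: "0 < r" "r \<le> r1" for r
  proof
    fix z assume "cmod z < r"
    then have zU: "p + L z \<in> U" using r r1 by auto
    have "((\<lambda>z. p + L z) has_derivative L) (at z)"
      using L.has_derivative[OF has_derivative_ident, of "at z"] by (auto intro!: derivative_eq_intros)
    from has_derivative_compose[OF this dV[OF zU]]
    have "((\<lambda>z. V (p + L z)) has_derivative (\<lambda>v. D (L v) (p + L z))) (at z)" .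
    then show "((\<lambda>z. V (p + L z)) has_derivative (\<lambda>v. Re (\<Gamma> z * v))) (at z)"
      by (rule has_derivative_eq_rhs) (auto simp: L_def \<Gamma>_def lin[OF zU[unfolded L_def]])
  next
    show "(\<lambda>z. \<Gamma> z - (P * z + R * cnj z)) \<in> o[nhds 0](\<lambda>z. z)"
    proof (rule landau_o.smallI)
      fix e :: real assume e: "e > 0"
      from d\<Gamma>[unfolded has_derivative_at_alt] e obtain d where d: "d > 0"
        "\<And>y. norm (y - 0) < d \<Longrightarrow> norm (\<Gamma> y - \<Gamma> 0 - \<Lambda> (y - 0)) \<le> e * norm (y - 0)" by blast
      then have "norm (\<Gamma> z - (P * z + R * cnj z)) \<le> e * norm z" if "norm z < d" for z
        using d(2)[of z] that \<open>\<Gamma> 0 = 0\<close> by (simp add: \<Lambda>)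
      then show "\<forall>\<^sub>F z in nhds 0. norm (\<Gamma> z - (P * z + R * cnj z)) \<le> e * norm z"
        unfolding eventually_nhds_metric using d(1) by auto
    qed
  qed (rule r(1))
  ultimately show ?thesis using r1 by blast
qed

section \<open>Continuation of the fixed point\<close>

text \<open>The quotient rule is iterated on pairs of numerator and denominator without cancelling.
  All denominators are powers of \<open>q\<close>, so no new poles arise.\<close>

lemma rational_derivatives:
  fixes p q :: "real poly"
  shows "\<exists>H::nat \<Rightarrow> real \<Rightarrow> real. H 0 = (\<lambda>y. poly p y / poly q y) \<and>
    (\<forall>k y. poly q y \<noteq> 0 \<longrightarrow> (H k has_real_derivative H (Suc k) y) (at y))"
proof -
  define pq where "pq = rec_nat (p, q) (\<lambda>_ (n, d). (pderiv n * d - n * pderiv d, d * d))"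
  define H where "H k y = poly (fst (pq k)) y / poly (snd (pq k)) y" for k y
  have pq_Suc: "fst (pq (Suc k)) = pderiv (fst (pq k)) * snd (pq k) - fst (pq k) * pderiv (snd (pq k))"
    "snd (pq (Suc k)) = snd (pq k) * snd (pq k)" for k
    by (simp_all add: pq_def split: prod.split)
  have nz: "poly q y \<noteq> 0 \<Longrightarrow> poly (snd (pq k)) y \<noteq> 0" for k y
  proof (induction k)
    case 0
    then show ?case by (simp add: pq_def)
  next
    case (Suc k)
    then show ?case by (simp add: pq_Suc)
  qed
  have "(H k has_real_derivative H (Suc k) y) (at y)" if "poly q y \<noteq> 0" for k y
    unfolding H_def pq_Suc using nz[OF that, of k]
    by (auto intro!: derivative_eq_intros poly_DERIV simp: field_simps)
  moreover have "H 0 = (\<lambda>y. poly p y / poly q y)" by (simp add: H_def pq_def fun_eq_iff)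
  ultimately show ?thesis by blast
qed

text \<open>The second component of the map is \<open>- x + f \<epsilon> y\<close>; the functions \<open>D1\<close>, \<open>D2\<close>, \<open>D3\<close> below are
  its derivatives in \<open>y\<close>.\<close>

locale cohen_family =
  fixes G H :: "nat \<Rightarrow> real \<Rightarrow> real" and X :: "real set" and y0 :: real
  assumes X: "open X" "y0 \<in> X" and y0: "y0 = 1 / sqrt 3"
    and G: "\<And>k y. y \<in> X \<Longrightarrow> (G k has_real_derivative G (Suc k) y) (at y)"
    and H: "\<And>k y. y \<in> X \<Longrightarrow> (H k has_real_derivative H (Suc k) y) (at y)"
begin

definition P :: "real \<Rightarrow> real \<Rightarrow> real" where "P \<epsilon> y = y\<^sup>2 + 1 + \<epsilon> * H 0 y"
definition P1 :: "real \<Rightarrow> real \<Rightarrow> real" where "P1 \<epsilon> y = 2 * y + \<epsilon> * H 1 y"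
definition P2 :: "real \<Rightarrow> real \<Rightarrow> real" where "P2 \<epsilon> y = 2 + \<epsilon> * H 2 y"
definition P3 :: "real \<Rightarrow> real \<Rightarrow> real" where "P3 \<epsilon> y = \<epsilon> * H 3 y"
definition f :: "real \<Rightarrow> real \<Rightarrow> real" where "f \<epsilon> y = sqrt (P \<epsilon> y) + \<epsilon> * G 0 y"
definition R :: "real \<Rightarrow> real \<Rightarrow> real" where "R \<epsilon> y = inverse (sqrt (P \<epsilon> y))"
definition D1 :: "real \<Rightarrow> real \<Rightarrow> real" where
  "D1 \<epsilon> y = P1 \<epsilon> y * R \<epsilon> y / 2 + \<epsilon> * G 1 y"
definition D2 :: "real \<Rightarrow> real \<Rightarrow> real" where
  "D2 \<epsilon> y = P2 \<epsilon> y * R \<epsilon> y / 2 - (P1 \<epsilon> y)\<^sup>2 * R \<epsilon> y ^ 3 / 4 + \<epsilon> * G 2 y"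
definition D3 :: "real \<Rightarrow> real \<Rightarrow> real" where
  "D3 \<epsilon> y = P3 \<epsilon> y * R \<epsilon> y / 2 - 3 * P1 \<epsilon> y * P2 \<epsilon> y * R \<epsilon> y ^ 3 / 4
     + 3 * P1 \<epsilon> y ^ 3 * R \<epsilon> y ^ 5 / 8 + \<epsilon> * G 3 y"

section \<open>Derivatives of the family and its twist at the unperturbed fixed point\<close>

lemma P_derivs:
  assumes "y \<in> X"
  shows "(P \<epsilon> has_real_derivative P1 \<epsilon> y) (at y)" "(P1 \<epsilon> has_real_derivative P2 \<epsilon> y) (at y)"
    "(P2 \<epsilon> has_real_derivative P3 \<epsilon> y) (at y)"
proof -
  have H': "(H 0 has_real_derivative H 1 y) (at y)" "(H 1 has_real_derivative H 2 y) (at y)"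
    "(H 2 has_real_derivative H 3 y) (at y)"
    using H[OF assms, of 0] H[OF assms, of 1] H[OF assms, of 2]
    by (simp_all add: numeral_2_eq_2 numeral_3_eq_3)
  show "(P \<epsilon> has_real_derivative P1 \<epsilon> y) (at y)"
    unfolding P_def P1_def using H'(1) by (auto intro!: derivative_eq_intros)
  show "(P1 \<epsilon> has_real_derivative P2 \<epsilon> y) (at y)"
    unfolding P1_def P2_def using H'(2) by (auto intro!: derivative_eq_intros)
  show "(P2 \<epsilon> has_real_derivative P3 \<epsilon> y) (at y)"
    unfolding P2_def P3_def using H'(3) by (auto intro!: derivative_eq_intros)
qed

lemma f_derivs:
  assumes "y \<in> X" "P \<epsilon> y > 0"
  shows "(f \<epsilon> has_real_derivative D1 \<epsilon> y) (at y)" "(D1 \<epsilon> has_real_derivative D2 \<epsilon> y) (at y)"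
    "(D2 \<epsilon> has_real_derivative D3 \<epsilon> y) (at y)" "isCont (D3 \<epsilon>) y"
proof -
  have G': "(G 0 has_real_derivative G 1 y) (at y)" "(G 1 has_real_derivative G 2 y) (at y)"
    "(G 2 has_real_derivative G 3 y) (at y)"
    using G[OF assms(1), of 0] G[OF assms(1), of 1] G[OF assms(1), of 2]
    by (simp_all add: numeral_2_eq_2 numeral_3_eq_3)
  note P = P_derivs[OF assms(1), of \<epsilon>]
  have sq: "((\<lambda>y. sqrt (P \<epsilon> y)) has_real_derivative P1 \<epsilon> y * R \<epsilon> y / 2) (at y)"
    by (rule DERIV_cong[OF DERIV_chain2[where g = "P \<epsilon>", OF DERIV_real_sqrt[OF assms(2)] P(1)]])
      (simp add: R_def)
  have R: "(R \<epsilon> has_real_derivative - (P1 \<epsilon> y * R \<epsilon> y ^ 3 / 2)) (at y)"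
  proof -
    have "sqrt (P \<epsilon> y) \<noteq> 0" using assms(2) by simp
    from DERIV_inverse_fun[OF sq this] show ?thesis
      unfolding R_def[abs_def]
    proof (rule DERIV_cong)
      have "- (p * inverse q / 2 * inverse (q ^ Suc (Suc 0))) = - (p * inverse q ^ 3 / 2)" for p q :: real
        by (simp add: power3_eq_cube)
      then show "- (P1 \<epsilon> y * inverse (sqrt (P \<epsilon> y)) / 2 * inverse (sqrt (P \<epsilon> y) ^ Suc (Suc 0))) =
          - (P1 \<epsilon> y * inverse (sqrt (P \<epsilon> y)) ^ 3 / 2)" .
    qed
  qed
  show "(f \<epsilon> has_real_derivative D1 \<epsilon> y) (at y)"
    unfolding f_def D1_def using DERIV_add[OF sq DERIV_cmult[OF G'(1)]] by simp
  show "(D1 \<epsilon> has_real_derivative D2 \<epsilon> y) (at y)"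
    unfolding D1_def
    by (rule DERIV_cong[OF DERIV_add[OF DERIV_cdivide[OF DERIV_mult[OF P(2) R]] DERIV_cmult[OF G'(2)]]])
      (simp add: D2_def power3_eq_cube power2_eq_square field_simps)
  show "(D2 \<epsilon> has_real_derivative D3 \<epsilon> y) (at y)"
    unfolding D2_def
    by (rule DERIV_cong[OF DERIV_add[OF DERIV_diff[OF DERIV_cdivide[OF DERIV_mult[OF P(3) R]]
            DERIV_cdivide[OF DERIV_mult[OF DERIV_power[OF P(2), of 2] DERIV_power[OF R, of 3]]]]
          DERIV_cmult[OF G'(3)]]])
      (simp add: D3_def eval_nat_numeral field_simps)
  have "isCont (H 3) y" "isCont (G 3) y" using H[OF assms(1)] G[OF assms(1)] DERIV_isCont by blast+
  moreover have "isCont (R \<epsilon>) y" "isCont (P1 \<epsilon>) y" "isCont (P2 \<epsilon>) y"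
    using R P DERIV_isCont by blast+
  ultimately show "isCont (D3 \<epsilon>) y"
    unfolding D3_def P3_def by (intro continuous_intros) auto
qed

text \<open>The fixed-point equation gives \<open>sqrt (P 0 y0) = 2 * y0\<close>, so everything is
  rational in \<open>y0\<close>, and \<open>y0\<^sup>2 = 1 / 3\<close>. \<open>D2\<close> is a
  rational multiple of \<open>sqrt 3\<close>; its square is recorded because the twist is quadratic
  in it.\<close>

lemma values_at_y0:
  "P 0 y0 = 4 / 3" "D1 0 y0 = 1 / 2" "(D2 0 y0)\<^sup>2 = 27 / 64" "D3 0 y0 = - 27 / 32"
proof -
  have y2: "y0\<^sup>2 = 1 / 3" by (simp add: y0 power_divide)
  have ypos: "y0 > 0" by (simp add: y0)
  show P0: "P 0 y0 = 4 / 3" by (simp add: P_def y2)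
  have "(2 * y0)\<^sup>2 = 4 / 3" using y2 by (simp add: power_mult_distrib)
  then have s: "sqrt (P 0 y0) = 2 * y0" unfolding P0 using ypos by (metis less_eq_real_def mult_pos_pos real_sqrt_unique zero_less_numeral)
  then have r: "R 0 y0 = inverse (2 * y0)" by (simp add: R_def)
  have ry: "y0 * inverse (2 * y0) = 1 / 2" using ypos by simp
  have r2: "(inverse (2 * y0))\<^sup>2 = 3 / 4" by (simp only: power_inverse power_mult_distrib y2) simp
  have r3: "inverse (2 * y0) ^ 3 = inverse (2 * y0) * (3 / 4)"
    using r2 by (simp add: power3_eq_cube power2_eq_square)
  have r5: "inverse (2 * y0) ^ 5 = inverse (2 * y0) * (9 / 16)"
    using r2 r3 by (simp add: eval_nat_numeral)
  show "D1 0 y0 = 1 / 2" unfolding D1_def r P1_def using ry by simp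
  have "D2 0 y0 = inverse (2 * y0) - y0\<^sup>2 * (3 / 4) * inverse (2 * y0)"
    unfolding D2_def r r3 P1_def P2_def by (simp add: power_mult_distrib)
  then have D2: "D2 0 y0 = 3 / 4 * inverse (2 * y0)" by (simp add: y2)
  show "(D2 0 y0)\<^sup>2 = 27 / 64" unfolding D2 power_mult_distrib r2 by (simp add: power2_eq_square)
  have "D3 0 y0 = - 9 / 4 * (y0 * inverse (2 * y0)) + 27 / 16 * (y0\<^sup>2 * (y0 * inverse (2 * y0)))"
    unfolding D3_def r r3 r5 P1_def P2_def P3_def by (simp add: power_mult_distrib power3_eq_cube power2_eq_square)
  then show "D3 0 y0 = - 27 / 32" unfolding ry y2 by simp
qed

text \<open>The negative of \<open>2 sin \<omega>\<close> times the twist coefficient at a fixed point with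
  \<open>cos \<omega> = D1 / 2\<close>.\<close>

definition twist_num :: "real \<Rightarrow> real \<Rightarrow> real" where
  "twist_num \<epsilon> y = (let c = D1 \<epsilon> y / 2; a = D2 \<epsilon> y / 2; b = D3 \<epsilon> y / 6 in
     2 * a * (a / (2 * (2 * c\<^sup>2 - 1 - c)) + a / (1 - c)) + 3 * b)"

lemma twist_num_at_y0: "twist_num 0 y0 = - 15 / 64"
proof -
  \<comment> \<open>Here c = 1/4, so 2c^2 - 1 - c = -9/8 and 1 - c = 3/4. The bracket is a(4/3 -
    4/9) = 8a/9, and 2a times it is 4/9 of the square of \<open>D2\<close>.\<close>
  have "twist_num 0 y0 = (D2 0 y0)\<^sup>2 * (4 / 9) + D3 0 y0 / 2"
    unfolding twist_num_def Let_def values_at_y0(2) by (simp add: power2_eq_square field_simps)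
  then show ?thesis unfolding values_at_y0 by simp
qed

lemma joint_continuity:
  "isCont (\<lambda>p. P (fst p) (snd p)) (0, y0)" "isCont (\<lambda>p. D1 (fst p) (snd p)) (0, y0)"
  "isCont (\<lambda>p. twist_num (fst p) (snd p)) (0, y0)"
proof -
  have "isCont (H k) y0" "isCont (G k) y0" for k using H[OF X(2)] G[OF X(2)] DERIV_isCont by blast+
  moreover have fs: "isCont fst (0::real, y0)" "isCont snd (0::real, y0)"
    using isCont_fst[OF continuous_ident, of "(0::real, y0)"] isCont_snd[OF continuous_ident, of "(0::real, y0)"]
    by simp_all
  ultimately have HG: "isCont (\<lambda>p. H k (snd p)) (0::real, y0)" "isCont (\<lambda>p. G k (snd p)) (0::real, y0)" for k
    using isCont_o2[of "(0::real, y0)" snd "H k"] isCont_o2[of "(0::real, y0)" snd "G k"] by simp_all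
  show P: "isCont (\<lambda>p. P (fst p) (snd p)) (0, y0)"
    unfolding P_def by (intro continuous_intros HG fs)
  have s: "isCont (\<lambda>p. R (fst p) (snd p)) (0, y0)"
    unfolding R_def by (intro continuous_intros P) (simp add: values_at_y0)
  have P1: "isCont (\<lambda>p. P1 (fst p) (snd p)) (0, y0)" and P2: "isCont (\<lambda>p. P2 (fst p) (snd p)) (0, y0)"
    and P3: "isCont (\<lambda>p. P3 (fst p) (snd p)) (0, y0)"
    unfolding P1_def P2_def P3_def by (intro continuous_intros HG fs)+
  show D1: "isCont (\<lambda>p. D1 (fst p) (snd p)) (0, y0)"
    unfolding D1_def by (intro continuous_intros HG fs P1 s) auto
  have D2: "isCont (\<lambda>p. D2 (fst p) (snd p)) (0, y0)"
    unfolding D2_def by (intro continuous_intros HG fs P1 P2 s) auto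
  have D3: "isCont (\<lambda>p. D3 (fst p) (snd p)) (0, y0)"
    unfolding D3_def by (intro continuous_intros HG fs P1 P2 P3 s) auto
  show "isCont (\<lambda>p. twist_num (fst p) (snd p)) (0, y0)"
    unfolding twist_num_def Let_def
    by (intro continuous_intros D1 D2 D3) (auto simp: values_at_y0 power2_eq_square)
qed

text \<open>All conditions are open, so joint continuity at \<open>(0, y0)\<close> spreads them.
  With cos \<omega> = D1 / 2, the bounds on \<open>D1\<close> mean 0 < cos \<omega> < 1/2 and keep
  clear of the resonant values -1, -1/2, 0 and 1.\<close>

lemma good_neighborhood:
  "\<exists>\<delta>>0. \<forall>\<epsilon> y. \<bar>\<epsilon>\<bar> < \<delta> \<longrightarrow> \<bar>y - y0\<bar> < \<delta> \<longrightarrow>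
     y \<in> X \<and> P \<epsilon> y > 0 \<and> 0 < D1 \<epsilon> y \<and> D1 \<epsilon> y < 1 \<and> twist_num \<epsilon> y < 0"
proof -
  have nhds: "(g \<longlongrightarrow> g a) (nhds a)" if "isCont g a" for g :: "real \<times> real \<Rightarrow> real" and a
    using that unfolding isCont_def tendsto_at_iff_tendsto_nhds .
  note t = joint_continuity[THEN nhds]
  have "\<forall>\<^sub>F p in nhds (0, y0). P (fst p) (snd p) > 0"
    "\<forall>\<^sub>F p in nhds (0, y0). D1 (fst p) (snd p) > 0"
    "\<forall>\<^sub>F p in nhds (0, y0). D1 (fst p) (snd p) < 1"
    "\<forall>\<^sub>F p in nhds (0, y0). twist_num (fst p) (snd p) < 0"
    using order_tendstoD(1)[OF t(1), of 0] order_tendstoD(1)[OF t(2), of 0] order_tendstoD(2)[OF t(2), of 1]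
      order_tendstoD(2)[OF t(3), of 0]
    by (simp_all add: values_at_y0 twist_num_at_y0)
  moreover have "\<forall>\<^sub>F p in nhds (0::real, y0). snd p \<in> X"
  proof -
    have "open (UNIV \<times> X :: (real \<times> real) set)" using X by (intro open_Times) auto
    then have "\<forall>\<^sub>F p in nhds (0::real, y0). p \<in> UNIV \<times> X" by (rule eventually_nhds_in_open) (use X in simp)
    then show ?thesis by (rule eventually_mono) auto
  qed
  ultimately have "\<forall>\<^sub>F p in nhds (0, y0). snd p \<in> X \<and> P (fst p) (snd p) > 0 \<and>
      0 < D1 (fst p) (snd p) \<and> D1 (fst p) (snd p) < 1 \<and> twist_num (fst p) (snd p) < 0"
    by eventually_elim blast
  then obtain d where d: "d > 0" "\<And>p. dist p (0, y0) < d \<Longrightarrow> snd p \<in> X \<and> P (fst p) (snd p) > 0 \<and>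
      0 < D1 (fst p) (snd p) \<and> D1 (fst p) (snd p) < 1 \<and> twist_num (fst p) (snd p) < 0"
    unfolding eventually_nhds_metric by blast
  have "dist (\<epsilon>, y) (0, y0) < d" if "\<bar>\<epsilon>\<bar> < d / 2" "\<bar>y - y0\<bar> < d / 2" for \<epsilon> y
  proof -
    have "dist (\<epsilon>, y) (0, y0) \<le> \<bar>\<epsilon>\<bar> + \<bar>y - y0\<bar>"
      unfolding dist_Pair_Pair dist_real_def using sqrt_sum_squares_le_sum_abs[of \<epsilon> "y - y0"] by simp
    then show ?thesis using that by linarith
  qed
  then show ?thesis using d by (intro exI[of _ "d / 2"]) force
qed

text \<open>Since \<open>D1 < 1\<close>, the function \<open>2 y - f \<epsilon> y\<close> is strictly increasing in \<open>y\<close>.\<close>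

lemma fixed_point_continuation:
  assumes \<delta>: "\<delta> > 0" "\<And>\<epsilon> y. \<bar>\<epsilon>\<bar> < \<delta> \<Longrightarrow> \<bar>y - y0\<bar> < \<delta> \<Longrightarrow> y \<in> X \<and> P \<epsilon> y > 0 \<and> D1 \<epsilon> y < 1"
  shows "\<exists>\<epsilon>0>0. \<forall>\<epsilon>. \<bar>\<epsilon>\<bar> < \<epsilon>0 \<longrightarrow> (\<exists>y. \<bar>y - y0\<bar> \<le> \<delta> / 2 \<and> f \<epsilon> y = 2 * y \<and>
           (\<forall>z. \<bar>z - y0\<bar> < \<delta> \<longrightarrow> f \<epsilon> z = 2 * z \<longrightarrow> z = y))"
proof -
  have mono: "2 * z - f \<epsilon> z > 2 * y - f \<epsilon> y"
    if "\<bar>\<epsilon>\<bar> < \<delta>" "\<bar>y - y0\<bar> < \<delta>" "\<bar>z - y0\<bar> < \<delta>" "y < z" for \<epsilon> y z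
  proof (rule DERIV_pos_imp_increasing[OF that(4)])
    fix x assume "y \<le> x" "x \<le> z"
    then have "\<bar>x - y0\<bar> < \<delta>" using that by linarith
    note x = \<delta>(2)[OF that(1) this]
    have "((\<lambda>y. 2 * y - f \<epsilon> y) has_real_derivative 2 - D1 \<epsilon> x) (at x)"
      using f_derivs(1)[of x \<epsilon>] x by (auto intro!: derivative_eq_intros)
    then show "\<exists>d. ((\<lambda>y. 2 * y - f \<epsilon> y) has_real_derivative d) (at x) \<and> d > 0"
      using x by (intro exI[of _ "2 - D1 \<epsilon> x"]) auto
  qed
  have root0: "2 * y0 - f 0 y0 = 0"
  proof -
    have "sqrt (4 / 3) = 2 * y0" by (simp add: y0 real_sqrt_divide)
    then show ?thesis by (simp add: f_def values_at_y0)
  qed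
  have tends: "((\<lambda>\<epsilon>. 2 * y - f \<epsilon> y) \<longlongrightarrow> 2 * y - f 0 y) (nhds 0)" for y
    unfolding f_def P_def by (intro tendsto_intros filterlim_ident)
  have "2 * (y0 + \<delta> / 2) - f 0 (y0 + \<delta> / 2) > 0" "2 * (y0 - \<delta> / 2) - f 0 (y0 - \<delta> / 2) < 0"
    using mono[of 0 y0 "y0 + \<delta> / 2"] mono[of 0 "y0 - \<delta> / 2" y0] root0 \<delta>(1) by auto
  then have "\<forall>\<^sub>F \<epsilon> in nhds 0. 2 * (y0 + \<delta> / 2) - f \<epsilon> (y0 + \<delta> / 2) > 0"
    "\<forall>\<^sub>F \<epsilon> in nhds 0. 2 * (y0 - \<delta> / 2) - f \<epsilon> (y0 - \<delta> / 2) < 0"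
    using order_tendstoD[OF tends] by blast+
  moreover have "\<forall>\<^sub>F \<epsilon>::real in nhds 0. \<bar>\<epsilon>\<bar> < \<delta>"
    unfolding eventually_nhds_metric using \<delta>(1) by auto
  ultimately have "\<forall>\<^sub>F \<epsilon> in nhds 0. 2 * (y0 + \<delta> / 2) - f \<epsilon> (y0 + \<delta> / 2) > 0 \<and>
     2 * (y0 - \<delta> / 2) - f \<epsilon> (y0 - \<delta> / 2) < 0 \<and> \<bar>\<epsilon>\<bar> < \<delta>" by eventually_elim blast
  then obtain \<epsilon>0 where \<epsilon>0: "\<epsilon>0 > 0" "\<And>\<epsilon>. \<bar>\<epsilon>\<bar> < \<epsilon>0 \<Longrightarrow> 2 * (y0 + \<delta> / 2) - f \<epsilon> (y0 + \<delta> / 2) > 0 \<and>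
     2 * (y0 - \<delta> / 2) - f \<epsilon> (y0 - \<delta> / 2) < 0 \<and> \<bar>\<epsilon>\<bar> < \<delta>"
    unfolding eventually_nhds_metric by auto
  have "\<exists>y. \<bar>y - y0\<bar> \<le> \<delta> / 2 \<and> f \<epsilon> y = 2 * y \<and> (\<forall>z. \<bar>z - y0\<bar> < \<delta> \<longrightarrow> f \<epsilon> z = 2 * z \<longrightarrow> z = y)"
    if \<epsilon>: "\<bar>\<epsilon>\<bar> < \<epsilon>0" for \<epsilon>
  proof -
    have \<epsilon>\<delta>: "\<bar>\<epsilon>\<bar> < \<delta>" using \<epsilon>0(2)[OF \<epsilon>] by blast
    have cont: "continuous_on {y0 - \<delta> / 2..y0 + \<delta> / 2} (\<lambda>y. 2 * y - f \<epsilon> y)"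
    proof (intro continuous_at_imp_continuous_on ballI)
      fix x assume "x \<in> {y0 - \<delta> / 2..y0 + \<delta> / 2}"
      then have "\<bar>x - y0\<bar> < \<delta>" using \<delta>(1) by auto
      then have "isCont (f \<epsilon>) x" using \<delta>(2)[OF \<epsilon>\<delta>] f_derivs(1) DERIV_isCont by blast
      then show "isCont (\<lambda>y. 2 * y - f \<epsilon> y) x" by (intro continuous_intros)
    qed
    have "\<exists>y\<ge>y0 - \<delta> / 2. y \<le> y0 + \<delta> / 2 \<and> 2 * y - f \<epsilon> y = 0"
      by (rule IVT'[OF _ _ _ cont]) (use \<epsilon>0(2)[OF \<epsilon>] \<delta>(1) in auto)
    then obtain y where "y0 - \<delta> / 2 \<le> y" "y \<le> y0 + \<delta> / 2" "2 * y - f \<epsilon> y = 0" by blast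
    then have y: "\<bar>y - y0\<bar> \<le> \<delta> / 2" "f \<epsilon> y = 2 * y" unfolding abs_le_iff by linarith+
    have "z = y" if "\<bar>z - y0\<bar> < \<delta>" "f \<epsilon> z = 2 * z" for z
    proof -
      have "\<bar>y - y0\<bar> < \<delta>" using y(1) \<delta>(1) by linarith
      then show ?thesis
        using mono[OF \<epsilon>\<delta> that(1), of y] mono[OF \<epsilon>\<delta> _ that(1), of y] that(2) y(2)
        by (cases z y rule: linorder_cases) auto
    qed
    with y show ?thesis by blast
  qed
  with \<epsilon>0(1) show ?thesis by blast
qed

text \<open>The Lagrange remainder contains \<open>D3\<close> at an intermediate point; continuity
  of \<open>D3\<close> at \<open>y\<close> makes the difference \<open>o(u ^ 3)\<close>.\<close>

lemma taylor_expansion: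
  assumes nb: "\<And>z. \<bar>z - y\<bar> < \<rho> \<Longrightarrow> z \<in> X \<and> P \<epsilon> z > 0" and \<rho>: "\<rho> > 0"
  shows "(\<lambda>u. f \<epsilon> (y + u) - f \<epsilon> y - (D1 \<epsilon> y * u + D2 \<epsilon> y / 2 * u\<^sup>2 + D3 \<epsilon> y / 6 * u ^ 3)) \<in> o[nhds 0](\<lambda>u. u ^ 3)"
proof (rule landau_o.smallI)
  fix e :: real assume e: "e > 0"
  have "isCont (D3 \<epsilon>) y" using f_derivs(4) nb[of y] \<rho> by simp
  then obtain d where d: "d > 0" "\<And>z. \<bar>z - y\<bar> < d \<Longrightarrow> \<bar>D3 \<epsilon> z - D3 \<epsilon> y\<bar> < 6 * e"
    using e unfolding continuous_at_eps_delta dist_real_def by (metis mult_pos_pos zero_less_numeral)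
  have "\<bar>f \<epsilon> (y + u) - f \<epsilon> y - (D1 \<epsilon> y * u + D2 \<epsilon> y / 2 * u\<^sup>2 + D3 \<epsilon> y / 6 * u ^ 3)\<bar> \<le> e * \<bar>u ^ 3\<bar>"
    if u: "\<bar>u\<bar> < min d (\<rho> / 2)" for u
  proof (cases "u = 0")
    case False
    define diff where "diff n = (if n = 0 then f \<epsilon> else if n = 1 then D1 \<epsilon> else if n = 2 then D2 \<epsilon> else D3 \<epsilon>)" for n :: nat
    have "\<exists>t. (if y + u < y then y + u < t \<and> t < y else y < t \<and> t < y + u) \<and>
      f \<epsilon> (y + u) = (\<Sum>m<3. diff m y / fact m * (y + u - y) ^ m) + diff 3 t / fact 3 * (y + u - y) ^ 3"
    proof (rule Taylor[where a = "y - \<rho> / 2" and b = "y + \<rho> / 2"])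
      show "\<forall>m t. m < 3 \<and> y - \<rho> / 2 \<le> t \<and> t \<le> y + \<rho> / 2 \<longrightarrow> (diff m has_real_derivative diff (Suc m) t) (at t)"
      proof (intro allI impI)
        fix m t assume mt: "m < (3::nat) \<and> y - \<rho> / 2 \<le> t \<and> t \<le> y + \<rho> / 2"
        then have "\<bar>t - y\<bar> < \<rho>" using \<rho> by (auto simp: abs_less_iff)
        note t = f_derivs[of t \<epsilon>, OF conjunct1[OF nb[OF this]] conjunct2[OF nb[OF this]]]
        have "m = 0 \<or> m = 1 \<or> m = 2" using mt by auto
        then show "(diff m has_real_derivative diff (Suc m) t) (at t)"
          using t by (auto simp: diff_def)
      qed
    qed (use u False \<rho> in \<open>auto simp: diff_def\<close>)
    then obtain t where t': "if y + u < y then y + u < t \<and> t < y else y < t \<and> t < y + u"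
      "f \<epsilon> (y + u) = (\<Sum>m<3. diff m y / fact m * (y + u - y) ^ m) + diff 3 t / fact 3 * (y + u - y) ^ 3"
      by blast
    have t: "\<bar>t - y\<bar> < \<bar>u\<bar>"
      "f \<epsilon> (y + u) = (\<Sum>m<3. diff m y / fact m * u ^ m) + D3 \<epsilon> t / 6 * u ^ 3"
    proof -
      show "\<bar>t - y\<bar> < \<bar>u\<bar>" using t'(1) by (auto split: if_splits)
      have "diff 3 = D3 \<epsilon>" "fact 3 = (6 :: real)" by (simp_all add: diff_def fact_numeral)
      then show "f \<epsilon> (y + u) = (\<Sum>m<3. diff m y / fact m * u ^ m) + D3 \<epsilon> t / 6 * u ^ 3"
        using t'(2) by simp
    qed
    have "f \<epsilon> (y + u) - f \<epsilon> y - (D1 \<epsilon> y * u + D2 \<epsilon> y / 2 * u\<^sup>2 + D3 \<epsilon> y / 6 * u ^ 3)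
        = (D3 \<epsilon> t - D3 \<epsilon> y) / 6 * u ^ 3"
    proof -
      have "(\<Sum>m<3. diff m y / fact m * u ^ m) = f \<epsilon> y + D1 \<epsilon> y * u + D2 \<epsilon> y / 2 * u\<^sup>2"
        by (simp add: diff_def numeral_3_eq_3 numeral_2_eq_2)
      then show ?thesis unfolding t(2) by (simp add: diff_divide_distrib left_diff_distrib)
    qed
    also have "\<bar>\<dots>\<bar> \<le> e * \<bar>u ^ 3\<bar>"
      unfolding abs_mult using d(2)[of t] t(1) u by (intro mult_right_mono) auto
    finally show ?thesis .
  qed simp
  then show "\<forall>\<^sub>F u in nhds 0. norm (f \<epsilon> (y + u) - f \<epsilon> y - (D1 \<epsilon> y * u + D2 \<epsilon> y / 2 * u\<^sup>2 + D3 \<epsilon> y / 6 * u ^ 3)) \<le> e * norm (u ^ 3)"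
    unfolding eventually_nhds_metric using d(1) \<rho> by (intro exI[of _ "min d (\<rho> / 2)"]) auto
qed

text \<open>Subtracting the equilibrium \<open>y\<close> from all terms of
  \<open>x (n+2) + x n = f \<epsilon> (x (n+1))\<close> replaces \<open>f \<epsilon>\<close> by
  \<open>u \<mapsto> f \<epsilon> (y + u) - 2 * y\<close>, whose linear coefficient is
  \<open>D1 \<epsilon> y = 2 * cos \<omega>\<close>.\<close>

lemma elliptic_expansion_at_fixed_point:
  assumes nb: "\<And>z. \<bar>z - y\<bar> < \<rho> \<Longrightarrow> z \<in> X \<and> P \<epsilon> z > 0" and \<rho>: "\<rho> > 0"
    and fixp: "f \<epsilon> y = 2 * y" and D1: "0 < D1 \<epsilon> y" "D1 \<epsilon> y < 1" and tw: "twist_num \<epsilon> y < 0"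
  defines "\<omega> \<equiv> arccos (D1 \<epsilon> y / 2)"
  shows "elliptic_expansion \<omega> (D2 \<epsilon> y / 2) (D3 \<epsilon> y / 6) (\<lambda>u. f \<epsilon> (y + u) - 2 * y)"
    "elliptic_expansion.twist_coeff \<omega> (D2 \<epsilon> y / 2) (D3 \<epsilon> y / 6) \<noteq> 0"
proof -
  define c where "c = D1 \<epsilon> y / 2"
  have c: "0 < c" "c < 1 / 2" using D1 by (auto simp: c_def)
  have cos: "cos \<omega> = c" unfolding \<omega>_def c_def[symmetric] using c by (intro cos_arccos) auto
  have "c\<^sup>2 < 1" using c by (subst abs_square_less_1) simp
  then have sin: "sin \<omega> \<noteq> 0" using sin_cos_squared_add[of \<omega>] cos by auto
  have cos2: "cos (2 * \<omega>) = 2 * c\<^sup>2 - 1" by (simp add: cos_double_cos cos)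
  interpret e: elliptic_expansion \<omega> "D2 \<epsilon> y / 2" "D3 \<epsilon> y / 6" "\<lambda>u. f \<epsilon> (y + u) - 2 * y"
  proof
    show "cos (2 * \<omega>) \<noteq> cos \<omega>"
    proof
      assume "cos (2 * \<omega>) = cos \<omega>"
      then have "(2 * c + 1) * (c - 1) = 0" unfolding cos2 cos by (simp add: power2_eq_square algebra_simps)
      then show False using c by auto
    qed
    show "cos (3 * \<omega>) \<noteq> cos \<omega>"
    proof
      assume "cos (3 * \<omega>) = cos \<omega>"
      then have "c * (c\<^sup>2 - 1) = 0" unfolding cos_treble_cos cos by (simp add: power2_eq_square power3_eq_cube algebra_simps)
      then show False using c \<open>c\<^sup>2 < 1\<close> by auto
    qed
    show "(\<lambda>u. f \<epsilon> (y + u) - 2 * y - (2 * cos \<omega> * u + D2 \<epsilon> y / 2 * u\<^sup>2 + D3 \<epsilon> y / 6 * u ^ 3)) \<in> o[nhds 0](\<lambda>u. u ^ 3)"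
      using taylor_expansion[of y \<rho> \<epsilon>, OF nb \<rho>] unfolding cos c_def fixp by simp
  qed (rule sin)
  show "elliptic_expansion \<omega> (D2 \<epsilon> y / 2) (D3 \<epsilon> y / 6) (\<lambda>u. f \<epsilon> (y + u) - 2 * y)"
    by (rule e.elliptic_expansion_axioms)
  have "e.twist_coeff = - twist_num \<epsilon> y / (2 * sin \<omega>)"
    unfolding e.twist_coeff_def e.\<alpha>_def e.\<beta>_def twist_num_def Let_def cos2 cos c_def[symmetric] by simp
  then show "e.twist_coeff \<noteq> 0" using tw sin by simp
qed

end

section \<open>Non-integrability\<close>

lemma complex_eigenvalue_companion:
  assumes "complex_eigenvalue A l" and A: "A $ 1 $ 1 = 0" "A $ 1 $ 2 = 1" "A $ 2 $ 1 = -1" "A $ 2 $ 2 = t"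
  shows "l\<^sup>2 - of_real t * l + 1 = 0"
proof -
  obtain v :: "complex^2" where v: "v \<noteq> 0" "(\<chi> i j. complex_of_real (A $ i $ j)) *v v = l *s v"
    using assms(1) unfolding complex_eigenvalue_def by blast
  have "v $ 2 = l * v $ 1" "- v $ 1 + of_real t * v $ 2 = l * v $ 2"
    using v(2) by (auto simp: vec_eq_iff forall_2 sum_2 matrix_vector_mult_def A)
  then have "(l\<^sup>2 - of_real t * l + 1) * v $ 1 = 0" and "v $ 1 \<noteq> 0"
    using v(1) by (auto simp: vec_eq_iff forall_2 power2_eq_square algebra_simps)
  then show ?thesis by simp
qed

text \<open>The linear part has determinant 1 and trace \<open>t\<close>, so for |t| < 2 its
  eigenvalues are nonreal conjugates with product 1.\<close>

lemma elliptic_fixed_pointI: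
  assumes "p \<in> interior D" "F p = p" "\<bar>t\<bar> < 2"
    and F: "(F has_derivative (\<lambda>h::real^2. vector [h $ 2, - h $ 1 + t * h $ 2])) (at p)"
  shows "elliptic_fixed_point D F p"
proof -
  define A where "A = matrix (frechet_derivative F (at p))"
  have fd: "frechet_derivative F (at p) = (\<lambda>h. vector [h $ 2, - h $ 1 + t * h $ 2])"
    using frechet_derivative_at[OF F] by simp
  have A: "A $ 1 $ 1 = 0" "A $ 1 $ 2 = 1" "A $ 2 $ 1 = -1" "A $ 2 $ 2 = t"
    unfolding A_def fd matrix_def by (simp_all add: axis_def)
  have "cmod l = 1 \<and> l \<noteq> 1 \<and> l \<noteq> -1" if "complex_eigenvalue A l" for l
  proof -
    have eq: "l\<^sup>2 - of_real t * l + 1 = 0" by (rule complex_eigenvalue_companion[OF that A])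
    have re: "(Re l)\<^sup>2 - (Im l)\<^sup>2 - t * Re l + 1 = 0" and im: "Im l * (2 * Re l - t) = 0"
      using arg_cong[OF eq, of Re] arg_cong[OF eq, of Im] by (simp_all add: power2_eq_square algebra_simps)
    have t4: "t\<^sup>2 < 4" using assms(3) abs_square_less_1[of "t / 2"] by (simp add: power_divide)
    have "Im l \<noteq> 0"
    proof
      assume "Im l = 0"
      then have "(Re l - t / 2)\<^sup>2 + (1 - t\<^sup>2 / 4) = 0" using re by (simp add: power2_eq_square algebra_simps)
      moreover have "(Re l - t / 2)\<^sup>2 \<ge> 0" by simp
      ultimately show False using t4 by linarith
    qed
    moreover from this have "t = 2 * Re l" using im by simp
    then have "(Re l)\<^sup>2 + (Im l)\<^sup>2 = 1" using re by (simp add: power2_eq_square)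
    then have "cmod l = 1" by (simp add: cmod_def)
    ultimately show ?thesis by auto
  qed
  moreover have "F differentiable (at p)" using F by (auto simp: differentiable_def)
  ultimately show ?thesis using assms(1,2) unfolding elliptic_fixed_point_def A_def by blast
qed

text \<open>Here dynamics and algebra meet: \<open>fin\<close> supplies the finiteness for periodic
  solutions of the recurrence near \<open>y\<close>, and the twist produces infinitely many of
  them.\<close>

lemma not_locally_integrable_second_order:
  fixes F :: "real^2 \<Rightarrow> real^2" and p :: "real^2"
  assumes ee: "elliptic_expansion \<omega> a b (\<lambda>u. \<phi> (y + u) - 2 * y)"
    and tw: "elliptic_expansion.twist_coeff \<omega> a b \<noteq> 0"
    and F: "\<And>v. F v = vector [v $ 2, - v $ 1 + \<phi> (v $ 2)]" and p: "p = vector [y, y]"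
    and \<rho>: "\<rho> > 0" and cont: "\<And>z. \<bar>z - y\<bar> < \<rho> \<Longrightarrow> isCont \<phi> z"
    and fin: "\<And>N S j. N > 0 \<Longrightarrow> \<not> 3 dvd N \<Longrightarrow> (\<And>x n. x \<in> S \<Longrightarrow> x (n + N) = x n) \<Longrightarrow>
        (\<And>x n. x \<in> S \<Longrightarrow> \<bar>x n - y\<bar> < \<rho> \<and> x (n + 2) = - x n + \<phi> (x (n + 1))) \<Longrightarrow> j < N + 2 \<Longrightarrow>
        finite ((\<lambda>x::nat \<Rightarrow> real. x j) ` S)"
  shows "\<not> locally_integrable_at (Suc (Suc m)) D F p"
proof
  assume "locally_integrable_at (Suc (Suc m)) D F p"
  then obtain U V where U: "open U" "p \<in> U" and fi: "first_integral_on (Suc (Suc m)) F p U V"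
    unfolding locally_integrable_at_def by blast
  interpret e: elliptic_expansion \<omega> a b "\<lambda>u. \<phi> (y + u) - 2 * y" by (rule ee)
  \<comment> \<open>Chosen to invert \<open>coord\<close>: the point \<open>p + L z\<close> has the
    coordinates y + 2 Re z and y + 2 Re (cis \<omega> z).\<close>
  define M1 :: "real^2" where "M1 = vector [2, 2 * cos \<omega>]"
  define M2 :: "real^2" where "M2 = vector [0, - 2 * sin \<omega>]"
  define L where "L z = Re z *\<^sub>R M1 + Im z *\<^sub>R M2" for z
  have basis: "\<exists>s t. v = s *\<^sub>R M1 + t *\<^sub>R M2" for v
    by (rule exI[of _ "v $ 1 / 2"], rule exI[of _ "(cos \<omega> * v $ 1 - v $ 2) / (2 * sin \<omega>)"])
      (use e.sin_nz in \<open>simp add: vec_eq_iff forall_2 M1_def M2_def\<close>)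
  have pL: "p + L z = vector [y + 2 * Re z, y + 2 * Re (cis \<omega> * z)]" for z
    by (simp add: vec_eq_iff forall_2 p L_def M1_def M2_def algebra_simps)
  have Re_\<Phi>: "2 * Re (e.\<Phi> z) = 2 * Re (cis \<omega> * z)"
    and Re_\<Phi>': "2 * Re (cis \<omega> * e.\<Phi> z) = - 2 * Re z + (\<phi> (y + 2 * Re (cis \<omega> * z)) - 2 * y)" for z
  proof -
    have "e.\<Phi> z = e.coord (2 * Re (cis \<omega> * z)) (- (2 * Re z) + (\<phi> (y + 2 * Re (cis \<omega> * z)) - 2 * y))"
      using e.\<Phi>_coord[of "2 * Re z" "2 * Re (cis \<omega> * z)"] unfolding e.coord_Re .
    then show "2 * Re (e.\<Phi> z) = 2 * Re (cis \<omega> * z)"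
      "2 * Re (cis \<omega> * e.\<Phi> z) = - 2 * Re z + (\<phi> (y + 2 * Re (cis \<omega> * z)) - 2 * y)"
      by (simp_all only: e.Re_coord e.Re_coord')
  qed
  have conj: "F (p + L z) = p + L (e.\<Phi> z)" for z
    unfolding pL F Re_\<Phi> Re_\<Phi>' by (simp add: vec_eq_iff forall_2)
  from first_integral_complex_coordinates[OF fi U basis] obtain \<Gamma> P R r1 where r1: "r1 > 0" "P \<noteq> 0 \<or> R \<noteq> 0"
    "\<And>z. cmod z < r1 \<Longrightarrow> p + L z \<in> U"
    "\<And>r. 0 < r \<Longrightarrow> r \<le> r1 \<Longrightarrow> complex_first_integral (\<lambda>z. V (p + L z)) \<Gamma> P R r"
    unfolding L_def by blast
  define r where "r = min r1 (\<rho> / 2)"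
  have r: "r > 0" "r \<le> r1" using r1 \<rho> by (auto simp: r_def)
  have Re_less: "\<bar>2 * Re z\<bar> < \<rho>" "\<bar>2 * Re (cis \<omega> * z)\<bar> < \<rho>" if "cmod z < r" for z
    using that abs_Re_le_cmod[of z] abs_Re_le_cmod[of "cis \<omega> * z"] unfolding norm_mult norm_cis r_def by linarith+
  have "continuous_on (ball 0 r) (\<lambda>z. \<phi> (y + 2 * Re (cis \<omega> * z)))"
  proof (rule continuous_on_compose2[where t = "{z. \<bar>z - y\<bar> < \<rho>}" and g = \<phi>])
    show "continuous_on {z. \<bar>z - y\<bar> < \<rho>} \<phi>"
      by (intro continuous_at_imp_continuous_on ballI cont) simp
  qed (use Re_less in \<open>auto intro!: continuous_intros simp del: times_complex.sel\<close>)
  then have cont\<Phi>: "continuous_on (ball 0 r) e.\<Phi>"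
    unfolding e.\<Phi>_def by (intro continuous_intros) (use e.sin_nz in auto)
  have inv: "V (p + L (e.\<Phi> z)) = V (p + L z)" if "cmod z < r" "cmod (e.\<Phi> z) < r" for z
  proof -
    have "p + L z \<in> U" "F (p + L z) \<in> U" unfolding conj using that r by (auto intro!: r1(3))
    then show ?thesis using fi unfolding first_integral_on_def conj[symmetric] by blast
  qed
  from e.infinitely_many_periodic_points[OF tw r1(4)[OF r] r1(2) cont\<Phi> inv] obtain N0 where
    N0: "\<And>N. N \<ge> N0 \<Longrightarrow> infinite {z. (\<forall>i. cmod ((e.\<Phi> ^^ i) z) < r) \<and> (e.\<Phi> ^^ N) z = z}" by blast
  \<comment> \<open>At least \<open>N0\<close>, and not a multiple of 3.\<close>
  define N where "N = 3 * N0 + 1"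
  define A where "A = {z. (\<forall>i. cmod ((e.\<Phi> ^^ i) z) < r) \<and> (e.\<Phi> ^^ N) z = z}"
  have "infinite A" unfolding A_def by (rule N0) (simp add: N_def)
  \<comment> \<open>First coordinates along the orbit; the second coordinate of a point is the first
    one of its image.\<close>
  define orb where "orb z n = y + 2 * Re ((e.\<Phi> ^^ n) z)" for z n
  have orb_Suc: "orb z (n + 1) = y + 2 * Re (cis \<omega> * (e.\<Phi> ^^ n) z)" for z n
    by (simp only: orb_def Suc_eq_plus1[symmetric] funpow.simps o_apply Re_\<Phi>)
  have N: "N > 0" "\<not> 3 dvd N" unfolding N_def by presburger+
  have per: "x (n + N) = x n" if x: "x \<in> orb ` A" for x n
  proof -
    obtain z where "z \<in> A" "x = orb z" using x by blast
    then show ?thesis by (simp add: orb_def funpow_add A_def)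
  qed
  have eq: "\<bar>x n - y\<bar> < \<rho> \<and> x (n + 2) = - x n + \<phi> (x (n + 1))" if x: "x \<in> orb ` A" for x n
  proof -
    obtain z where z: "z \<in> A" "x = orb z" using x by blast
    have "orb z (n + 2) = y + 2 * Re (cis \<omega> * e.\<Phi> ((e.\<Phi> ^^ n) z))"
      using orb_Suc[of z "n + 1"] by (simp only: Suc_eq_plus1[symmetric] funpow.simps o_apply) simp
    also have "\<dots> = - orb z n + \<phi> (orb z (n + 1))"
      unfolding Re_\<Phi>' orb_Suc by (simp add: orb_def)
    finally have "x (n + 2) = - x n + \<phi> (x (n + 1))" by (simp add: z(2))
    moreover have "\<bar>x n - y\<bar> < \<rho>" using Re_less(1)[of "(e.\<Phi> ^^ n) z"] z by (simp add: orb_def A_def)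
    ultimately show ?thesis by blast
  qed
  \<comment> \<open>Entries 0 and 1 of an orbit are the two coordinates of its initial point, so
    finitely many values of each leave finitely many points.\<close>
  have "finite ((\<lambda>x. x 0) ` (orb ` A))" by (rule fin[OF N per eq]) simp_all
  moreover have "finite ((\<lambda>x. x 1) ` (orb ` A))" by (rule fin[OF N per eq]) simp_all
  ultimately have "finite ((\<lambda>(s, t). e.coord (s - y) (t - y)) ` ((\<lambda>x. x 0) ` (orb ` A) \<times> (\<lambda>x. x 1) ` (orb ` A)))"
    by (rule finite_imageI[OF finite_cartesian_product])
  moreover have "A \<subseteq> (\<lambda>(s, t). e.coord (s - y) (t - y)) ` ((\<lambda>x. x 0) ` (orb ` A) \<times> (\<lambda>x. x 1) ` (orb ` A))"
  proof
    fix z assume "z \<in> A"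
    then have "(orb z 0, orb z 1) \<in> (\<lambda>x. x 0) ` (orb ` A) \<times> (\<lambda>x. x 1) ` (orb ` A)" by blast
    moreover have "orb z 0 - y = 2 * Re z" "orb z 1 - y = 2 * Re (cis \<omega> * z)"
      using orb_Suc[of z 0] by (simp_all add: orb_def)
    then have "e.coord (orb z 0 - y) (orb z 1 - y) = z" by (simp only: e.coord_Re)
    ultimately show "z \<in> (\<lambda>(s, t). e.coord (s - y) (t - y)) ` ((\<lambda>x. x 0) ` (orb ` A) \<times> (\<lambda>x. x 1) ` (orb ` A))"
      by force
  qed
  ultimately have "finite A" by (rule finite_subset[rotated])
  with \<open>infinite A\<close> show False by simp
qed

lemma finite_periodic_coordinates:
  fixes g h :: ratfun
  assumes deg: "rat_degree g > 1 \<or> rat_degree h > 2" and deg_neq: "2 * rat_degree g \<noteq> rat_degree h"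
    and N: "N > 0" "\<not> 3 dvd N"
    and per: "\<And>x n. x \<in> S \<Longrightarrow> x (n + N) = x n"
    and eq: "\<And>x n. x \<in> S \<Longrightarrow> x (n + 2) = - x n + (sqrt ((x (n + 1))\<^sup>2 + 1 + \<epsilon> * rat_eval h (x (n + 1))) + \<epsilon> * rat_eval g (x (n + 1)))"
    and dom: "\<And>x n. x \<in> S \<Longrightarrow> poly (rat_den g) (x n) \<noteq> 0 \<and> poly (rat_den h) (x n) \<noteq> 0 \<and>
        (x n)\<^sup>2 + 1 + \<epsilon> * rat_eval h (x n) > 0"
    and j: "j < N + 2"
  shows "finite ((\<lambda>x::nat \<Rightarrow> real. x j) ` S)"
proof (cases "S = {}")
  case False
  then obtain x0 where x0: "x0 \<in> S" by blast
  \<comment> \<open>Squaring forgets the sign of the root. It can only add solutions, which does no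
    harm to a finiteness claim.\<close>
  have sq: "(x (n + 2) + x n - \<epsilon> * rat_eval g (x (n + 1)))\<^sup>2 = (x (n + 1))\<^sup>2 + 1 + \<epsilon> * rat_eval h (x (n + 1))"
    if "x \<in> S" for x n
    using eq[OF that, of n] dom[OF that, of "n + 1"] by simp
  show ?thesis
  proof (cases "\<epsilon> = 0")
    case True
    show ?thesis
      by (rule finite_coordinate_values_cohen[OF N(2) per _ j]) (use sq True in auto)
  next
    case False
    show ?thesis
    proof (rule finite_coordinate_values_rational[where Q = "rat_den g" and T = "rat_den h" and
          P = "rat_num g" and R = "rat_num h", OF N(1) per _ _ False _ _ _ j])
      show "rat_den g \<noteq> 0" "rat_den h \<noteq> 0" using dom[OF x0, of 0] by auto
      show "1 < int (degree (rat_num g)) - int (degree (rat_den g)) \<or> 2 < int (degree (rat_num h)) - int (degree (rat_den h))"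
        "2 * (int (degree (rat_num g)) - int (degree (rat_den g))) \<noteq> int (degree (rat_num h)) - int (degree (rat_den h))"
        using deg deg_neq unfolding rat_degree_def .
      fix x n assume x: "x \<in> S"
      let ?y = "x (n + 1)" and ?s = "x (n + 2) + x n"
      let ?P = "poly (rat_num g) ?y" and ?Q = "poly (rat_den g) ?y" and ?R = "poly (rat_num h) ?y" and ?T = "poly (rat_den h) ?y"
      have nz: "?Q \<noteq> 0" "?T \<noteq> 0" using dom[OF x] by auto
      have 1: "?Q * ?s - \<epsilon> * ?P = ?Q * (?s - \<epsilon> * (?P / ?Q))" using nz by (simp add: right_diff_distrib)
      have 2: "?T * (?y\<^sup>2 + 1) + \<epsilon> * ?R = ?T * (?y\<^sup>2 + 1 + \<epsilon> * (?R / ?T))" using nz by (simp add: distrib_left)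
      show "?T * (?Q * ?s - \<epsilon> * ?P)\<^sup>2 = ?Q\<^sup>2 * (?T * (?y\<^sup>2 + 1) + \<epsilon> * ?R)"
        using sq[OF x, of n] unfolding rat_eval_def 1 2 power_mult_distrib by (simp only: mult_ac)
    qed
  qed
qed simp

text \<open>Other elliptic fixed points may escape to infinity or to poles as \<epsilon> tends to 0.
  Choosing the ball before \<epsilon> singles out the continuation of \<open>p0\<close>.\<close>

theorem corollary10:
  fixes g h :: ratfun and p0 :: "real^2"
  assumes deg: "rat_degree g > 1 \<or> rat_degree h > 2"
    and deg_neq: "2 * rat_degree g \<noteq> rat_degree h"
    and ell0: "elliptic_fixed_point (H_dom g h 0) (H_map g h 0) p0"
  shows "\<exists>r>0. \<exists>\<epsilon>0>0. \<forall>\<epsilon>. \<bar>\<epsilon>\<bar> < \<epsilon>0 \<longrightarrow>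
           (\<exists>p\<in>ball p0 r.
              elliptic_fixed_point (H_dom g h \<epsilon>) (H_map g h \<epsilon>) p \<and>
              (\<forall>q\<in>ball p0 r. elliptic_fixed_point (H_dom g h \<epsilon>) (H_map g h \<epsilon>) q \<longrightarrow> q = p) \<and>
              \<not> locally_integrable_at 6 (H_dom g h \<epsilon>) (H_map g h \<epsilon>) p)"
proof -
  define y0 :: real where "y0 = 1 / sqrt 3"
  define X where "X = {y. poly (rat_den g) y \<noteq> 0 \<and> poly (rat_den h) y \<noteq> 0}"
  have "p0 \<in> H_dom g h 0" "H_map g h 0 p0 = p0"
    using ell0 interior_subset unfolding elliptic_fixed_point_def by blast+
  then have "p0 $ 2 \<in> X" and fix1: "p0 $ 1 = p0 $ 2" and fix2: "2 * p0 $ 2 = sqrt ((p0 $ 2)\<^sup>2 + 1)"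
    by (auto simp: H_dom_def H_map_def X_def rat_defined_at_def Let_def vec_eq_iff forall_2)
  \<comment> \<open>The square root makes the coordinate nonnegative, which selects the root 1 /
    sqrt 3 of 4 y^2 = y^2 + 1.\<close>
  have p2: "p0 $ 2 = y0"
  proof -
    have "p0 $ 2 \<ge> 0" using fix2 by (smt (verit) real_sqrt_ge_zero zero_le_power2)
    moreover have "(2 * p0 $ 2)\<^sup>2 = (p0 $ 2)\<^sup>2 + 1" unfolding fix2 by simp
    then have "(p0 $ 2)\<^sup>2 = 1 / 3" by (simp add: power_mult_distrib)
    ultimately have "p0 $ 2 = sqrt (1 / 3)" by (metis real_sqrt_unique)
    then show ?thesis by (simp add: y0_def real_sqrt_divide)
  qed
  have p0: "p0 = vector [y0, y0]" using fix1 p2 by (simp add: vec_eq_iff forall_2)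
  obtain G where G: "G 0 = (\<lambda>y. poly (rat_num g) y / poly (rat_den g) y)"
    "\<And>k y. poly (rat_den g) y \<noteq> 0 \<Longrightarrow> (G k has_real_derivative G (Suc k) y) (at y)"
    using rational_derivatives[of "rat_num g" "rat_den g"] by blast
  obtain H where H: "H 0 = (\<lambda>y. poly (rat_num h) y / poly (rat_den h) y)"
    "\<And>k y. poly (rat_den h) y \<noteq> 0 \<Longrightarrow> (H k has_real_derivative H (Suc k) y) (at y)"
    using rational_derivatives[of "rat_num h" "rat_den h"] by blast
  interpret cf: cohen_family G H X y0
  proof
    show "open X" unfolding X_def by (intro open_Collect_conj open_Collect_neq continuous_intros)
  qed (use \<open>p0 $ 2 \<in> X\<close> p2 G H in \<open>auto simp: X_def y0_def\<close>)
  have G0: "G 0 y = rat_eval g y" and H0: "H 0 y = rat_eval h y" for y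
    by (simp_all add: G H rat_eval_def)
  have F: "H_map g h \<epsilon> v = vector [v $ 2, - v $ 1 + cf.f \<epsilon> (v $ 2)]" for \<epsilon> v
    by (simp add: H_map_def Let_def cf.f_def cf.P_def G0 H0 algebra_simps)
  obtain \<delta> where \<delta>: "\<delta> > 0" and good: "\<And>\<epsilon> y. \<bar>\<epsilon>\<bar> < \<delta> \<Longrightarrow> \<bar>y - y0\<bar> < \<delta> \<Longrightarrow>
     y \<in> X \<and> cf.P \<epsilon> y > 0 \<and> 0 < cf.D1 \<epsilon> y \<and> cf.D1 \<epsilon> y < 1 \<and> cf.twist_num \<epsilon> y < 0"
    using cf.good_neighborhood by blast
  obtain \<epsilon>1 where \<epsilon>1: "\<epsilon>1 > 0" "\<And>\<epsilon>. \<bar>\<epsilon>\<bar> < \<epsilon>1 \<Longrightarrow> \<exists>y. \<bar>y - y0\<bar> \<le> \<delta> / 2 \<and> cf.f \<epsilon> y = 2 * y \<and>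
           (\<forall>z. \<bar>z - y0\<bar> < \<delta> \<longrightarrow> cf.f \<epsilon> z = 2 * z \<longrightarrow> z = y)"
    using cf.fixed_point_continuation[OF \<delta>] good by blast
  show ?thesis
  proof (rule exI[of _ \<delta>], rule conjI[OF \<delta>], rule exI[of _ "min \<epsilon>1 \<delta>"], intro conjI allI impI)
    fix \<epsilon> assume "\<bar>\<epsilon>\<bar> < min \<epsilon>1 \<delta>"
    then have \<epsilon>: "\<bar>\<epsilon>\<bar> < \<epsilon>1" "\<bar>\<epsilon>\<bar> < \<delta>" by auto
    obtain y where y: "\<bar>y - y0\<bar> \<le> \<delta> / 2" "cf.f \<epsilon> y = 2 * y"
      and uniq: "\<And>z. \<bar>z - y0\<bar> < \<delta> \<Longrightarrow> cf.f \<epsilon> z = 2 * z \<Longrightarrow> z = y"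
      using \<epsilon>1(2)[OF \<epsilon>(1)] by blast
    have y': "\<bar>y - y0\<bar> < \<delta>" using y(1) \<delta> by linarith
    note good_y = good[OF \<epsilon>(2) y']
    define p :: "real^2" where "p = vector [y, y]"
    \<comment> \<open>As |y - y0| \<le> \<delta> / 2, the \<rho>-neighbourhood of \<open>y\<close>
      stays within the good \<delta>-neighbourhood of \<open>y0\<close>.\<close>
    define \<rho> where "\<rho> = \<delta> / 2"
    have \<rho>: "\<rho> > 0" using \<delta> by (simp add: \<rho>_def)
    have near: "z \<in> X \<and> cf.P \<epsilon> z > 0" if "\<bar>z - y\<bar> < \<rho>" for z
    proof -
      have "\<bar>z - y0\<bar> < \<delta>" using that y(1) unfolding \<rho>_def by linarith
      then show ?thesis using good[OF \<epsilon>(2)] by blast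
    qed
    \<comment> \<open>Both coordinates move by the same amount, so the distance is sqrt 2 |y - y0|,
      at most \<delta> / sqrt 2.\<close>
    have dist_p: "dist p0 p < \<delta>"
    proof -
      have "(dist p0 p)\<^sup>2 = 2 * (y - y0)\<^sup>2"
        unfolding dist_norm power2_norm_eq_inner
        by (simp add: p0 p_def inner_vec_def sum_2 power2_eq_square algebra_simps)
      also have "(y - y0)\<^sup>2 \<le> (\<delta> / 2)\<^sup>2" using y(1) \<delta> by (simp add: abs_le_square_iff[symmetric])
      finally have "(dist p0 p)\<^sup>2 \<le> \<delta>\<^sup>2 / 2" by (simp add: power_divide)
      also have "\<dots> < \<delta>\<^sup>2" using \<delta> by simp
      finally show ?thesis by (rule power2_less_imp_less) (use \<delta> in simp)
    qed
    have ell: "elliptic_fixed_point (H_dom g h \<epsilon>) (H_map g h \<epsilon>) p"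
    proof (rule elliptic_fixed_pointI)
      have "open {v::real^2. \<bar>v $ 2 - y\<bar> < \<rho>}" by (intro open_Collect_less continuous_intros)
      moreover have "{v::real^2. \<bar>v $ 2 - y\<bar> < \<rho>} \<subseteq> H_dom g h \<epsilon>"
        using near by (auto simp: H_dom_def rat_defined_at_def X_def cf.P_def H0 less_imp_le)
      ultimately show "p \<in> interior (H_dom g h \<epsilon>)"
        using \<rho> by (intro interiorI) (auto simp: p_def)
      show "H_map g h \<epsilon> p = p" unfolding F using y(2) by (simp add: p_def vec_eq_iff forall_2)
      show "\<bar>cf.D1 \<epsilon> y\<bar> < 2" using good_y by auto
      have nth: "((\<lambda>v::real^2. v $ i) has_derivative (\<lambda>h. h $ i)) (at p)" for i
        by (rule bounded_linear_imp_has_derivative[OF bounded_linear_vec_nth])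
      have "(cf.f \<epsilon> has_derivative (\<lambda>h. cf.D1 \<epsilon> y * h)) (at (p $ 2))"
        using cf.f_derivs(1) good_y unfolding has_field_derivative_def by (simp add: p_def)
      from has_derivative_compose[OF nth this]
      have f: "((\<lambda>v::real^2. cf.f \<epsilon> (v $ 2)) has_derivative (\<lambda>h. cf.D1 \<epsilon> y * h $ 2)) (at p)" .
      have vec: "vector [s, t] = s *\<^sub>R axis 1 1 + t *\<^sub>R (axis 2 1 :: real^2)" for s t :: real
        by (simp add: vec_eq_iff forall_2 axis_def)
      show "(H_map g h \<epsilon> has_derivative (\<lambda>k. vector [k $ 2, - k $ 1 + cf.D1 \<epsilon> y * k $ 2])) (at p)"
        unfolding F[abs_def] vec
        by (intro has_derivative_add has_derivative_scaleR_left has_derivative_minus f nth)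
    qed
    have unique: "q = p" if q: "q \<in> ball p0 \<delta>" "elliptic_fixed_point (H_dom g h \<epsilon>) (H_map g h \<epsilon>) q" for q
    proof -
      have "H_map g h \<epsilon> q = q" using q(2) by (simp add: elliptic_fixed_point_def)
      then have fq: "q $ 1 = q $ 2" "cf.f \<epsilon> (q $ 2) = 2 * q $ 2"
        unfolding F by (auto simp: vec_eq_iff forall_2)
      have "\<bar>q $ 2 - y0\<bar> \<le> dist p0 q"
        using component_le_norm_cart[of "q - p0" 2] by (simp add: p0 dist_norm norm_minus_commute)
      then have "q $ 2 = y" using q(1) fq(2) by (intro uniq) auto
      then show ?thesis using fq(1) by (simp add: p_def vec_eq_iff forall_2)
    qed
    have not_int: "\<not> locally_integrable_at 6 (H_dom g h \<epsilon>) (H_map g h \<epsilon>) p"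
    proof -
      have expn: "elliptic_expansion (arccos (cf.D1 \<epsilon> y / 2)) (cf.D2 \<epsilon> y / 2) (cf.D3 \<epsilon> y / 6) (\<lambda>u. cf.f \<epsilon> (y + u) - 2 * y)"
        "elliptic_expansion.twist_coeff (arccos (cf.D1 \<epsilon> y / 2)) (cf.D2 \<epsilon> y / 2) (cf.D3 \<epsilon> y / 6) \<noteq> 0"
        using cf.elliptic_expansion_at_fixed_point[of y \<rho> \<epsilon>, OF near \<rho> y(2)] good_y by auto
      have "\<not> locally_integrable_at (Suc (Suc 4)) (H_dom g h \<epsilon>) (H_map g h \<epsilon>) p"
      proof (rule not_locally_integrable_second_order[OF expn F p_def \<rho>])
        show "isCont (cf.f \<epsilon>) z" if "\<bar>z - y\<bar> < \<rho>" for z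
          using cf.f_derivs(1) near[OF that] DERIV_isCont by blast
        fix N j :: nat and S :: "(nat \<Rightarrow> real) set"
        assume *: "N > 0" "\<not> 3 dvd N" "\<And>x n. x \<in> S \<Longrightarrow> x (n + N) = x n"
          "\<And>x n. x \<in> S \<Longrightarrow> \<bar>x n - y\<bar> < \<rho> \<and> x (n + 2) = - x n + cf.f \<epsilon> (x (n + 1))" "j < N + 2"
        show "finite ((\<lambda>x::nat \<Rightarrow> real. x j) ` S)"
        proof (rule finite_periodic_coordinates[OF deg deg_neq *(1,2,3) _ _ *(5)])
          fix x n assume x: "x \<in> S"
          show "x (n + 2) = - x n + (sqrt ((x (n + 1))\<^sup>2 + 1 + \<epsilon> * rat_eval h (x (n + 1))) + \<epsilon> * rat_eval g (x (n + 1)))"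
            using *(4)[OF x, of n] by (simp add: cf.f_def cf.P_def G0 H0)
          show "poly (rat_den g) (x n) \<noteq> 0 \<and> poly (rat_den h) (x n) \<noteq> 0 \<and> (x n)\<^sup>2 + 1 + \<epsilon> * rat_eval h (x n) > 0"
            using near[of "x n"] *(4)[OF x, of n] by (auto simp: X_def cf.P_def H0)
        qed
      qed
      then show ?thesis by (simp add: numeral_eq_Suc)
    qed
    show "\<exists>p\<in>ball p0 \<delta>. elliptic_fixed_point (H_dom g h \<epsilon>) (H_map g h \<epsilon>) p \<and>
        (\<forall>q\<in>ball p0 \<delta>. elliptic_fixed_point (H_dom g h \<epsilon>) (H_map g h \<epsilon>) q \<longrightarrow> q = p) \<and>
        \<not> locally_integrable_at 6 (H_dom g h \<epsilon>) (H_map g h \<epsilon>) p"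
    proof (intro bexI[of _ p] conjI ballI impI)
      show "p \<in> ball p0 \<delta>" using dist_p by simp
    qed (fact ell, rule unique, assumption+, fact not_int)
  qed (use \<delta> \<epsilon>1 in auto)
qed

end
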